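(* Let $(\mathbb{G},\Gamma)$ be a finite graph of groups whose underlying graph $\Gamma$ is a finite tree and all of whose vertex groups are finite, and suppose that $(\mathbb{G},\Gamma)$ satisfies the normalizer condition. Then the fundamental group $G=\pi_1(\mathbb{G},\Gamma)$ is subgroup into-conjugacy separable; that is, for any two finitely generated subgroups $H_1,H_2\leqslant G$ such that $H_2$ is not conjugate into $H_1$ in $G$, there exists a homomorphism $\phi$ from $G$ to a finite group $\overline{G}$ such that $\phi(H_2)$ is not conjugate into $\phi(H_1)$ in $\overline{G}$.
   Context: For two subgroups $A,B$ of a group $G$, $A$ is said to be conjugate into $B$ (in $G$) if there is $g\in G$ such that $A^g$ is a subgroup of $B$, where $A^g$ denotes the conjugate of $A$ by $g$. A graph of groups $(\mathbb{G},\Gamma)$ consists of a connected graph $\Gamma$ (in the sense of Serre, each edge $e$ having an inverse $\overline{e}$, initial vertex $i(e)$ and terminal vertex $t(e)$), vertex groups $G_v$ ($v\in\Gamma^0$), edge groups $G_e=G_{\overline{e}}$ ($e\in\Gamma^1$), and boundary monomorphisms $\rho_e^i:G_e\to G_{i(e)}$, $\rho_e^t:G_e\to G_{t(e)}$ with $\rho_e^i=\rho_{\overline{e}}^t$. Its fundamental group $\pi_1(\mathbb{G},\Gamma)$ is the usual (Bass–Serre) one; when $\Gamma$ is a tree it is the iterated amalgamated product of the vertex groups along the edge groups. Vertex groups and edge groups embed in $G=\pi_1(\mathbb{G},\Gamma)$, canonically up to conjugacy, and are regarded as subgroups of $G$. Normalizer condition: a finite graph of finite groups $(\mathbb{G},\Gamma)$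 with $G=\pi_1(\mathbb{G},\Gamma)$ satisfies the normalizer condition if $|N_G(E):E|<\infty$ for each nontrivial subgroup $E$ of every edge group (viewed as a subgroup of $G$), where $N_G(E)$ is the normalizer of $E$ in $G$. *)

theory Defs
  imports
    "HOL-Algebra.Generated_Groups"
    "HOL-Algebra.Group_Action"
    "Graph_Theory.Bidirected_Digraph"
    "Graph_Theory.Arc_Walk"
    "Graph_Theory.Digraph_Component"
begin

section \<open>Graphs of groups\<close>

text \<open>
  A graph in the sense of Serre is a \<^locale>\<open>bidirected_digraph\<close>: the arcs are the oriented
  edges, \<^const>\<open>tail\<close> and \<^const>\<open>head\<close> are the initial and the terminal vertex, and
  the reversal is a fixed-point-free involution of the arcs (it is the identity outside the arcs).

  Seen as a digraph, every pair of mutually inverse edges is a cycle of length two, so the constant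
  \<^const>\<open>tree\<close> of the digraph library is not the right notion. A circuit in the sense of Serre
  is a cycle (of any length, loops included) not of the form of an edge followed by its inverse.
\<close>

definition serre_tree :: "('v, 'e) pre_digraph \<Rightarrow> ('e \<Rightarrow> 'e) \<Rightarrow> bool" where
  "serre_tree \<Gamma> inve \<longleftrightarrow>
     bidirected_digraph \<Gamma> inve \<and> connected \<Gamma> \<and>
     \<not> (\<exists>p. pre_digraph.cycle \<Gamma> p \<and> (\<forall>e. p \<noteq> [e, inve e]))"

text \<open>
  All vertex groups have their carriers in one type, and so do all edge groups; this is no
  restriction, since the types are arbitrary.
\<close>

record ('v, 'e, 'a, 'b) graph_of_groups =
  base_graph :: "('v, 'e) pre_digraph"
  edge_inv :: "'e \<Rightarrow> 'e"
  vertex_group :: "'v \<Rightarrow> 'a monoid"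
  edge_group :: "'e \<Rightarrow> 'b monoid"
  rho_i :: "'e \<Rightarrow> 'b \<Rightarrow> 'a"
  rho_t :: "'e \<Rightarrow> 'b \<Rightarrow> 'a"

locale graph_of_groups =
  fixes X :: "('v, 'e, 'a, 'b) graph_of_groups"
  assumes base_bidirected: "bidirected_digraph (base_graph X) (edge_inv X)"
    and base_connected: "connected (base_graph X)"
    and vertex_group: "v \<in> verts (base_graph X) \<Longrightarrow> group (vertex_group X v)"
    and edge_group: "e \<in> arcs (base_graph X) \<Longrightarrow> group (edge_group X e)"
    and edge_group_inv: "e \<in> arcs (base_graph X) \<Longrightarrow> edge_group X (edge_inv X e) = edge_group X e"
    and rho_i: "e \<in> arcs (base_graph X) \<Longrightarrow>
      rho_i X e \<in> mon (edge_group X e) (vertex_group X (tail (base_graph X) e))"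
    and rho_t: "e \<in> arcs (base_graph X) \<Longrightarrow>
      rho_t X e \<in> mon (edge_group X e) (vertex_group X (head (base_graph X) e))"
    and rho_inv: "e \<in> arcs (base_graph X) \<Longrightarrow> g \<in> carrier (edge_group X e) \<Longrightarrow>
      rho_i X e g = rho_t X (edge_inv X e) g"


section \<open>The fundamental group\<close>

text \<open>
  The Bass--Serre fundamental group with respect to (the set \<open>T\<close> of edges of) a maximal
  subtree: the group generated by the disjoint union of the vertex groups together with a letter
  for every edge, subject to the relations of the vertex groups and the relations in the
  last three rules below. The inverse of a vertex letter or of an edge letter is again a letter,
  so the group is the quotient of the monoid of words by the congruence generated by the
  relations.

  If the base graph is a tree, the only maximal subtree is the whole graph, all edge letters are
  trivial, and the group is the (iterated) amalgamated product of the vertex groups along the edge groups.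
\<close>

datatype ('v, 'e, 'a) letter = Vertex 'v 'a | Edge 'e

definition pi1_words ::
    "('v, 'e, 'a, 'b) graph_of_groups \<Rightarrow> ('v, 'e, 'a) letter list set" where
  "pi1_words X = lists
     ({Vertex v g | v g. v \<in> verts (base_graph X) \<and> g \<in> carrier (vertex_group X v)} \<union>
      {Edge e | e. e \<in> arcs (base_graph X)})"

inductive_set pi1_relations ::
    "('v, 'e, 'a, 'b) graph_of_groups \<Rightarrow> 'e set \<Rightarrow>
       (('v, 'e, 'a) letter list \<times> ('v, 'e, 'a) letter list) set"
  for X T where
  vertex_mult: "v \<in> verts (base_graph X) \<Longrightarrow>
      g \<in> carrier (vertex_group X v) \<Longrightarrow> h \<in> carrier (vertex_group X v) \<Longrightarrow>
      ([Vertex v g, Vertex v h], [Vertex v (g \<otimes>\<^bsub>vertex_group X v\<^esub> h)]) \<in> pi1_relations X T"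
| vertex_one: "v \<in> verts (base_graph X) \<Longrightarrow>
      ([Vertex v \<one>\<^bsub>vertex_group X v\<^esub>], []) \<in> pi1_relations X T"
| edge_inverse: "e \<in> arcs (base_graph X) \<Longrightarrow>
      ([Edge e, Edge (edge_inv X e)], []) \<in> pi1_relations X T"
| edge_conj: "e \<in> arcs (base_graph X) \<Longrightarrow> g \<in> carrier (edge_group X e) \<Longrightarrow>
      ([Edge e, Vertex (head (base_graph X) e) (rho_t X e g), Edge (edge_inv X e)],
       [Vertex (tail (base_graph X) e) (rho_i X e g)]) \<in> pi1_relations X T"
| edge_tree: "e \<in> arcs (base_graph X) \<Longrightarrow> e \<in> T \<Longrightarrow> ([Edge e], []) \<in> pi1_relations X T"

inductive_set pi1_cong ::
    "('v, 'e, 'a, 'b) graph_of_groups \<Rightarrow> 'e set \<Rightarrow>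
       (('v, 'e, 'a) letter list \<times> ('v, 'e, 'a) letter list) set"
  for X T where
  base: "u \<in> pi1_words X \<Longrightarrow> w \<in> pi1_words X \<Longrightarrow> (l, r) \<in> pi1_relations X T \<Longrightarrow>
      (u @ l @ w, u @ r @ w) \<in> pi1_cong X T"
| refl: "w \<in> pi1_words X \<Longrightarrow> (w, w) \<in> pi1_cong X T"
| sym: "(u, w) \<in> pi1_cong X T \<Longrightarrow> (w, u) \<in> pi1_cong X T"
| trans: "(u, v) \<in> pi1_cong X T \<Longrightarrow> (v, w) \<in> pi1_cong X T \<Longrightarrow> (u, w) \<in> pi1_cong X T"

definition pi1 ::
    "('v, 'e, 'a, 'b) graph_of_groups \<Rightarrow> 'e set \<Rightarrow> ('v, 'e, 'a) letter list set monoid" where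
  "pi1 X T =
     \<lparr> carrier = pi1_words X // pi1_cong X T,
       monoid.mult = (\<lambda>A B. \<Union>a\<in>A. \<Union>b\<in>B. pi1_cong X T `` {a @ b}),
       one = pi1_cong X T `` {[]} \<rparr>"

definition vertex_emb ::
    "('v, 'e, 'a, 'b) graph_of_groups \<Rightarrow> 'e set \<Rightarrow> 'v \<Rightarrow> 'a \<Rightarrow> ('v, 'e, 'a) letter list set" where
  "vertex_emb X T v g = pi1_cong X T `` {[Vertex v g]}"

text \<open>
  Embedding the edge group through the terminal vertex instead changes its image by a conjugation
  only, and not at all for the edges in \<open>T\<close>.
\<close>

definition edge_emb ::
    "('v, 'e, 'a, 'b) graph_of_groups \<Rightarrow> 'e set \<Rightarrow> 'e \<Rightarrow> 'b \<Rightarrow> ('v, 'e, 'a) letter list set" where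
  "edge_emb X T e g = vertex_emb X T (tail (base_graph X) e) (rho_i X e g)"

definition normalizer_condition :: "('v, 'e, 'a, 'b) graph_of_groups \<Rightarrow> 'e set \<Rightarrow> bool" where
  "normalizer_condition X T \<longleftrightarrow>
     (\<forall>e \<in> arcs (base_graph X). \<forall>E. subgroup E (edge_group X e) \<and> E \<noteq> {\<one>\<^bsub>edge_group X e\<^esub>} \<longrightarrow>
        finite (rcosets\<^bsub>(pi1 X T)\<lparr>carrier := normalizer (pi1 X T) (edge_emb X T e ` E)\<rparr>\<^esub>
                  (edge_emb X T e ` E)))"


section \<open>Subgroup into-conjugacy separability\<close>

definition conjugate_into :: "('g, 'm) monoid_scheme \<Rightarrow> 'g set \<Rightarrow> 'g set \<Rightarrow> bool" where
  "conjugate_into G A B \<longleftrightarrow>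
     (\<exists>g \<in> carrier G. subgroup (inv\<^bsub>G\<^esub> g <#\<^bsub>G\<^esub> A #>\<^bsub>G\<^esub> g) (G\<lparr>carrier := B\<rparr>))"

definition fg_subgroup :: "('g, 'm) monoid_scheme \<Rightarrow> 'g set \<Rightarrow> bool" where
  "fg_subgroup G H \<longleftrightarrow> (\<exists>S. finite S \<and> S \<subseteq> carrier G \<and> H = generate G S)"

text \<open>
  Every finite group is isomorphic to one whose carrier is a set of natural numbers.
\<close>

definition subgroup_into_conjugacy_separable :: "('g, 'm) monoid_scheme \<Rightarrow> bool" where
  "subgroup_into_conjugacy_separable G \<longleftrightarrow>
     (\<forall>H1 H2. fg_subgroup G H1 \<and> fg_subgroup G H2 \<and> \<not> conjugate_into G H2 H1 \<longrightarrow>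
        (\<exists>(Q :: nat monoid) \<phi>. group Q \<and> finite (carrier Q) \<and> \<phi> \<in> hom G Q \<and>
           \<not> conjugate_into Q (\<phi> ` H2) (\<phi> ` H1)))"

end

theory Submission
  imports Defs
begin

text \<open>
  It suffices to find a finite \<open>G\<close>-set with a point fixed by \<open>H\<^sub>1\<close> and without points fixed by
  \<open>H\<^sub>2\<close>; the \<open>G\<close>-set of cosets of \<open>H\<^sub>1\<close> has these properties, but is infinite. By the universal
  property of the tree product, a \<open>G\<close>-set is a family of actions of the vertex groups that agree
  on the edge groups, so it can be modified locally. The geometry of the Bass--Serre tree and
  the normalizer condition imply that a nontrivial element of a vertex group fixes only
  finitely many cosets of \<open>H\<^sub>1\<close>. Hence a large finite part \<open>B'\<close> of the coset space, outside of
  which the vertex groups act freely, can be completed by free orbits to a finite \<open>G\<close>-set.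
  To remove the unwanted fixed points far from the core \<open>B\<close> of \<open>B'\<close>, this \<open>G\<close>-set is
  multiplied by a finite \<open>G\<close>-set in which some element of \<open>H\<^sub>2\<close> has no fixed points, and the
  action on the second factor is made trivial over \<open>B\<close>, so that \<open>H\<^sub>1\<close> still fixes a point.
\<close>

section \<open>The fundamental group as a group\<close>

text \<open>A completion is arbitrary outside \<open>B'\<close>, so it may create points fixed by
  \<open>H2\<close> there, and enlarging \<open>B'\<close> does not exclude this. The second factor
  \<open>Q\<close> does, since some \<open>f\<close> in \<open>H2\<close> has no fixed point in it.
  The plain product with \<open>Q\<close>, however, may lose the point fixed by \<open>H1\<close>;
  hence the twist, with trivial action on \<open>Q\<close> over the core and the product action far
  from it. Both the completion and the twist need edge groups to act freely wherever data at the two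
  ends of an edge are matched. This is what the normalizer condition provides: the cosets fixed by
  nontrivial vertex elements are finite in number and can all be put into the core. The margin
  between the core \<open>B\<close> and \<open>B'\<close> then yields a dichotomy for a candidate
  fixed point of \<open>H2\<close>. Either it is so close to the core that the generators of
  \<open>H2\<close> act on it as on a coset of \<open>H1\<close>, and these have no common fixed
  coset; or it is so far away that \<open>f\<close> acts by the product action.\<close>

context graph_of_groups
begin

sublocale base: bidirected_digraph "base_graph X" "edge_inv X"
  by (rule base_bidirected)

fun letter_inv :: "('v, 'e, 'a) letter \<Rightarrow> ('v, 'e, 'a) letter" where
  "letter_inv (Vertex v g) = Vertex v (inv\<^bsub>vertex_group X v\<^esub> g)"
| "letter_inv (Edge e) = Edge (edge_inv X e)"

lemma pi1_words_append [simp]: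
  "u @ w \<in> pi1_words X \<longleftrightarrow> u \<in> pi1_words X \<and> w \<in> pi1_words X"
  by (auto simp: pi1_words_def)

lemma pi1_words_Nil [simp]: "[] \<in> pi1_words X"
  by (simp add: pi1_words_def)

lemma pi1_words_Cons:
  "l # w \<in> pi1_words X \<longleftrightarrow>
    (case l of Vertex v g \<Rightarrow> v \<in> verts (base_graph X) \<and> g \<in> carrier (vertex_group X v)
      | Edge e \<Rightarrow> e \<in> arcs (base_graph X)) \<and> w \<in> pi1_words X"
  by (auto simp: pi1_words_def split: letter.splits)

lemma rho_i_closed:
  "e \<in> arcs (base_graph X) \<Longrightarrow> g \<in> carrier (edge_group X e) \<Longrightarrow>
    rho_i X e g \<in> carrier (vertex_group X (tail (base_graph X) e))"
  using rho_i[of e] by (auto simp: mon_def hom_def)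

lemma rho_t_closed:
  "e \<in> arcs (base_graph X) \<Longrightarrow> g \<in> carrier (edge_group X e) \<Longrightarrow>
    rho_t X e g \<in> carrier (vertex_group X (head (base_graph X) e))"
  using rho_t[of e] by (auto simp: mon_def hom_def)

lemma pi1_relations_words:
  assumes "(l, r) \<in> pi1_relations X T"
  shows "l \<in> pi1_words X \<and> r \<in> pi1_words X"
  using assms
proof cases
  case (vertex_mult v g h)
  then interpret vg: group "vertex_group X v" by (simp add: vertex_group)
  show ?thesis using vertex_mult by (auto simp: pi1_words_Cons)
next
  case (vertex_one v)
  then interpret vg: group "vertex_group X v" by (simp add: vertex_group)
  show ?thesis using vertex_one by (auto simp: pi1_words_Cons)
qed (auto simp: pi1_words_Cons rho_i_closed rho_t_closed)

lemma pi1_cong_words: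
  "(u, w) \<in> pi1_cong X T \<Longrightarrow> u \<in> pi1_words X \<and> w \<in> pi1_words X"
  by (induction rule: pi1_cong.induct) (auto dest: pi1_relations_words)

lemma equiv_pi1_cong: "equiv (pi1_words X) (pi1_cong X T)"
proof (rule equivI)
  show "pi1_cong X T \<subseteq> pi1_words X \<times> pi1_words X"
    using pi1_cong_words by auto
  show "refl_on (pi1_words X) (pi1_cong X T)"
    by (auto simp: refl_on_def intro: pi1_cong.refl)
  show "sym (pi1_cong X T)"
    by (rule symI) (rule pi1_cong.sym)
  show "trans (pi1_cong X T)"
    by (rule transI) (rule pi1_cong.trans)
qed

lemma pi1_cong_context:
  assumes "(u, w) \<in> pi1_cong X T" "p \<in> pi1_words X" "q \<in> pi1_words X"
  shows "(p @ u @ q, p @ w @ q) \<in> pi1_cong X T"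
  using assms
proof (induction rule: pi1_cong.induct)
  case (base u w l r)
  then show ?case
    using pi1_cong.base[of "p @ u" X "w @ q" l r T] by simp
next
  case (refl w)
  then show ?case by (simp add: pi1_cong.refl)
next
  case (sym u w)
  then show ?case by (blast intro: pi1_cong.sym)
next
  case (trans u v w)
  then show ?case by (blast intro: pi1_cong.trans)
qed

lemma pi1_cong_append:
  assumes "(u, u') \<in> pi1_cong X T" "(w, w') \<in> pi1_cong X T"
  shows "(u @ w, u' @ w') \<in> pi1_cong X T"
proof -
  have "(u @ w, u' @ w) \<in> pi1_cong X T"
    using pi1_cong_context[OF assms(1), of "[]" w] pi1_cong_words[OF assms(2)] by simp
  moreover have "(u' @ w, u' @ w') \<in> pi1_cong X T"
    using pi1_cong_context[OF assms(2), of u' "[]"] pi1_cong_words[OF assms(1)] by simp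
  ultimately show ?thesis by (rule pi1_cong.trans)
qed

lemma pi1_cong_rel: "(l, r) \<in> pi1_relations X T \<Longrightarrow> (l, r) \<in> pi1_cong X T"
  using pi1_cong.base[of "[]" X "[]" l r T] by simp

lemma pi1_class_eq_iff:
  "u \<in> pi1_words X \<Longrightarrow> w \<in> pi1_words X \<Longrightarrow>
    pi1_cong X T `` {u} = pi1_cong X T `` {w} \<longleftrightarrow> (u, w) \<in> pi1_cong X T"
  using eq_equiv_class_iff[OF equiv_pi1_cong] by blast

lemma pi1_mult_class:
  assumes "u \<in> pi1_words X" "w \<in> pi1_words X"
  shows "pi1_cong X T `` {u} \<otimes>\<^bsub>pi1 X T\<^esub> pi1_cong X T `` {w} = pi1_cong X T `` {u @ w}"
proof -
  have "pi1_cong X T `` {a @ b} = pi1_cong X T `` {u @ w}"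
    if "(u, a) \<in> pi1_cong X T" "(w, b) \<in> pi1_cong X T" for a b
    using pi1_cong_append[OF that] equiv_class_eq[OF equiv_pi1_cong] by blast
  then have "pi1_cong X T `` {u} \<otimes>\<^bsub>pi1 X T\<^esub> pi1_cong X T `` {w} =
      (\<Union>a \<in> pi1_cong X T `` {u}. \<Union>b \<in> pi1_cong X T `` {w}. pi1_cong X T `` {u @ w})"
    by (simp add: pi1_def)
  moreover have "u \<in> pi1_cong X T `` {u}" "w \<in> pi1_cong X T `` {w}"
    using assms by (auto intro: pi1_cong.refl)
  ultimately show ?thesis by blast
qed

lemma pi1_carrier: "carrier (pi1 X T) = (\<lambda>w. pi1_cong X T `` {w}) ` pi1_words X"
  by (auto simp: pi1_def quotient_def)

lemma pi1_one: "\<one>\<^bsub>pi1 X T\<^esub> = pi1_cong X T `` {[]}"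
  by (simp add: pi1_def)

lemma letter_inv_cong:
  assumes "[l] \<in> pi1_words X"
  shows "[letter_inv l] \<in> pi1_words X \<and> ([letter_inv l, l], []) \<in> pi1_cong X T"
proof (cases l)
  case (Vertex v g)
  then have v: "v \<in> verts (base_graph X)" and g: "g \<in> carrier (vertex_group X v)"
    using assms by (auto simp: pi1_words_Cons)
  interpret vg: group "vertex_group X v" using v by (rule vertex_group)
  have "([letter_inv l, l], [Vertex v \<one>\<^bsub>vertex_group X v\<^esub>]) \<in> pi1_cong X T"
    using pi1_cong_rel[OF pi1_relations.vertex_mult[of v X "inv\<^bsub>vertex_group X v\<^esub> g" g T]] v g
    by (simp add: Vertex)
  moreover have "([Vertex v \<one>\<^bsub>vertex_group X v\<^esub>], []) \<in> pi1_cong X T"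
    using v by (intro pi1_cong_rel pi1_relations.vertex_one)
  ultimately show ?thesis
    using v g by (auto simp: Vertex pi1_words_Cons intro: pi1_cong.trans)
next
  case (Edge e)
  then have e: "e \<in> arcs (base_graph X)" using assms by (auto simp: pi1_words_Cons)
  then have "([Edge (edge_inv X e), Edge e], []) \<in> pi1_cong X T"
    using pi1_cong_rel[OF pi1_relations.edge_inverse[of "edge_inv X e" X T]] by simp
  then show ?thesis using e by (auto simp: Edge pi1_words_Cons)
qed

lemma word_inv_cong:
  "w \<in> pi1_words X \<Longrightarrow>
    \<exists>u \<in> pi1_words X. (u @ w, []) \<in> pi1_cong X T"
proof (induction w)
  case Nil
  then show ?case by (intro bexI[of _ "[]"]) (auto intro: pi1_cong.refl)
next
  case (Cons l w)
  then have l: "[l] \<in> pi1_words X" and w: "w \<in> pi1_words X"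
    using pi1_words_append[of "[l]" w] by auto
  obtain u where u: "u \<in> pi1_words X" "(u @ w, []) \<in> pi1_cong X T"
    using Cons.IH[OF w] by blast
  have "(u @ [letter_inv l, l] @ w, u @ [] @ w) \<in> pi1_cong X T"
    using letter_inv_cong[OF l] u w by (intro pi1_cong_context) auto
  with u have "((u @ [letter_inv l]) @ l # w, []) \<in> pi1_cong X T"
    by (auto intro: pi1_cong.trans)
  then show ?case using u letter_inv_cong[OF l] pi1_words_append by blast
qed

lemma group_pi1: "group (pi1 X T)"
proof (rule groupI)
  show "\<one>\<^bsub>pi1 X T\<^esub> \<in> carrier (pi1 X T)" by (auto simp: pi1_carrier pi1_one)
next
  fix x y assume "x \<in> carrier (pi1 X T)" "y \<in> carrier (pi1 X T)"
  then show "x \<otimes>\<^bsub>pi1 X T\<^esub> y \<in> carrier (pi1 X T)"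
    by (force simp: pi1_carrier pi1_mult_class)
next
  fix x y z
  assume "x \<in> carrier (pi1 X T)" "y \<in> carrier (pi1 X T)" "z \<in> carrier (pi1 X T)"
  then show "x \<otimes>\<^bsub>pi1 X T\<^esub> y \<otimes>\<^bsub>pi1 X T\<^esub> z = x \<otimes>\<^bsub>pi1 X T\<^esub> (y \<otimes>\<^bsub>pi1 X T\<^esub> z)"
    by (auto simp: pi1_carrier pi1_mult_class)
next
  fix x assume x: "x \<in> carrier (pi1 X T)"
  then show "\<one>\<^bsub>pi1 X T\<^esub> \<otimes>\<^bsub>pi1 X T\<^esub> x = x"
    by (auto simp: pi1_carrier pi1_mult_class pi1_one)
  obtain w where w: "w \<in> pi1_words X" "x = pi1_cong X T `` {w}"
    using x by (auto simp: pi1_carrier)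
  obtain u where u: "u \<in> pi1_words X" "(u @ w, []) \<in> pi1_cong X T"
    using word_inv_cong[OF w(1)] by blast
  have "pi1_cong X T `` {u} \<otimes>\<^bsub>pi1 X T\<^esub> x = \<one>\<^bsub>pi1 X T\<^esub>"
    using u w by (simp add: pi1_mult_class pi1_one pi1_class_eq_iff)
  then show "\<exists>y\<in>carrier (pi1 X T). y \<otimes>\<^bsub>pi1 X T\<^esub> x = \<one>\<^bsub>pi1 X T\<^esub>"
    using u by (auto simp: pi1_carrier)
qed

lemma vertex_emb_hom:
  assumes v: "v \<in> verts (base_graph X)"
  shows "vertex_emb X T v \<in> hom (vertex_group X v) (pi1 X T)"
proof -
  interpret vg: group "vertex_group X v" using v by (rule vertex_group)
  show ?thesis
  proof (rule homI)
    fix g assume "g \<in> carrier (vertex_group X v)"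
    then show "vertex_emb X T v g \<in> carrier (pi1 X T)"
      using v by (auto simp: vertex_emb_def pi1_carrier pi1_words_Cons)
  next
    fix g h assume gh: "g \<in> carrier (vertex_group X v)" "h \<in> carrier (vertex_group X v)"
    have "([Vertex v g, Vertex v h], [Vertex v (g \<otimes>\<^bsub>vertex_group X v\<^esub> h)]) \<in> pi1_cong X T"
      using v gh by (intro pi1_cong_rel pi1_relations.vertex_mult)
    then show "vertex_emb X T v (g \<otimes>\<^bsub>vertex_group X v\<^esub> h) =
        vertex_emb X T v g \<otimes>\<^bsub>pi1 X T\<^esub> vertex_emb X T v h"
      using v gh by (simp add: vertex_emb_def pi1_mult_class pi1_words_Cons pi1_class_eq_iff
        pi1_cong.sym)
  qed
qed

end

section \<open>The universal property in terms of actions\<close>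

text \<open>The acting subset \<open>K\<close> is a parameter beside \<open>G\<close>, so that one
  operation can be restricted to vertex and edge groups without changing the group structure.
  Nothing is asked of \<open>\<alpha>\<close> outside \<open>\<Omega>\<close>, which lets sets be
  cut into invariant pieces and reassembled.\<close>

definition acts :: "('g, 'm) monoid_scheme \<Rightarrow> 'g set \<Rightarrow> ('g \<Rightarrow> 'x \<Rightarrow> 'x) \<Rightarrow> 'x set \<Rightarrow> bool" where
  "acts G K \<alpha> \<Omega> \<longleftrightarrow>
     (\<forall>a\<in>K. \<forall>x\<in>\<Omega>. \<alpha> a x \<in> \<Omega>) \<and> (\<forall>x\<in>\<Omega>. \<alpha> \<one>\<^bsub>G\<^esub> x = x) \<and>
     (\<forall>a\<in>K. \<forall>b\<in>K. \<forall>x\<in>\<Omega>. \<alpha> (a \<otimes>\<^bsub>G\<^esub> b) x = \<alpha> a (\<alpha> b x))"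

lemma acts_closed: "acts G K \<alpha> \<Omega> \<Longrightarrow> a \<in> K \<Longrightarrow> x \<in> \<Omega> \<Longrightarrow> \<alpha> a x \<in> \<Omega>"
  by (simp add: acts_def)

lemma acts_one: "acts G K \<alpha> \<Omega> \<Longrightarrow> x \<in> \<Omega> \<Longrightarrow> \<alpha> \<one>\<^bsub>G\<^esub> x = x"
  by (simp add: acts_def)

lemma acts_mult:
  "acts G K \<alpha> \<Omega> \<Longrightarrow> a \<in> K \<Longrightarrow> b \<in> K \<Longrightarrow> x \<in> \<Omega> \<Longrightarrow> \<alpha> (a \<otimes>\<^bsub>G\<^esub> b) x = \<alpha> a (\<alpha> b x)"
  by (simp add: acts_def)

lemma (in group) acts_inv:
  assumes "acts G K \<alpha> \<Omega>" "subgroup K G" "a \<in> K" "x \<in> \<Omega>"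
  shows "\<alpha> (inv a) (\<alpha> a x) = x" "\<alpha> a (\<alpha> (inv a) x) = x"
proof -
  have a: "a \<in> carrier G" "inv a \<in> K"
    using assms subgroup.mem_carrier subgroup.m_inv_closed by metis+
  show "\<alpha> (inv a) (\<alpha> a x) = x" "\<alpha> a (\<alpha> (inv a) x) = x"
    using assms a acts_mult[of G K \<alpha> \<Omega> "inv a" a x] acts_mult[of G K \<alpha> \<Omega> a "inv a" x]
      acts_one[of G K \<alpha> \<Omega> x] by simp_all
qed

lemma acts_subset: "acts G K \<alpha> \<Omega> \<Longrightarrow> K' \<subseteq> K \<Longrightarrow> acts G K' \<alpha> \<Omega>"
  by (simp add: acts_def subset_iff)

text \<open>The maximal subtree is the whole graph, so the group is \<open>pi1 X D\<close> and every
  edge letter is trivial in it.\<close>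

locale tree_of_finite_groups = graph_of_groups X
  for X :: "('v, 'e, 'a, 'b) graph_of_groups" +
  assumes base_finite: "fin_digraph (base_graph X)"
    and base_tree: "serre_tree (base_graph X) (edge_inv X)"
    and finite_vertex_group: "v \<in> verts (base_graph X) \<Longrightarrow> finite (carrier (vertex_group X v))"
begin

abbreviation V :: "'v set" where "V \<equiv> verts (base_graph X)"
abbreviation D :: "'e set" where "D \<equiv> arcs (base_graph X)"
abbreviation src :: "'e \<Rightarrow> 'v" where "src \<equiv> tail (base_graph X)"
abbreviation tgt :: "'e \<Rightarrow> 'v" where "tgt \<equiv> head (base_graph X)"
abbreviation G :: "('v, 'e, 'a) letter list set monoid" where "G \<equiv> pi1 X D"

definition A :: "'v \<Rightarrow> ('v, 'e, 'a) letter list set set" where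
  "A v = vertex_emb X D v ` carrier (vertex_group X v)"

definition E :: "'e \<Rightarrow> ('v, 'e, 'a) letter list set set" where
  "E e = edge_emb X D e ` carrier (edge_group X e)"

sublocale G: group G
  by (rule group_pi1)

lemma A_subgroup: "v \<in> V \<Longrightarrow> subgroup (A v) G"
proof -
  assume v: "v \<in> V"
  interpret h: group_hom "vertex_group X v" G "vertex_emb X D v"
    by (simp add: group_hom_def group_hom_axioms_def vertex_emb_hom v vertex_group group_pi1)
  show "subgroup (A v) G" unfolding A_def by (rule h.img_is_subgroup)
qed

lemma edge_emb_hom:
  assumes e: "e \<in> D"
  shows "edge_emb X D e \<in> hom (edge_group X e) G"
  using vertex_emb_hom[of "src e" D] rho_i[OF e] e
  by (auto simp: edge_emb_def hom_def mon_def)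

lemma E_subgroup:
  assumes e: "e \<in> D"
  shows "subgroup (E e) G"
proof -
  interpret h: group_hom "edge_group X e" G "edge_emb X D e"
    by (simp add: group_hom_def group_hom_axioms_def edge_group e group_pi1 edge_emb_hom)
  show ?thesis unfolding E_def by (rule h.img_is_subgroup)
qed

lemma finite_A: "v \<in> V \<Longrightarrow> finite (A v)"
  by (simp add: A_def finite_vertex_group)

lemma finite_V: "finite V"
  using base_finite by (simp add: fin_digraph_def fin_digraph_axioms_def)

text \<open>Since edge letters are trivial, the conjugation relation identifies the two boundary
  images of an edge group. This is why \<open>E e\<close> lies in the vertex subgroups at both ends
  of \<open>e\<close>.\<close>

lemma edge_emb_tgt:
  assumes "e \<in> D" "g \<in> carrier (edge_group X e)"
  shows "edge_emb X D e g = vertex_emb X D (tgt e) (rho_t X e g)"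
proof -
  let ?h = "Vertex (tgt e) (rho_t X e g)"
  have w: "[Edge e] \<in> pi1_words X" "[Edge (edge_inv X e)] \<in> pi1_words X" "[?h] \<in> pi1_words X"
      "[Vertex (src e) (rho_i X e g)] \<in> pi1_words X"
    using assms by (auto simp: pi1_words_Cons rho_t_closed rho_i_closed)
  have "([Edge e], []) \<in> pi1_cong X D" "([Edge (edge_inv X e)], []) \<in> pi1_cong X D"
    using assms by (auto intro!: pi1_cong_rel pi1_relations.edge_tree)
  then have "([Edge e] @ [?h] @ [Edge (edge_inv X e)], [] @ [?h] @ []) \<in> pi1_cong X D"
    using w by (intro pi1_cong_append pi1_cong.refl) auto
  moreover have "([Edge e, ?h, Edge (edge_inv X e)], [Vertex (src e) (rho_i X e g)]) \<in> pi1_cong X D"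
    using assms by (intro pi1_cong_rel pi1_relations.edge_conj)
  ultimately have "([Vertex (src e) (rho_i X e g)], [?h]) \<in> pi1_cong X D"
    by (metis append_Cons append_Nil append_Nil2 pi1_cong.sym pi1_cong.trans)
  then show ?thesis using w by (simp add: edge_emb_def vertex_emb_def pi1_class_eq_iff)
qed

lemma E_src: "e \<in> D \<Longrightarrow> E e \<subseteq> A (src e)"
  by (auto simp: E_def A_def edge_emb_def rho_i_closed)

lemma E_tgt: "e \<in> D \<Longrightarrow> E e \<subseteq> A (tgt e)"
  by (auto simp: E_def A_def edge_emb_tgt rho_t_closed)

lemma E_inv: "e \<in> D \<Longrightarrow> E (edge_inv X e) = E e"
proof -
  assume e: "e \<in> D"
  have "edge_emb X D (edge_inv X e) g = edge_emb X D e g" if "g \<in> carrier (edge_group X e)" for g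
  proof -
    have "rho_i X (edge_inv X e) g = rho_t X e g"
      using rho_inv[of "edge_inv X e" g] e that by (simp add: edge_group_inv)
    then show ?thesis using edge_emb_tgt[OF e that] e by (simp add: edge_emb_def)
  qed
  then show ?thesis using e by (auto simp: E_def edge_group_inv)
qed

lemma finite_E: "e \<in> D \<Longrightarrow> finite (E e)"
  using E_src[of e] finite_A[of "src e"] finite_subset by auto

lemma A_carrier: "v \<in> V \<Longrightarrow> a \<in> A v \<Longrightarrow> a \<in> carrier G"
  using A_subgroup subgroup.mem_carrier by metis

lemma E_carrier: "e \<in> D \<Longrightarrow> a \<in> E e \<Longrightarrow> a \<in> carrier G"
  using E_subgroup subgroup.mem_carrier by metis

text \<open>A vertex letter contributes an element of a vertex subgroup and an edge letter the
  identity; this reduces statements about \<open>G\<close> to single vertex elements.\<close>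

lemma class_Cons:
  assumes "l # w \<in> pi1_words X"
  shows "\<exists>a \<in> insert \<one>\<^bsub>G\<^esub> (\<Union>v\<in>V. A v). pi1_cong X D `` {l # w} = a \<otimes>\<^bsub>G\<^esub> pi1_cong X D `` {w}"
proof -
  have lw: "[l] \<in> pi1_words X" "w \<in> pi1_words X"
    using assms pi1_words_append[of "[l]" w] by auto
  have m: "pi1_cong X D `` {l # w} = pi1_cong X D `` {[l]} \<otimes>\<^bsub>G\<^esub> pi1_cong X D `` {w}"
    using lw by (simp add: pi1_mult_class)
  show ?thesis
  proof (cases l)
    case (Vertex v g)
    then show ?thesis using lw m by (auto simp: pi1_words_Cons A_def vertex_emb_def)
  next
    case (Edge e)
    then have "([l], []) \<in> pi1_cong X D"
      using lw by (auto simp: pi1_words_Cons intro!: pi1_cong_rel pi1_relations.edge_tree)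
    then have "pi1_cong X D `` {[l]} = \<one>\<^bsub>G\<^esub>"
      using lw by (simp add: pi1_one pi1_class_eq_iff)
    then show ?thesis using m by auto
  qed
qed

text \<open>A word acts letter by letter, edge letters trivially. The vertex relations are respected
  because each \<open>\<alpha> v\<close> is an action, the conjugation relation because of
  \<open>agree\<close>; hence congruent words act alike.\<close>

theorem ex_action:
  fixes \<alpha> :: "'v \<Rightarrow> ('v, 'e, 'a) letter list set \<Rightarrow> 'x \<Rightarrow> 'x"
  assumes acts: "\<And>v. v \<in> V \<Longrightarrow> acts G (A v) (\<alpha> v) \<Omega>"
    and agree: "\<And>e a x. e \<in> D \<Longrightarrow> a \<in> E e \<Longrightarrow> x \<in> \<Omega> \<Longrightarrow> \<alpha> (src e) a x = \<alpha> (tgt e) a x"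
  obtains \<beta> where "acts G (carrier G) \<beta> \<Omega>"
    and "\<And>v a x. v \<in> V \<Longrightarrow> a \<in> A v \<Longrightarrow> x \<in> \<Omega> \<Longrightarrow> \<beta> a x = \<alpha> v a x"
proof -
  define la where "la l x = (case l of Vertex v g \<Rightarrow> \<alpha> v (vertex_emb X D v g) x | Edge e \<Rightarrow> x)"
    for l :: "('v, 'e, 'a) letter" and x
  define wa where "wa w x = foldr la w x" for w x
  have wa_app: "wa (u @ w) x = wa u (wa w x)" for u w x by (simp add: wa_def)
  have emb: "vertex_emb X D v g \<in> A v" if "g \<in> carrier (vertex_group X v)" for v g
    using that by (auto simp: A_def)
  have la_closed: "la l x \<in> \<Omega>" if "[l] \<in> pi1_words X" "x \<in> \<Omega>" for l x
    using that acts acts_closed[OF acts] emb by (auto simp: la_def pi1_words_Cons split: letter.splits)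
  have wa_closed: "wa w x \<in> \<Omega>" if "w \<in> pi1_words X" "x \<in> \<Omega>" for w x
    using that
  proof (induction w)
    case (Cons l w)
    then have "[l] \<in> pi1_words X" "w \<in> pi1_words X"
      using pi1_words_append[of "[l]" w] by auto
    then show ?case using la_closed Cons by (simp add: wa_def)
  qed (simp add: wa_def)
  have rel: "wa l x = wa r x" if "(l, r) \<in> pi1_relations X D" "x \<in> \<Omega>" for l r x
    using that(1)
  proof cases
    case (vertex_mult v g h)
    then show ?thesis
      using that(2) acts_mult[OF acts] emb vertex_emb_hom[of v D]
      by (auto simp: wa_def la_def hom_def)
  next
    case (vertex_one v)
    interpret h: group_hom "vertex_group X v" G "vertex_emb X D v"
      by (simp add: group_hom_def group_hom_axioms_def vertex_emb_hom vertex_one vertex_group group_pi1)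
    show ?thesis using vertex_one that(2) acts_one[OF acts] h.hom_one
      by (simp add: wa_def la_def)
  next
    case (edge_conj e g)
    then have "edge_emb X D e g \<in> E e" by (auto simp: E_def)
    then have "\<alpha> (src e) (edge_emb X D e g) x = \<alpha> (tgt e) (edge_emb X D e g) x"
      using agree edge_conj that(2) by blast
    then show ?thesis
      using edge_conj edge_emb_tgt[of e g] by (simp add: wa_def la_def edge_emb_def)
  qed (simp_all add: wa_def la_def)
  have cong: "wa u x = wa w x" if "(u, w) \<in> pi1_cong X D" "x \<in> \<Omega>" for u w x
    using that
  proof (induction arbitrary: x rule: pi1_cong.induct)
    case (base u w l r)
    then show ?case using rel wa_closed by (simp add: wa_app)
  qed simp_all
  \<comment> \<open>Any representative of the class will do, since \<open>cong\<close> makes the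
    value independent of it.\<close>
  define \<beta> where "\<beta> c x = wa (SOME w. w \<in> c) x" for c x
  have \<beta>: "\<beta> (pi1_cong X D `` {w}) x = wa w x" if "w \<in> pi1_words X" "x \<in> \<Omega>" for w x
  proof -
    have "w \<in> pi1_cong X D `` {w}" using that pi1_cong.refl[of w X D] by simp
    then have "(SOME u. u \<in> pi1_cong X D `` {w}) \<in> pi1_cong X D `` {w}" by (rule someI)
    then show ?thesis using cong[OF _ that(2)] unfolding \<beta>_def by auto
  qed
  show ?thesis
  proof
    show "acts G (carrier G) \<beta> \<Omega>"
      unfolding acts_def
      using wa_closed by (auto simp: pi1_carrier pi1_mult_class pi1_one \<beta> wa_app)
        (simp add: wa_def)
  next
    fix v a x assume *: "v \<in> V" "a \<in> A v" "x \<in> \<Omega>"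
    then obtain g where g: "g \<in> carrier (vertex_group X v)" "a = vertex_emb X D v g"
      by (auto simp: A_def)
    then show "\<beta> a x = \<alpha> v a x"
      using * \<beta>[of "[Vertex v g]" x] by (simp add: vertex_emb_def pi1_words_Cons wa_def la_def)
  qed
qed

section \<open>Trees\<close>

lemma reach_V:
  assumes "u \<in> V" "v \<in> V"
  shows "(u, v) \<in> ((\<lambda>e. (src e, tgt e)) ` D)\<^sup>*"
proof -
  have "u \<rightarrow>\<^sup>*\<^bsub>mk_symmetric (base_graph X)\<^esub> v"
    using base_connected assms by (auto simp: connected_def)
  then have "u \<rightarrow>\<^sup>*\<^bsub>base_graph X\<^esub> v"
    using base.reachable_mk_symmetric_eq[OF base.sym_arcs] by blast
  then show ?thesis
    unfolding reachable_def
    by (auto dest!: rtrancl_on_rtranclI simp: arcs_ends_conv)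
qed

text \<open>If \<open>tgt e\<close> could be joined to \<open>src e\<close> without \<open>e\<close>
  and its inverse, a path doing so, closed up by \<open>e\<close>, would be a circuit. So the
  vertices reachable from \<open>tgt e\<close> in the remaining graph form one side of the
  edge.\<close>

lemma cut:
  assumes e: "e \<in> D"
  shows "\<exists>s :: 'v \<Rightarrow> bool. s (src e) \<noteq> s (tgt e) \<and>
    (\<forall>f\<in>D. f \<noteq> e \<longrightarrow> f \<noteq> edge_inv X e \<longrightarrow> s (src f) = s (tgt f))"
proof -
  let ?D = "D - {e, edge_inv X e}"
  let ?R = "(\<lambda>f. (src f, tgt f)) ` ?D"
  define s where "s x \<longleftrightarrow> (tgt e, x) \<in> ?R\<^sup>*" for x
  have walk: "\<exists>p. base.awalk x p y \<and> set p \<subseteq> ?D" if "(x, y) \<in> ?R\<^sup>*" "y \<in> V" for x y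
    using that
  proof (induction rule: converse_rtrancl_induct)
    case base
    then show ?case by (intro exI[of _ "[]"]) (simp add: base.awalk_Nil_iff)
  next
    case (step x z)
    then obtain p f where "base.awalk z p y" "set p \<subseteq> ?D" "f \<in> ?D" "x = src f" "z = tgt f" by auto
    then show ?case by (intro exI[of _ "f # p"]) (simp add: base.awalk_Cons_iff)
  qed
  have "\<not> s (src e)"
  proof
    assume "s (src e)"
    then obtain p where p: "base.awalk (tgt e) p (src e)" "set p \<subseteq> ?D"
      using walk e unfolding s_def by (meson base.tail_in_verts)
    define q where "q = base.awalk_to_apath p"
    have q: "base.apath (tgt e) q (src e)" "set q \<subseteq> ?D"
      using p base.apath_awalk_to_apath base.awalk_to_apath_subset unfolding q_def by blast+
    then have "base.cycle (e # q)"
      using e unfolding base.cycle_def base.apath_def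
      by (intro exI[of _ "src e"]) (simp add: base.awalk_Cons_iff)
    \<comment> \<open>\<open>q\<close> avoids the inverse of \<open>e\<close>, so the cycle is not
      an edge followed by its inverse. If \<open>e\<close> is a loop, \<open>q\<close> is empty and
      the cycle is \<open>[e]\<close>.\<close>
    moreover have "e # q \<noteq> [f, edge_inv X f]" for f using q(2) by auto
    ultimately show False using base_tree unfolding serre_tree_def by blast
  qed
  moreover have "s (tgt e)" by (simp add: s_def)
  moreover have "s (src f) = s (tgt f)" if "f \<in> D" "f \<noteq> e" "f \<noteq> edge_inv X e" for f
  proof -
    have "edge_inv X f \<in> ?D" "f \<in> ?D"
      using that by (auto simp: base.arev_eq_iff)
    then have "(src f, tgt f) \<in> ?R" "(tgt f, src f) \<in> ?R"
      using that rev_image_eqI[of "edge_inv X f" ?D "(tgt f, src f)" "\<lambda>f. (src f, tgt f)"] by auto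
    then show ?thesis unfolding s_def by (meson rtrancl.rtrancl_into_rtrancl)
  qed
  ultimately show ?thesis by (intro exI[of _ s]) blast
qed

text \<open>\<open>d\<close> is the distance to the root \<open>r\<close>, and \<open>pa v\<close>
  is the first edge of a shortest walk from \<open>v\<close> to \<open>r\<close>. If an edge were
  the parent edge of neither end, parent edges would lead from both ends to \<open>r\<close> without
  crossing it, although it separates its ends.\<close>

lemma rooted:
  "\<exists>(r :: 'v) (pa :: 'v \<Rightarrow> 'e) (d :: 'v \<Rightarrow> nat). r \<in> V \<and>
    (\<forall>v\<in>V. v \<noteq> r \<longrightarrow> pa v \<in> D \<and> src (pa v) = v \<and> d (tgt (pa v)) < d v) \<and>
    (\<forall>e\<in>D. src e \<noteq> r \<and> pa (src e) = e \<or> tgt e \<noteq> r \<and> pa (tgt e) = edge_inv X e)"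
proof -
  let ?R = "(\<lambda>f. (src f, tgt f)) ` D"
  obtain r where r: "r \<in> V" using base_connected by (auto simp: connected_def strongly_connected_def)
  define d where "d v = (LEAST n. (v, r) \<in> ?R ^^ n)" for v
  have "\<exists>f. f \<in> D \<and> src f = v \<and> d (tgt f) < d v" if v: "v \<in> V" "v \<noteq> r" for v
  proof -
    obtain n where "(v, r) \<in> ?R ^^ n" using reach_V[OF v(1) r] rtrancl_imp_relpow by blast
    then have d: "(v, r) \<in> ?R ^^ d v" unfolding d_def by (rule LeastI)
    then obtain k where k: "d v = Suc k" using v by (cases "d v") auto
    then obtain z where "(v, z) \<in> ?R" "(z, r) \<in> ?R ^^ k"
      using relpow_Suc_D2[OF d[unfolded k]] by blast
    moreover from this have "d z \<le> k" unfolding d_def by (intro Least_le)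
    ultimately show ?thesis using k by auto
  qed
  then obtain pa where pa: "\<And>v. v \<in> V \<Longrightarrow> v \<noteq> r \<Longrightarrow> pa v \<in> D \<and> src (pa v) = v \<and> d (tgt (pa v)) < d v"
    by metis
  have "src e \<noteq> r \<and> pa (src e) = e \<or> tgt e \<noteq> r \<and> pa (tgt e) = edge_inv X e" if e: "e \<in> D" for e
  proof (rule ccontr)
    assume neither: "\<not> ?thesis"
    obtain s :: "'v \<Rightarrow> bool" where s: "s (src e) \<noteq> s (tgt e)"
      "\<And>f. f \<in> D \<Longrightarrow> f \<noteq> e \<Longrightarrow> f \<noteq> edge_inv X e \<Longrightarrow> s (src f) = s (tgt f)"
      using cut[OF e] by blast
    have "s v = s r" if "v \<in> V" for v
      using that
    proof (induction "d v" arbitrary: v rule: less_induct)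
      case less
      show ?case
      proof (cases "v = r")
        case False
        have p: "pa v \<in> D" "src (pa v) = v" "d (tgt (pa v)) < d v" using pa less False by auto
        have "pa v \<noteq> e" "pa v \<noteq> edge_inv X e" using neither p False e by auto
        then show ?thesis using s(2)[OF p(1)] p less by auto
      qed simp
    qed
    then show False using s(1) e by auto
  qed
  then show ?thesis using r pa by (intro exI[of _ r] exI[of _ pa] exI[of _ d]) simp
qed

section \<open>Gluing actions of the vertex groups along a tree\<close>

text \<open>Everything is transported to \<open>Z r\<close>: \<open>\<gamma> v\<close> composes the
  maps \<open>\<beta>\<close> along the parent edges from \<open>v\<close> to the root. Every edge
  is a parent edge in one direction, so equivariance makes the transported actions agree on edge
  groups and \<open>ex_action\<close> applies. The last clause records that
  \<open>\<gamma> v z\<close> arises from \<open>z\<close> by applying maps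
  \<open>\<beta> e\<close>, so whatever all of these preserve survives the gluing.\<close>

theorem gluing:
  fixes Z :: "'v \<Rightarrow> 'z set"
  assumes acts: "\<And>v. v \<in> V \<Longrightarrow> acts G (A v) (\<alpha> v) (Z v)"
    and bij: "\<And>e. e \<in> D \<Longrightarrow> bij_betw (\<beta> e) (Z (src e)) (Z (tgt e))"
    and equivar: "\<And>e a z. e \<in> D \<Longrightarrow> a \<in> E e \<Longrightarrow> z \<in> Z (src e) \<Longrightarrow>
      \<beta> e (\<alpha> (src e) a z) = \<alpha> (tgt e) a (\<beta> e z)"
  shows "\<exists>r \<gamma> \<delta>. r \<in> V \<and> (\<forall>v\<in>V. bij_betw (\<gamma> v) (Z v) (Z r)) \<and>
    acts G (carrier G) \<delta> (Z r) \<and>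
    (\<forall>v\<in>V. \<forall>a\<in>A v. \<forall>z\<in>Z v. \<delta> a (\<gamma> v z) = \<gamma> v (\<alpha> v a z)) \<and>
    (\<forall>v\<in>V. \<forall>z\<in>Z v. (z, \<gamma> v z) \<in> {(z, \<beta> e z) | e z. e \<in> D \<and> z \<in> Z (src e)}\<^sup>*)"
proof -
  obtain r pa d where r: "r \<in> V"
    and pa: "\<And>v. v \<in> V \<Longrightarrow> v \<noteq> r \<Longrightarrow> pa v \<in> D \<and> src (pa v) = v \<and> d (tgt (pa v)) < (d v :: nat)"
    and all_pa: "\<And>e. e \<in> D \<Longrightarrow>
      src e \<noteq> r \<and> pa (src e) = e \<or> tgt e \<noteq> r \<and> pa (tgt e) = edge_inv X e"
    using rooted by metis
  \<comment> \<open>The guard lets the recursion descend only to vertices with smaller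
    \<open>d\<close>; at the root, and outside \<open>V\<close>, the value is
    \<open>id\<close>.\<close>
  define \<gamma> where "\<gamma> = wfrec (Wellfounded.measure d)
    (\<lambda>f v. if v \<in> V \<and> v \<noteq> r then f (tgt (pa v)) \<circ> \<beta> (pa v) else id)"
  have \<gamma>_unfold: "\<gamma> v = (if v \<in> V \<and> v \<noteq> r then \<gamma> (tgt (pa v)) \<circ> \<beta> (pa v) else id)" for v
    using pa[of v] unfolding \<gamma>_def by (subst wfrec[OF wf_measure]) (auto simp: cut_apply)
  have \<gamma>_pa: "\<gamma> v z = \<gamma> (tgt (pa v)) (\<beta> (pa v) z)" if "v \<in> V" "v \<noteq> r" for v z
    using that by (subst \<gamma>_unfold) simp
  have \<gamma>_r: "\<gamma> r = id" by (subst \<gamma>_unfold) simp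
  have \<gamma>: "bij_betw (\<gamma> v) (Z v) (Z r) \<and>
      (\<forall>z\<in>Z v. (z, \<gamma> v z) \<in> {(z, \<beta> e z) | e z. e \<in> D \<and> z \<in> Z (src e)}\<^sup>*)" if "v \<in> V" for v
    using that
  proof (induction "d v" arbitrary: v rule: less_induct)
    case less
    show ?case
    proof (cases "v = r")
      case True
      then show ?thesis by (simp add: \<gamma>_r)
    next
      case False
      let ?w = "tgt (pa v)"
      note p = pa[OF less.prems False]
      have IH: "bij_betw (\<gamma> ?w) (Z ?w) (Z r)"
        "\<forall>z\<in>Z ?w. (z, \<gamma> ?w z) \<in> {(z, \<beta> e z) | e z. e \<in> D \<and> z \<in> Z (src e)}\<^sup>*"
        using less.hyps[of ?w] p by auto
      have b: "bij_betw (\<beta> (pa v)) (Z v) (Z ?w)" using bij[of "pa v"] p by simp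
      have "bij_betw (\<gamma> v) (Z v) (Z r)"
        using bij_betw_trans[OF b IH(1)] less.prems False by (subst \<gamma>_unfold) simp
      moreover have "(z, \<gamma> v z) \<in> {(z, \<beta> e z) | e z. e \<in> D \<and> z \<in> Z (src e)}\<^sup>*" if z: "z \<in> Z v" for z
      proof -
        have "(z, \<beta> (pa v) z) \<in> {(z, \<beta> e z) | e z. e \<in> D \<and> z \<in> Z (src e)}"
          using z p by (intro CollectI exI[of _ "pa v"] exI[of _ z]) simp
        moreover have "\<beta> (pa v) z \<in> Z ?w" using b z by (rule bij_betw_apply)
        ultimately show ?thesis
          using IH(2) \<gamma>_pa[OF less.prems False, of z] by (metis (no_types, lifting) converse_rtrancl_into_rtrancl)
      qed
      ultimately show ?thesis by blast
    qed
  qed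
  then have \<gamma>_bij: "bij_betw (\<gamma> v) (Z v) (Z r)" if "v \<in> V" for v using that by blast
  define \<gamma>' where "\<gamma>' v = inv_into (Z v) (\<gamma> v)" for v
  have \<gamma>'1: "\<gamma>' v (\<gamma> v z) = z" if "v \<in> V" "z \<in> Z v" for v z
    using \<gamma>_bij that by (auto simp: \<gamma>'_def bij_betw_def)
  have \<gamma>'2: "\<gamma> v (\<gamma>' v x) = x" "\<gamma>' v x \<in> Z v" if "v \<in> V" "x \<in> Z r" for v x
    using \<gamma>_bij[OF that(1)] that unfolding \<gamma>'_def bij_betw_def
    by (metis f_inv_into_f, metis inv_into_into)
  define \<alpha>' where "\<alpha>' v a x = \<gamma> v (\<alpha> v a (\<gamma>' v x))" for v a x
  have acts': "acts G (A v) (\<alpha>' v) (Z r)" if v: "v \<in> V" for v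
    unfolding acts_def \<alpha>'_def
    using \<gamma>'1[OF v] \<gamma>'2[OF v] acts_closed[OF acts[OF v]] acts_one[OF acts[OF v]]
      acts_mult[OF acts[OF v]] bij_betw_apply[OF \<gamma>_bij[OF v]]
    by auto
  have step: "\<alpha>' v a x = \<alpha>' (tgt (pa v)) a x"
    if v: "v \<in> V" "v \<noteq> r" and a: "a \<in> E (pa v)" and x: "x \<in> Z r" for v a x
  proof -
    note p = pa[OF v]
    then have w: "tgt (pa v) \<in> V" by auto
    let ?z = "\<gamma>' v x"
    have z: "?z \<in> Z v" "\<gamma> v ?z = x" using \<gamma>'2 v x by auto
    then have bz: "\<beta> (pa v) ?z \<in> Z (tgt (pa v))" using bij_betw_apply[OF bij, of "pa v"] p by auto
    have "\<gamma>' (tgt (pa v)) x = \<beta> (pa v) ?z"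
      using \<gamma>'1[OF w bz] z \<gamma>_pa[OF v] by simp
    then show ?thesis
      using equivar[of "pa v" a ?z] p a z \<gamma>_pa[OF v] by (simp add: \<alpha>'_def)
  qed
  have agree: "\<alpha>' (src e) a x = \<alpha>' (tgt e) a x" if e: "e \<in> D" "a \<in> E e" "x \<in> Z r" for e a x
    using all_pa[OF e(1)]
  proof (elim disjE conjE)
    assume "src e \<noteq> r" "pa (src e) = e"
    then show ?thesis using step[of "src e" a x] e by simp
  next
    assume "tgt e \<noteq> r" "pa (tgt e) = edge_inv X e"
    then show ?thesis using step[of "tgt e" a x] e by (simp add: E_inv)
  qed
  obtain \<delta> where \<delta>: "acts G (carrier G) \<delta> (Z r)"
    "\<And>v a x. v \<in> V \<Longrightarrow> a \<in> A v \<Longrightarrow> x \<in> Z r \<Longrightarrow> \<delta> a x = \<alpha>' v a x"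
    using ex_action[of \<alpha>' "Z r", OF acts' agree] by blast
  have "\<delta> a (\<gamma> v z) = \<gamma> v (\<alpha> v a z)" if "v \<in> V" "a \<in> A v" "z \<in> Z v" for v a z
    using \<delta>(2)[OF that(1,2), of "\<gamma> v z"] bij_betw_apply[OF \<gamma>_bij] \<gamma>'1 that by (simp add: \<alpha>'_def)
  then show ?thesis using r \<gamma> \<delta>(1) by (intro exI[of _ r] exI[of _ \<gamma>] exI[of _ \<delta>]) simp
qed

section \<open>The Bass--Serre tree\<close>

lemma G_induct [consumes 1, case_names one mult]:
  assumes "g \<in> carrier G"
    and "P \<one>\<^bsub>G\<^esub>"
    and "\<And>v a g. v \<in> V \<Longrightarrow> a \<in> A v \<Longrightarrow> g \<in> carrier G \<Longrightarrow> P g \<Longrightarrow> P (a \<otimes>\<^bsub>G\<^esub> g)"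
  shows "P g"
proof -
  have "P (pi1_cong X D `` {w})" if "w \<in> pi1_words X" for w
    using that
  proof (induction w)
    case Nil
    then show ?case using assms(2) by (simp add: pi1_one)
  next
    case (Cons l w)
    have w: "w \<in> pi1_words X" using Cons.prems pi1_words_append[of "[l]" w] by simp
    then have c: "pi1_cong X D `` {w} \<in> carrier G" by (auto simp: pi1_carrier)
    obtain a where a: "a \<in> insert \<one>\<^bsub>G\<^esub> (\<Union>v\<in>V. A v)"
      "pi1_cong X D `` {l # w} = a \<otimes>\<^bsub>G\<^esub> pi1_cong X D `` {w}"
      using class_Cons[OF Cons.prems] by blast
    show ?case
    proof (cases "a = \<one>\<^bsub>G\<^esub>")
      case True
      then show ?thesis using a Cons.IH[OF w] c by simp
    next
      case False
      then show ?thesis using a Cons.IH[OF w] c assms(3) by auto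
    qed
  qed
  then show ?thesis using assms(1) by (auto simp: pi1_carrier)
qed

text \<open>
  The vertices of the Bass--Serre tree are the cosets of the vertex groups; here the coset of
  \<open>A v\<close> containing \<open>g\<close> is represented by all the pairs \<open>(v, h)\<close> with \<open>h\<close> in this coset,
  connected by steps inside the coset. An edge is a coset of an edge group.
\<close>

definition nodes :: "('v \<times> ('v, 'e, 'a) letter list set) set" where
  "nodes = V \<times> carrier G"

definition tstep :: "('v \<times> ('v, 'e, 'a) letter list set) rel" where
  "tstep = {((v, g), (v, g \<otimes>\<^bsub>G\<^esub> a)) | v g a. v \<in> V \<and> g \<in> carrier G \<and> a \<in> A v} \<union>
     {((src e, g), (tgt e, g)) | e g. e \<in> D \<and> g \<in> carrier G}"

definition translate ::
    "('v, 'e, 'a) letter list set \<Rightarrow> 'v \<times> ('v, 'e, 'a) letter list set \<Rightarrow>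
       'v \<times> ('v, 'e, 'a) letter list set" where
  "translate c p = (fst p, c \<otimes>\<^bsub>G\<^esub> snd p)"

lemma tstep_rotate: "v \<in> V \<Longrightarrow> g \<in> carrier G \<Longrightarrow> a \<in> A v \<Longrightarrow> ((v, g), (v, g \<otimes>\<^bsub>G\<^esub> a)) \<in> tstep"
  by (auto simp: tstep_def)

lemma tstep_cross: "e \<in> D \<Longrightarrow> g \<in> carrier G \<Longrightarrow> ((src e, g), (tgt e, g)) \<in> tstep"
  by (auto simp: tstep_def)

lemma tstep_cases:
  assumes "(p, q) \<in> tstep"
  obtains (rotate) v g a where "v \<in> V" "g \<in> carrier G" "a \<in> A v" "p = (v, g)" "q = (v, g \<otimes>\<^bsub>G\<^esub> a)"
    | (cross) e g where "e \<in> D" "g \<in> carrier G" "p = (src e, g)" "q = (tgt e, g)"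
  using assms unfolding tstep_def by blast

lemma tstep_nodes: "(p, q) \<in> tstep \<Longrightarrow> p \<in> nodes \<and> q \<in> nodes"
  by (erule tstep_cases) (auto simp: nodes_def A_carrier)

lemma tstep_sym: "(p, q) \<in> tstep \<Longrightarrow> (q, p) \<in> tstep"
proof (erule tstep_cases)
  fix v g a assume *: "v \<in> V" "g \<in> carrier G" "a \<in> A v" "p = (v, g)" "q = (v, g \<otimes>\<^bsub>G\<^esub> a)"
  then have "((v, g \<otimes>\<^bsub>G\<^esub> a), (v, g \<otimes>\<^bsub>G\<^esub> a \<otimes>\<^bsub>G\<^esub> inv\<^bsub>G\<^esub> a)) \<in> tstep"
    by (intro tstep_rotate) (auto simp: A_carrier subgroup.m_inv_closed A_subgroup)
  moreover have "g \<otimes>\<^bsub>G\<^esub> a \<otimes>\<^bsub>G\<^esub> inv\<^bsub>G\<^esub> a = g"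
    using * A_carrier[of v a] by (simp add: G.m_assoc)
  ultimately show "(q, p) \<in> tstep" using * by simp
next
  fix e g assume *: "e \<in> D" "g \<in> carrier G" "p = (src e, g)" "q = (tgt e, g)"
  then show "(q, p) \<in> tstep" using tstep_cross[of "edge_inv X e" g] by simp
qed

lemma tstep_translate:
  "(p, q) \<in> tstep \<Longrightarrow> c \<in> carrier G \<Longrightarrow> (translate c p, translate c q) \<in> tstep"
proof (erule tstep_cases)
  fix v g a assume *: "c \<in> carrier G" "v \<in> V" "g \<in> carrier G" "a \<in> A v" "p = (v, g)" "q = (v, g \<otimes>\<^bsub>G\<^esub> a)"
  then show "(translate c p, translate c q) \<in> tstep"
    using tstep_rotate[of v "c \<otimes>\<^bsub>G\<^esub> g" a] A_carrier[of v a] by (simp add: translate_def G.m_assoc)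
next
  fix e g assume *: "c \<in> carrier G" "e \<in> D" "g \<in> carrier G" "p = (src e, g)" "q = (tgt e, g)"
  then show "(translate c p, translate c q) \<in> tstep"
    using tstep_cross[of e "c \<otimes>\<^bsub>G\<^esub> g"] by (simp add: translate_def)
qed

text \<open>The nodes over one element \<open>g\<close> form a lift of the base graph. Recording
  that the walk stays in this lift allows it to be used inside the sets \<open>V \<times> Y\<close>
  below.\<close>

lemma tstep_fiber:
  assumes "u \<in> V" "v \<in> V" "g \<in> carrier G"
  shows "((u, g), (v, g)) \<in> (tstep \<inter> (V \<times> {g}) \<times> (V \<times> {g}))\<^sup>*"
  using reach_V[OF assms(1,2)]
proof (induction rule: rtrancl_induct)
  case base
  then show ?case by simp
next
  case (step y z)
  then obtain e where "e \<in> D" "y = src e" "z = tgt e" by auto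
  then have "((y, g), (z, g)) \<in> tstep \<inter> (V \<times> {g}) \<times> (V \<times> {g})"
    using tstep_cross assms(3) by simp
  with step.IH show ?case by (rule rtrancl.rtrancl_into_rtrancl)
qed

lemma tstep_connected:
  assumes "p \<in> nodes" "q \<in> nodes"
  shows "(p, q) \<in> tstep\<^sup>*"
proof -
  have fiber: "((u, g), (v, g)) \<in> tstep\<^sup>*" if "u \<in> V" "v \<in> V" "g \<in> carrier G" for u v g
    using tstep_fiber[OF that] rtrancl_mono[of "tstep \<inter> (V \<times> {g}) \<times> (V \<times> {g})" tstep] by blast
  \<comment> \<open>\<open>g\<close> is arbitrary because splitting a factor \<open>a\<close> off
    the element moves the start of the remaining walk from \<open>g\<close> to the product of
    \<open>g\<close> and \<open>a\<close>.\<close>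
  have conn: "((v, g), (v, g \<otimes>\<^bsub>G\<^esub> x)) \<in> tstep\<^sup>*" if "x \<in> carrier G" "v \<in> V" "g \<in> carrier G" for x v g
    using that
  proof (induction x arbitrary: g rule: G_induct)
    case one
    then show ?case by simp
  next
    case (mult u a x)
    have a: "a \<in> carrier G" using mult A_carrier by blast
    have "((v, g), (u, g)) \<in> tstep\<^sup>*" "((u, g \<otimes>\<^bsub>G\<^esub> a), (v, g \<otimes>\<^bsub>G\<^esub> a)) \<in> tstep\<^sup>*"
      using fiber mult a by auto
    moreover have "((u, g), (u, g \<otimes>\<^bsub>G\<^esub> a)) \<in> tstep" using mult by (intro tstep_rotate)
    moreover have "((v, g \<otimes>\<^bsub>G\<^esub> a), (v, g \<otimes>\<^bsub>G\<^esub> a \<otimes>\<^bsub>G\<^esub> x)) \<in> tstep\<^sup>*"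
      using mult a by simp
    ultimately have "((v, g), (v, g \<otimes>\<^bsub>G\<^esub> a \<otimes>\<^bsub>G\<^esub> x)) \<in> tstep\<^sup>*"
      by (meson rtrancl.rtrancl_into_rtrancl rtrancl_trans)
    then show ?case using mult a by (simp add: G.m_assoc)
  qed
  obtain u g v h where pq: "p = (u, g)" "q = (v, h)" "u \<in> V" "v \<in> V" "g \<in> carrier G" "h \<in> carrier G"
    using assms by (auto simp: nodes_def)
  have "g \<otimes>\<^bsub>G\<^esub> (inv\<^bsub>G\<^esub> g \<otimes>\<^bsub>G\<^esub> h) = h"
    using pq by (simp add: G.m_assoc[symmetric])
  then have "((u, g), (u, h)) \<in> tstep\<^sup>*"
    using conn[of "inv\<^bsub>G\<^esub> g \<otimes>\<^bsub>G\<^esub> h" u g] pq by simp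
  then show ?thesis using fiber[of u v h] pq by auto
qed

text \<open>
  Every edge separates the tree. The two sides are found by letting \<open>G\<close> act on two copies of
  itself, where the vertex groups on one side of the edge are conjugated by the involution that
  exchanges the two copies of the edge group: following a walk from the identity, the copy
  changes whenever the walk crosses the edge.
\<close>

lemma separation_one:
  assumes e0: "e0 \<in> D"
  shows "\<exists>\<chi> :: _ \<Rightarrow> bool. (\<forall>v\<in>V. \<forall>g\<in>carrier G. \<forall>a\<in>A v. \<chi> (v, g \<otimes>\<^bsub>G\<^esub> a) = \<chi> (v, g)) \<and>
    (\<forall>e\<in>D. \<forall>g\<in>carrier G. \<chi> (src e, g) \<noteq> \<chi> (tgt e, g) \<longleftrightarrow> e \<in> {e0, edge_inv X e0} \<and> g \<in> E e0)"
proof -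
  obtain s :: "'v \<Rightarrow> bool" where s: "s (src e0) \<noteq> s (tgt e0)"
    "\<And>f. f \<in> D \<Longrightarrow> f \<noteq> e0 \<Longrightarrow> f \<noteq> edge_inv X e0 \<Longrightarrow> s (src f) = s (tgt f)"
    using cut[OF e0] by blast
  \<comment> \<open>The first coordinate is right translation by the inverse. At the vertices with
    \<open>s v\<close>, the bit flips when this translation enters or leaves
    \<open>E e0\<close>.\<close>
  define \<alpha> where "\<alpha> v a x = (fst x \<otimes>\<^bsub>G\<^esub> inv\<^bsub>G\<^esub> a,
      snd x \<noteq> (s v \<and> (fst x \<in> E e0) \<noteq> (fst x \<otimes>\<^bsub>G\<^esub> inv\<^bsub>G\<^esub> a \<in> E e0)))"
    for v a and x :: "('v, 'e, 'a) letter list set \<times> bool"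
  let ?\<Omega> = "carrier G \<times> (UNIV :: bool set)"
  have acts: "acts G (A v) (\<alpha> v) ?\<Omega>" if "v \<in> V" for v
    unfolding acts_def \<alpha>_def using A_carrier[OF that]
    by (auto simp: G.inv_mult_group G.m_assoc)
  \<comment> \<open>Translation by elements of \<open>E e0\<close> preserves membership in
    \<open>E e0\<close>, so no bit flips along \<open>e0\<close>; for every other edge,
    \<open>s\<close> is the same at both ends.\<close>
  have agree: "\<alpha> (src e) a x = \<alpha> (tgt e) a x" if "e \<in> D" "a \<in> E e" "x \<in> ?\<Omega>" for e a x
  proof (cases "e \<in> {e0, edge_inv X e0}")
    case True
    then have a: "a \<in> E e0" using that e0 E_inv by auto
    note sub = E_subgroup[OF e0]
    have ac: "a \<in> carrier G" using a e0 E_carrier by blast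
    have "fst x \<otimes>\<^bsub>G\<^esub> inv\<^bsub>G\<^esub> a \<in> E e0 \<longleftrightarrow> fst x \<in> E e0"
    proof
      assume "fst x \<otimes>\<^bsub>G\<^esub> inv\<^bsub>G\<^esub> a \<in> E e0"
      then have "fst x \<otimes>\<^bsub>G\<^esub> inv\<^bsub>G\<^esub> a \<otimes>\<^bsub>G\<^esub> a \<in> E e0" using a sub subgroup.m_closed by metis
      then show "fst x \<in> E e0" using that ac by (auto simp: G.m_assoc)
    qed (use a sub in \<open>simp add: subgroup.m_closed subgroup.m_inv_closed\<close>)
    then show ?thesis by (simp add: \<alpha>_def)
  next
    case False
    then show ?thesis using s(2)[OF that(1)] by (simp add: \<alpha>_def)
  qed
  obtain \<beta> where \<beta>: "acts G (carrier G) \<beta> ?\<Omega>"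
    "\<And>v a x. v \<in> V \<Longrightarrow> a \<in> A v \<Longrightarrow> x \<in> ?\<Omega> \<Longrightarrow> \<beta> a x = \<alpha> v a x"
    using ex_action[of \<alpha> ?\<Omega>, OF acts agree] by blast
  have fst_\<beta>: "fst (\<beta> g x) = fst x \<otimes>\<^bsub>G\<^esub> inv\<^bsub>G\<^esub> g" if "g \<in> carrier G" "x \<in> ?\<Omega>" for g x
    using that(1)
  proof (induction g rule: G_induct)
    case one
    then show ?case using acts_one[OF \<beta>(1)] that(2) by auto
  next
    case (mult v a g)
    have "\<beta> g x \<in> ?\<Omega>" using acts_closed[OF \<beta>(1)] mult that(2) by blast
    moreover have "\<beta> (a \<otimes>\<^bsub>G\<^esub> g) x = \<beta> a (\<beta> g x)"
      using acts_mult[OF \<beta>(1)] mult that(2) A_carrier by blast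
    ultimately show ?case
      using mult that(2) A_carrier[of v a] \<beta>(2)[of v a "\<beta> g x"]
      by (auto simp: \<alpha>_def G.inv_mult_group G.m_assoc)
  qed
  define \<chi>0 where "\<chi>0 g = snd (\<beta> (inv\<^bsub>G\<^esub> g) (\<one>\<^bsub>G\<^esub>, False))" for g
  have pt: "\<beta> (inv\<^bsub>G\<^esub> g) (\<one>\<^bsub>G\<^esub>, False) = (g, \<chi>0 g)" if "g \<in> carrier G" for g
    using fst_\<beta>[of "inv\<^bsub>G\<^esub> g" "(\<one>\<^bsub>G\<^esub>, False)"] that by (auto simp: \<chi>0_def prod_eq_iff)
  have \<chi>0: "\<chi>0 (g \<otimes>\<^bsub>G\<^esub> a) = (\<chi>0 g \<noteq> (s v \<and> (g \<in> E e0) \<noteq> (g \<otimes>\<^bsub>G\<^esub> a \<in> E e0)))"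
    if "v \<in> V" "a \<in> A v" "g \<in> carrier G" for v a g
  proof -
    have a: "a \<in> carrier G" "inv\<^bsub>G\<^esub> a \<in> A v"
      using that A_carrier A_subgroup subgroup.m_inv_closed by metis+
    have "\<beta> (inv\<^bsub>G\<^esub> (g \<otimes>\<^bsub>G\<^esub> a)) (\<one>\<^bsub>G\<^esub>, False) = \<beta> (inv\<^bsub>G\<^esub> a) (\<beta> (inv\<^bsub>G\<^esub> g) (\<one>\<^bsub>G\<^esub>, False))"
      using acts_mult[OF \<beta>(1), of "inv\<^bsub>G\<^esub> a" "inv\<^bsub>G\<^esub> g" "(\<one>\<^bsub>G\<^esub>, False)"] that a
      by (simp add: G.inv_mult_group)
    also have "\<dots> = \<alpha> v (inv\<^bsub>G\<^esub> a) (g, \<chi>0 g)"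
      using \<beta>(2)[of v "inv\<^bsub>G\<^esub> a" "(g, \<chi>0 g)"] that a pt by simp
    finally show ?thesis using pt[of "g \<otimes>\<^bsub>G\<^esub> a"] that a by (simp add: \<alpha>_def)
  qed
  \<comment> \<open>The term added to \<open>\<chi>0\<close> undoes the flips, so
    \<open>\<chi>\<close> is constant on cosets. Since this term depends on \<open>s\<close>, which
    differs at the ends of \<open>e0\<close>, crossing \<open>e0\<close> changes
    \<open>\<chi>\<close> exactly at the elements of \<open>E e0\<close>.\<close>
  define \<chi> where "\<chi> p = (\<chi>0 (snd p) \<noteq> (s (fst p) \<and> snd p \<in> E e0))"
    for p :: "'v \<times> ('v, 'e, 'a) letter list set"
  show ?thesis
  proof (intro exI[of _ \<chi>] conjI ballI)
    fix v g a assume "v \<in> V" "g \<in> carrier G" "a \<in> A v"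
    then show "\<chi> (v, g \<otimes>\<^bsub>G\<^esub> a) = \<chi> (v, g)" using \<chi>0[of v a g] by (auto simp: \<chi>_def)
  next
    fix e g assume "e \<in> D" "g \<in> carrier G"
    then show "\<chi> (src e, g) \<noteq> \<chi> (tgt e, g) \<longleftrightarrow> e \<in> {e0, edge_inv X e0} \<and> g \<in> E e0"
      using s(1) s(2)[of e] e0 by (auto simp: \<chi>_def)
  qed
qed

lemma separation:
  assumes "e0 \<in> D" "g0 \<in> carrier G"
  shows "\<exists>\<chi> :: _ \<Rightarrow> bool. (\<forall>v\<in>V. \<forall>g\<in>carrier G. \<forall>a\<in>A v. \<chi> (v, g \<otimes>\<^bsub>G\<^esub> a) = \<chi> (v, g)) \<and>
    (\<forall>e\<in>D. \<forall>g\<in>carrier G. \<chi> (src e, g) \<noteq> \<chi> (tgt e, g) \<longleftrightarrow>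
      e \<in> {e0, edge_inv X e0} \<and> inv\<^bsub>G\<^esub> g0 \<otimes>\<^bsub>G\<^esub> g \<in> E e0)"
proof -
  obtain \<chi> :: "_ \<Rightarrow> bool" where
    \<chi>: "\<forall>v\<in>V. \<forall>g\<in>carrier G. \<forall>a\<in>A v. \<chi> (v, g \<otimes>\<^bsub>G\<^esub> a) = \<chi> (v, g)"
    "\<forall>e\<in>D. \<forall>g\<in>carrier G. \<chi> (src e, g) \<noteq> \<chi> (tgt e, g) \<longleftrightarrow> e \<in> {e0, edge_inv X e0} \<and> g \<in> E e0"
    using separation_one[OF assms(1)] by (elim exE conjE)
  show ?thesis
  proof (intro exI[of _ "\<chi> \<circ> translate (inv\<^bsub>G\<^esub> g0)"] conjI ballI)
    fix v g a assume "v \<in> V" "g \<in> carrier G" "a \<in> A v"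
    then show "(\<chi> \<circ> translate (inv\<^bsub>G\<^esub> g0)) (v, g \<otimes>\<^bsub>G\<^esub> a) = (\<chi> \<circ> translate (inv\<^bsub>G\<^esub> g0)) (v, g)"
      using \<chi>(1)[rule_format, of v "inv\<^bsub>G\<^esub> g0 \<otimes>\<^bsub>G\<^esub> g" a] A_carrier[of v a] assms
      by (simp add: translate_def G.m_assoc)
  next
    fix e g assume "e \<in> D" "g \<in> carrier G"
    then show "(\<chi> \<circ> translate (inv\<^bsub>G\<^esub> g0)) (src e, g) \<noteq> (\<chi> \<circ> translate (inv\<^bsub>G\<^esub> g0)) (tgt e, g) \<longleftrightarrow>
      e \<in> {e0, edge_inv X e0} \<and> inv\<^bsub>G\<^esub> g0 \<otimes>\<^bsub>G\<^esub> g \<in> E e0"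
      using \<chi>(2)[rule_format, of e "inv\<^bsub>G\<^esub> g0 \<otimes>\<^bsub>G\<^esub> g"] assms by (simp add: translate_def)
  qed
qed

section \<open>Fixed edges between disjoint invariant subtrees\<close>

text \<open>After its last visit to \<open>P\<close> the walk stays outside; reading the walk
  backwards from its end finds this visit.\<close>

lemma rtrancl_last_exit:
  assumes "(p, q) \<in> R\<^sup>*" "p \<in> P" "q \<notin> P"
  shows "\<exists>p0 q0. p0 \<in> P \<and> q0 \<notin> P \<and> (p0, q0) \<in> R \<and> (q0, q) \<in> (R \<inter> (- P) \<times> (- P))\<^sup>*"
proof -
  let ?C = "R \<inter> (- P) \<times> (- P)"
  let ?Ex = "\<exists>p0 q0. p0 \<in> P \<and> q0 \<notin> P \<and> (p0, q0) \<in> R \<and> (q0, q) \<in> ?C\<^sup>*"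
  have "p \<notin> P \<and> (p, q) \<in> ?C\<^sup>* \<or> ?Ex"
    using assms(1)
  proof (induction rule: converse_rtrancl_induct)
    case base
    then show ?case using assms(3) by simp
  next
    case (step x y)
    from step.IH show ?case
    proof (elim disjE conjE)
      assume y: "y \<notin> P" "(y, q) \<in> ?C\<^sup>*"
      show ?case
      proof (cases "x \<in> P")
        case True
        then show ?thesis using y step.hyps(1) by blast
      next
        case False
        then have "(x, y) \<in> ?C" using y step.hyps(1) by simp
        then show ?thesis using y(2) False by (simp add: converse_rtrancl_into_rtrancl)
      qed
    qed simp
  qed
  then show ?thesis using assms(2) by simp
qed

lemma rtrancl_translate:
  assumes "(p, q) \<in> (tstep \<inter> K \<times> K)\<^sup>*" "c \<in> carrier G" "\<And>x. x \<in> nodes \<Longrightarrow> x \<in> K \<Longrightarrow> translate c x \<in> L"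
  shows "(translate c p, translate c q) \<in> (tstep \<inter> L \<times> L)\<^sup>*"
  using assms(1)
proof (induction rule: rtrancl_induct)
  case base
  then show ?case by simp
next
  case (step y z)
  then have "(translate c y, translate c z) \<in> tstep \<inter> L \<times> L"
    using tstep_translate[of y z c] tstep_nodes[of y z] assms(2) assms(3)[of y] assms(3)[of z] by simp
  with step.IH show ?case by (rule rtrancl.rtrancl_into_rtrancl)
qed

lemma rtrancl_tstep_sym:
  assumes "(p, q) \<in> (tstep \<inter> K \<times> K)\<^sup>*"
  shows "(q, p) \<in> (tstep \<inter> K \<times> K)\<^sup>*"
proof -
  have "sym (tstep \<inter> K \<times> K)" by (rule symI) (auto intro: tstep_sym)
  then show ?thesis using assms sym_rtrancl symD by metis
qed

text \<open>
  The first edge of the way from \<open>P\<close> to \<open>P'\<close> is fixed by every automorphism preserving both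
  sets: it is the only edge between \<open>P\<close> and the component of \<open>P'\<close> in the complement of \<open>P\<close>.
\<close>

lemma bridge:
  assumes c: "c \<in> carrier G"
    and P: "P \<subseteq> nodes" "P \<noteq> {}"
    and P_sat: "\<And>v g a. (v, g) \<in> P \<Longrightarrow> a \<in> A v \<Longrightarrow> (v, g \<otimes>\<^bsub>G\<^esub> a) \<in> P"
    and P_conn: "\<And>p q. p \<in> P \<Longrightarrow> q \<in> P \<Longrightarrow> (p, q) \<in> (tstep \<inter> P \<times> P)\<^sup>*"
    and P_inv: "\<And>p. p \<in> nodes \<Longrightarrow> translate c p \<in> P \<longleftrightarrow> p \<in> P"
    and P': "P' \<subseteq> nodes" "P' \<noteq> {}"
    and P'_conn: "\<And>p q. p \<in> P' \<Longrightarrow> q \<in> P' \<Longrightarrow> (p, q) \<in> (tstep \<inter> P' \<times> P')\<^sup>*"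
    and P'_inv: "\<And>p. p \<in> P' \<Longrightarrow> translate c p \<in> P'"
    and disj: "P \<inter> P' = {}"
  shows "\<exists>e\<in>D. \<exists>g\<in>carrier G. (src e, g) \<in> P \<and> (tgt e, g) \<notin> P \<and>
    inv\<^bsub>G\<^esub> g \<otimes>\<^bsub>G\<^esub> (c \<otimes>\<^bsub>G\<^esub> g) \<in> E e"
proof -
  let ?C = "tstep \<inter> (- P) \<times> (- P)"
  obtain p q where pq: "p \<in> P" "q \<in> P'" using P P' by blast
  then have qP: "q \<notin> P" using disj by blast
  have "(p, q) \<in> tstep\<^sup>*" using pq P P' by (intro tstep_connected) auto
  then obtain p0 q0 where p0: "p0 \<in> P" "q0 \<notin> P" "(p0, q0) \<in> tstep" "(q0, q) \<in> ?C\<^sup>*"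
    using rtrancl_last_exit[of p q tstep P] pq qP by blast
  \<comment> \<open>\<open>P\<close> is a union of cosets, so the step that leaves it cannot be a
    rotation and crosses an edge.\<close>
  obtain e g where eg: "e \<in> D" "g \<in> carrier G" "p0 = (src e, g)" "q0 = (tgt e, g)"
    using p0(3)
  proof (cases rule: tstep_cases)
    case (rotate v g a)
    then show ?thesis using P_sat[of v g a] p0 by simp
  qed
  obtain \<chi> :: "_ \<Rightarrow> bool" where
    \<chi>: "\<forall>v\<in>V. \<forall>g\<in>carrier G. \<forall>a\<in>A v. \<chi> (v, g \<otimes>\<^bsub>G\<^esub> a) = \<chi> (v, g)"
    "\<forall>f\<in>D. \<forall>h\<in>carrier G. \<chi> (src f, h) \<noteq> \<chi> (tgt f, h) \<longleftrightarrow>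
      f \<in> {e, edge_inv X e} \<and> inv\<^bsub>G\<^esub> g \<otimes>\<^bsub>G\<^esub> h \<in> E e"
    using separation[OF eg(1,2)] by (elim exE conjE)
  have sat_iff: "(v, g \<otimes>\<^bsub>G\<^esub> a) \<in> P \<longleftrightarrow> (v, g) \<in> P" if "v \<in> V" "a \<in> A v" for v a
  proof
    assume "(v, g \<otimes>\<^bsub>G\<^esub> a) \<in> P"
    moreover have "inv\<^bsub>G\<^esub> a \<in> A v" "a \<in> carrier G"
      using that A_subgroup subgroup.m_inv_closed A_carrier by metis+
    ultimately show "(v, g) \<in> P"
      using P_sat[of v "g \<otimes>\<^bsub>G\<^esub> a" "inv\<^bsub>G\<^esub> a"] eg by (simp add: G.m_assoc)
  qed (use that P_sat in blast)
  have E_iff: "(src e, h) \<in> P \<and> (tgt e, h) \<notin> P"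
    if h: "h \<in> carrier G" "inv\<^bsub>G\<^esub> g \<otimes>\<^bsub>G\<^esub> h \<in> E e" for h
  proof -
    have "h = g \<otimes>\<^bsub>G\<^esub> (inv\<^bsub>G\<^esub> g \<otimes>\<^bsub>G\<^esub> h)" using eg h by (simp add: G.m_assoc[symmetric])
    then show ?thesis
      using sat_iff[of "src e" "inv\<^bsub>G\<^esub> g \<otimes>\<^bsub>G\<^esub> h"] sat_iff[of "tgt e" "inv\<^bsub>G\<^esub> g \<otimes>\<^bsub>G\<^esub> h"]
        E_src[OF eg(1)] E_tgt[OF eg(1)] eg h p0 by auto
  qed
  \<comment> \<open>\<open>\<chi>\<close> changes only across one edge of the tree, and by
    \<open>E_iff\<close> each of its representatives leads out of \<open>P\<close>. So
    \<open>\<chi>\<close> is constant along walks inside \<open>P\<close> and along walks outside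
    \<open>P\<close>.\<close>
  have const: "\<chi> x = \<chi> y" if xy: "(x, y) \<in> tstep" "x \<in> P \<longleftrightarrow> y \<in> P" for x y
    using xy(1)
  proof (cases rule: tstep_cases)
    case (rotate v h a)
    then show ?thesis using \<chi>(1) by simp
  next
    case (cross f h)
    show ?thesis
    proof (rule ccontr)
      assume "\<chi> x \<noteq> \<chi> y"
      then have "f \<in> {e, edge_inv X e}" "inv\<^bsub>G\<^esub> g \<otimes>\<^bsub>G\<^esub> h \<in> E e"
        using \<chi>(2)[rule_format, of f h] cross by auto
      then show False using E_iff[of h] cross xy(2) eg(1) by auto
    qed
  qed
  have constP: "\<chi> x = \<chi> y" if "(x, y) \<in> (tstep \<inter> P \<times> P)\<^sup>*" for x y
    using that by induction (use const in auto)
  have constC: "\<chi> x = \<chi> y" if "(x, y) \<in> ?C\<^sup>*" for x y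
    using that by induction (use const in auto)
  have n0: "p0 \<in> nodes" "q0 \<in> nodes" using tstep_nodes[OF p0(3)] by auto
  have 1: "\<chi> (translate c p0) = \<chi> p0"
    using constP P_conn P_inv[OF n0(1)] p0(1) by blast
  have "(translate c q0, translate c q) \<in> ?C\<^sup>*"
    using p0(4) c by (rule rtrancl_translate) (use P_inv in auto)
  moreover have "(translate c q, q) \<in> ?C\<^sup>*"
  proof -
    have "(translate c q, q) \<in> (tstep \<inter> P' \<times> P')\<^sup>*" using P'_conn P'_inv pq by blast
    moreover have "tstep \<inter> P' \<times> P' \<subseteq> ?C" using disj by auto
    ultimately show ?thesis using rtrancl_mono by blast
  qed
  ultimately have 2: "\<chi> (translate c q0) = \<chi> q0"
    using constC p0(4) by metis
  \<comment> \<open>The ends of the edge and their translates by \<open>c\<close> have the same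
    values of \<open>\<chi>\<close>. So the translated edge is also one across which
    \<open>\<chi>\<close> changes, and there is only one such edge.\<close>
  have "\<chi> p0 \<noteq> \<chi> q0"
    using \<chi>(2)[rule_format, of e g] eg subgroup.one_closed[OF E_subgroup] by simp
  then have "\<chi> (src e, c \<otimes>\<^bsub>G\<^esub> g) \<noteq> \<chi> (tgt e, c \<otimes>\<^bsub>G\<^esub> g)"
    using 1 2 eg by (simp add: translate_def)
  then have "inv\<^bsub>G\<^esub> g \<otimes>\<^bsub>G\<^esub> (c \<otimes>\<^bsub>G\<^esub> g) \<in> E e"
    using \<chi>(2)[rule_format, of e "c \<otimes>\<^bsub>G\<^esub> g"] eg c by simp
  then show ?thesis using eg p0 by blast
qed

section \<open>Consequences of the normalizer condition\<close>

text \<open>Sets \<open>V \<times> Y\<close> are unions of lifts of the base graph. If such a set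
  joins the identity to \<open>g\<close>, its translate by \<open>a\<close> joins \<open>a\<close>
  to the product of \<open>a\<close> and \<open>g\<close>, and a rotation at \<open>u\<close> links
  the identity to \<open>a\<close>.\<close>

lemma finite_tree_containing_one:
  assumes "g \<in> carrier G"
  shows "\<exists>Y. finite Y \<and> Y \<subseteq> carrier G \<and> \<one>\<^bsub>G\<^esub> \<in> Y \<and> g \<in> Y \<and>
    (\<forall>v\<in>V. \<forall>w\<in>V. \<forall>y\<in>Y. ((v, \<one>\<^bsub>G\<^esub>), (w, y)) \<in> (tstep \<inter> (V \<times> Y) \<times> (V \<times> Y))\<^sup>*)"
  using assms
proof (induction g rule: G_induct)
  case one
  show ?case
    by (intro exI[of _ "{\<one>\<^bsub>G\<^esub>}"]) (use tstep_fiber in auto)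
next
  case (mult u a g)
  then obtain Y where Y: "finite Y" "Y \<subseteq> carrier G" "\<one>\<^bsub>G\<^esub> \<in> Y" "g \<in> Y"
    and conn: "\<forall>v\<in>V. \<forall>w\<in>V. \<forall>y\<in>Y.
      ((v, \<one>\<^bsub>G\<^esub>), (w, y)) \<in> (tstep \<inter> (V \<times> Y) \<times> (V \<times> Y))\<^sup>*"
    by (elim exE conjE)
  have a: "a \<in> carrier G" using mult A_carrier by blast
  let ?Y = "insert \<one>\<^bsub>G\<^esub> ((\<lambda>y. a \<otimes>\<^bsub>G\<^esub> y) ` Y)"
  let ?R = "tstep \<inter> (V \<times> ?Y) \<times> (V \<times> ?Y)"
  have sub: "(tstep \<inter> (V \<times> {x}) \<times> (V \<times> {x}))\<^sup>* \<subseteq> ?R\<^sup>*" if "x \<in> ?Y" for x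
    using that by (intro rtrancl_mono) auto
  have aY: "a \<in> ?Y" using Y a by (auto intro!: image_eqI[of _ _ "\<one>\<^bsub>G\<^esub>"])
  have "((v, \<one>\<^bsub>G\<^esub>), (w, y)) \<in> ?R\<^sup>*" if v: "v \<in> V" "w \<in> V" "y \<in> ?Y" for v w y
  proof (cases "y = \<one>\<^bsub>G\<^esub>")
    case True
    then show ?thesis using tstep_fiber[OF v(1,2)] sub[of "\<one>\<^bsub>G\<^esub>"] by auto
  next
    case False
    then obtain y' where y': "y' \<in> Y" "y = a \<otimes>\<^bsub>G\<^esub> y'" using v by auto
    have 1: "((v, \<one>\<^bsub>G\<^esub>), (u, \<one>\<^bsub>G\<^esub>)) \<in> ?R\<^sup>*"
      using tstep_fiber[OF v(1) mult(1), of "\<one>\<^bsub>G\<^esub>"] sub[of "\<one>\<^bsub>G\<^esub>"] by auto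
    have 2: "((u, \<one>\<^bsub>G\<^esub>), (u, a)) \<in> ?R"
      using tstep_rotate[of u "\<one>\<^bsub>G\<^esub>" a] mult a aY by simp
    have "(translate a (u, \<one>\<^bsub>G\<^esub>), translate a (w, y')) \<in> ?R\<^sup>*"
      by (rule rtrancl_translate[OF conn[rule_format, OF mult(1) v(2) y'(1)] a]) (auto simp: translate_def)
    then have "((u, a), (w, y)) \<in> ?R\<^sup>*" using y' a by (simp add: translate_def)
    with 1 2 show ?thesis by (meson rtrancl.rtrancl_into_rtrancl rtrancl_trans)
  qed
  moreover have "finite ?Y" "?Y \<subseteq> carrier G" "\<one>\<^bsub>G\<^esub> \<in> ?Y" "a \<otimes>\<^bsub>G\<^esub> g \<in> ?Y" using Y a by auto
  ultimately show ?case by (intro exI[of _ ?Y]) simp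
qed

lemma finite_tree_containing:
  assumes "finite S" "S \<subseteq> carrier G"
  shows "\<exists>Y. finite Y \<and> Y \<subseteq> carrier G \<and> \<one>\<^bsub>G\<^esub> \<in> Y \<and> S \<subseteq> Y \<and>
    (\<forall>v\<in>V. \<forall>w\<in>V. \<forall>y\<in>Y. ((v, \<one>\<^bsub>G\<^esub>), (w, y)) \<in> (tstep \<inter> (V \<times> Y) \<times> (V \<times> Y))\<^sup>*)"
  using assms
proof (induction S)
  case empty
  show ?case
    by (intro exI[of _ "{\<one>\<^bsub>G\<^esub>}"]) (use tstep_fiber in auto)
next
  case (insert g S)
  obtain Y1 where Y1: "finite Y1" "Y1 \<subseteq> carrier G" "\<one>\<^bsub>G\<^esub> \<in> Y1" "S \<subseteq> Y1"
    "\<forall>v\<in>V. \<forall>w\<in>V. \<forall>y\<in>Y1. ((v, \<one>\<^bsub>G\<^esub>), (w, y)) \<in> (tstep \<inter> (V \<times> Y1) \<times> (V \<times> Y1))\<^sup>*"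
    using insert by auto
  obtain Y2 where Y2: "finite Y2" "Y2 \<subseteq> carrier G" "\<one>\<^bsub>G\<^esub> \<in> Y2" "g \<in> Y2"
    "\<forall>v\<in>V. \<forall>w\<in>V. \<forall>y\<in>Y2. ((v, \<one>\<^bsub>G\<^esub>), (w, y)) \<in> (tstep \<inter> (V \<times> Y2) \<times> (V \<times> Y2))\<^sup>*"
    using finite_tree_containing_one[of g] insert.prems by auto
  let ?R = "\<lambda>Y. (tstep \<inter> (V \<times> Y) \<times> (V \<times> Y))\<^sup>*"
  have "?R Y1 \<subseteq> ?R (Y1 \<union> Y2)" "?R Y2 \<subseteq> ?R (Y1 \<union> Y2)"
    by (rule rtrancl_mono, blast)+
  then have "((v, \<one>\<^bsub>G\<^esub>), (w, y)) \<in> ?R (Y1 \<union> Y2)" if "v \<in> V" "w \<in> V" "y \<in> Y1 \<union> Y2" for v w y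
    using that Y1(5)[rule_format, of v w y] Y2(5)[rule_format, of v w y] by (auto elim: subsetD)
  moreover have "finite (Y1 \<union> Y2)" "Y1 \<union> Y2 \<subseteq> carrier G" "\<one>\<^bsub>G\<^esub> \<in> Y1 \<union> Y2" "insert g S \<subseteq> Y1 \<union> Y2"
    using Y1 Y2 by auto
  ultimately show ?case by (intro exI[of _ "Y1 \<union> Y2"]) simp
qed

text \<open>The set consists of the translates, under the generated subgroup, of a finite connected
  piece through the identity and all generators. Generators link neighbouring translates, so the
  union is connected: it plays the role of an invariant subtree with finite quotient.\<close>

lemma generate_tree:
  assumes S: "finite S" "S \<subseteq> carrier G"
  shows "\<exists>Y. finite Y \<and> Y \<subseteq> carrier G \<and> \<one>\<^bsub>G\<^esub> \<in> Y \<and>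
    (let T = V \<times> {h \<otimes>\<^bsub>G\<^esub> y | h y. h \<in> generate G S \<and> y \<in> Y}
     in \<forall>p\<in>T. \<forall>q\<in>T. (p, q) \<in> (tstep \<inter> T \<times> T)\<^sup>*)"
proof -
  obtain Y where Y: "finite Y" "Y \<subseteq> carrier G" "\<one>\<^bsub>G\<^esub> \<in> Y" "S \<subseteq> Y"
    and Y_conn: "\<forall>v\<in>V. \<forall>w\<in>V. \<forall>y\<in>Y.
      ((v, \<one>\<^bsub>G\<^esub>), (w, y)) \<in> (tstep \<inter> (V \<times> Y) \<times> (V \<times> Y))\<^sup>*"
    using finite_tree_containing[OF S] by (elim exE conjE)
  let ?H = "generate G S"
  define T where "T = V \<times> {h \<otimes>\<^bsub>G\<^esub> y | h y. h \<in> ?H \<and> y \<in> Y}"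
  let ?R = "(tstep \<inter> T \<times> T)\<^sup>*"
  have H: "subgroup ?H G" by (rule G.generate_is_subgroup[OF S(2)])
  have Hc: "h \<in> carrier G" if "h \<in> ?H" for h using H that subgroup.mem_carrier by metis
  have T_trans: "translate h p \<in> T" if hp: "h \<in> ?H" "p \<in> T" for h p
  proof -
    obtain v h' y where p: "p = (v, h' \<otimes>\<^bsub>G\<^esub> y)" "v \<in> V" "h' \<in> ?H" "y \<in> Y"
      using hp(2) unfolding T_def by blast
    have eq: "translate h p = (v, (h \<otimes>\<^bsub>G\<^esub> h') \<otimes>\<^bsub>G\<^esub> y)"
      using p hp Hc Y by (auto simp: translate_def G.m_assoc)
    have "h \<otimes>\<^bsub>G\<^esub> h' \<in> ?H" using p hp H subgroup.m_closed by metis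
    then have "(v, (h \<otimes>\<^bsub>G\<^esub> h') \<otimes>\<^bsub>G\<^esub> y) \<in> T"
      using p unfolding T_def by blast
    then show ?thesis using eq by simp
  qed
  have "Y \<subseteq> {h \<otimes>\<^bsub>G\<^esub> y | h y. h \<in> ?H \<and> y \<in> Y}"
  proof
    fix y assume y: "y \<in> Y"
    then have "y = \<one>\<^bsub>G\<^esub> \<otimes>\<^bsub>G\<^esub> y" using Y by auto
    then show "y \<in> {h \<otimes>\<^bsub>G\<^esub> y | h y. h \<in> ?H \<and> y \<in> Y}" using y subgroup.one_closed[OF H] by blast
  qed
  then have "(tstep \<inter> (V \<times> Y) \<times> (V \<times> Y))\<^sup>* \<subseteq> ?R"
    by (intro rtrancl_mono) (auto simp: T_def)
  with Y_conn have conn1: "((v, \<one>\<^bsub>G\<^esub>), (w, y)) \<in> ?R" if "v \<in> V" "w \<in> V" "y \<in> Y" for v w y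
    using that by blast
  have shift: "(translate h p, translate h q) \<in> ?R" if "(p, q) \<in> ?R" "h \<in> ?H" for h p q
    using that T_trans Hc by (intro rtrancl_translate[of p q T h T]) auto
  have connH: "((v, \<one>\<^bsub>G\<^esub>), (w, h)) \<in> ?R" if "h \<in> ?H" "v \<in> V" "w \<in> V" for h v w
    using that
  proof (induction h arbitrary: v w rule: generate.induct)
    case one
    then show ?case using conn1 Y by blast
  next
    case (incl h)
    then show ?case using conn1 Y by blast
  next
    \<comment> \<open>The walk from the identity to \<open>s\<close>, translated by the inverse of
      \<open>s\<close>, joins this inverse to the identity.\<close>
    case (inv s)
    then have "(translate (inv\<^bsub>G\<^esub> s) (w, \<one>\<^bsub>G\<^esub>), translate (inv\<^bsub>G\<^esub> s) (v, s)) \<in> ?R"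
      using conn1[of w v s] Y generate.inv[of s S G] by (intro shift) auto
    then have "((w, inv\<^bsub>G\<^esub> s), (v, \<one>\<^bsub>G\<^esub>)) \<in> ?R"
      using inv S by (auto simp: translate_def)
    then show ?case by (rule rtrancl_tstep_sym)
  next
    case (eng h1 h2)
    have "(translate h1 (w, \<one>\<^bsub>G\<^esub>), translate h1 (w, h2)) \<in> ?R"
      using eng by (intro shift) auto
    then have "((w, h1), (w, h1 \<otimes>\<^bsub>G\<^esub> h2)) \<in> ?R"
      using eng Hc by (auto simp: translate_def)
    moreover have "((v, \<one>\<^bsub>G\<^esub>), (w, h1)) \<in> ?R" using eng by blast
    ultimately show ?case by (rule rtrancl_trans[rotated])
  qed
  have to_T: "((v, \<one>\<^bsub>G\<^esub>), p) \<in> ?R" if vp: "v \<in> V" "p \<in> T" for v p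
  proof -
    obtain w h y where p: "p = (w, h \<otimes>\<^bsub>G\<^esub> y)" "w \<in> V" "h \<in> ?H" "y \<in> Y"
      using vp(2) unfolding T_def by blast
    have "(translate h (w, \<one>\<^bsub>G\<^esub>), translate h (w, y)) \<in> ?R"
      using p conn1 by (intro shift) auto
    then have "((w, h), p) \<in> ?R" using p Hc by (auto simp: translate_def)
    with connH[OF p(3) vp(1) p(2)] show ?thesis by (rule rtrancl_trans)
  qed
  have "(p, q) \<in> ?R" if "p \<in> T" "q \<in> T" for p q
  proof -
    have v: "fst p \<in> V" using that by (auto simp: T_def)
    show ?thesis
      using rtrancl_tstep_sym[OF to_T[OF v that(1)]] to_T[OF v that(2)] by (rule rtrancl_trans)
  qed
  then show ?thesis using Y(1-3) by (intro exI[of _ Y]) (simp add: T_def Let_def)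
qed

end

section \<open>Finiteness of centralizers and of fixed point sets\<close>

locale normalizer_tree = tree_of_finite_groups X
  for X :: "('v, 'e, 'a, 'b) graph_of_groups" +
  assumes normalizer: "normalizer_condition X D"
begin

text \<open>The normalizer condition is applied to the cyclic group generated by \<open>c\<close>.
  This group is finite, as it lies in \<open>E e\<close>, so having finite index makes its
  normalizer finite; and the normalizer contains the centralizer of \<open>c\<close>.\<close>

lemma finite_centralizer_edge:
  assumes e: "e \<in> D" and c: "c \<in> E e" "c \<noteq> \<one>\<^bsub>G\<^esub>"
  shows "finite {g \<in> carrier G. g \<otimes>\<^bsub>G\<^esub> c = c \<otimes>\<^bsub>G\<^esub> g}"
proof -
  interpret h: group_hom "edge_group X e" G "edge_emb X D e"
    by (simp add: group_hom_def group_hom_axioms_def edge_group e group_pi1 edge_emb_hom)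
  obtain c0 where c0: "c0 \<in> carrier (edge_group X e)" "c = edge_emb X D e c0"
    using c by (auto simp: E_def)
  let ?E = "generate (edge_group X e) {c0}"
  have sub: "subgroup ?E (edge_group X e)" using c0 by (intro h.G.generate_is_subgroup) auto
  have "c0 \<in> ?E" by (simp add: generate.incl)
  moreover have "c0 \<noteq> \<one>\<^bsub>edge_group X e\<^esub>" using c c0 h.hom_one by auto
  ultimately have ne: "?E \<noteq> {\<one>\<^bsub>edge_group X e\<^esub>}" by blast
  define I where "I = edge_emb X D e ` ?E"
  define N where "N = normalizer G I"
  have I: "I = generate G {c}" unfolding I_def c0(2) using c0 h.generate_img[of "{c0}"] by simp
  have cG: "c \<in> carrier G" using e c E_carrier by blast
  have IG: "I \<subseteq> carrier G" unfolding I using cG by (intro G.generate_incl) auto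
  have fin: "finite (rcosets\<^bsub>G\<lparr>carrier := N\<rparr>\<^esub> I)"
    using normalizer e sub ne unfolding normalizer_condition_def I_def N_def by blast
  have "I \<subseteq> E e" unfolding I_def E_def using sub subgroup.subset by blast
  then have finI: "finite I" using finite_E[OF e] finite_subset by blast
  have "N \<subseteq> \<Union> (rcosets\<^bsub>G\<lparr>carrier := N\<rparr>\<^esub> I)"
  proof
    fix n assume n: "n \<in> N"
    then have "n \<in> carrier G" by (auto simp: N_def normalizer_def stabilizer_def)
    moreover have "\<one>\<^bsub>G\<^esub> \<in> I" unfolding I by (rule generate.one)
    ultimately have "n \<in> I #>\<^bsub>G\<lparr>carrier := N\<rparr>\<^esub> n"
      by (auto simp: r_coset_def intro!: bexI[of _ "\<one>\<^bsub>G\<^esub>"])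
    then show "n \<in> \<Union> (rcosets\<^bsub>G\<lparr>carrier := N\<rparr>\<^esub> I)" using n by (auto simp: RCOSETS_def)
  qed
  moreover have "finite C" if "C \<in> rcosets\<^bsub>G\<lparr>carrier := N\<rparr>\<^esub> I" for C
    using that finI by (auto simp: RCOSETS_def r_coset_def)
  ultimately have "finite N" using fin finite_subset by blast
  moreover have "{g \<in> carrier G. g \<otimes>\<^bsub>G\<^esub> c = c \<otimes>\<^bsub>G\<^esub> g} \<subseteq> N"
  proof
    fix g assume "g \<in> {g \<in> carrier G. g \<otimes>\<^bsub>G\<^esub> c = c \<otimes>\<^bsub>G\<^esub> g}"
    then have g: "g \<in> carrier G" "g \<otimes>\<^bsub>G\<^esub> c = c \<otimes>\<^bsub>G\<^esub> g" by auto
    have comm: "g \<otimes>\<^bsub>G\<^esub> x = x \<otimes>\<^bsub>G\<^esub> g" if "x \<in> I" for x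
      using that unfolding I
    proof (induction x rule: generate.induct)
      case (inv h)
      have "g \<otimes>\<^bsub>G\<^esub> inv\<^bsub>G\<^esub> c = inv\<^bsub>G\<^esub> c \<otimes>\<^bsub>G\<^esub> (c \<otimes>\<^bsub>G\<^esub> g) \<otimes>\<^bsub>G\<^esub> inv\<^bsub>G\<^esub> c"
        using g cG by (simp add: G.m_assoc[symmetric])
      also have "\<dots> = inv\<^bsub>G\<^esub> c \<otimes>\<^bsub>G\<^esub> g"
        unfolding g(2)[symmetric] using g(1) cG by (simp add: G.m_assoc)
      finally show ?case using inv by simp
    next
      case (eng h1 h2)
      have "h1 \<in> carrier G" "h2 \<in> carrier G" using eng IG I by auto
      then show ?case using eng g by (metis G.m_assoc)
    qed (use g in auto)
    have "g <#\<^bsub>G\<^esub> I #>\<^bsub>G\<^esub> inv\<^bsub>G\<^esub> g = (\<lambda>x. g \<otimes>\<^bsub>G\<^esub> x \<otimes>\<^bsub>G\<^esub> inv\<^bsub>G\<^esub> g) ` I"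
      by (auto simp: l_coset_def r_coset_def)
    also have "\<dots> = (\<lambda>x. x) ` I"
      using comm g IG by (intro image_cong refl) (auto simp: G.m_assoc)
    finally show "g \<in> N" using g IG by (simp add: N_def normalizer_def stabilizer_def)
  qed
  ultimately show ?thesis by (rule finite_subset[rotated])
qed

text \<open>
  An element fixing no edge fixes a single vertex; otherwise a conjugate of it lies in an edge
  group and the normalizer condition applies.
\<close>

lemma finite_conjugators:
  assumes v: "v \<in> V" "c \<in> A v" "c \<noteq> \<one>\<^bsub>G\<^esub>" and x: "x \<in> V"
  shows "finite {k \<in> carrier G. inv\<^bsub>G\<^esub> k \<otimes>\<^bsub>G\<^esub> (c \<otimes>\<^bsub>G\<^esub> k) \<in> A x}"
proof (cases "\<exists>e\<in>D. \<exists>g\<in>carrier G. inv\<^bsub>G\<^esub> g \<otimes>\<^bsub>G\<^esub> (c \<otimes>\<^bsub>G\<^esub> g) \<in> E e")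
  case True
  then obtain e g where eg: "e \<in> D" "g \<in> carrier G" "inv\<^bsub>G\<^esub> g \<otimes>\<^bsub>G\<^esub> (c \<otimes>\<^bsub>G\<^esub> g) \<in> E e" by blast
  have c: "c \<in> carrier G" using v A_carrier by blast
  define c' where "c' = inv\<^bsub>G\<^esub> g \<otimes>\<^bsub>G\<^esub> (c \<otimes>\<^bsub>G\<^esub> g)"
  have c': "c' \<in> carrier G" "c' \<in> E e" using eg c by (simp_all add: c'_def)
  have "g \<otimes>\<^bsub>G\<^esub> (inv\<^bsub>G\<^esub> g \<otimes>\<^bsub>G\<^esub> c) = c" using eg c by (simp add: G.m_assoc[symmetric])
  then have "g \<otimes>\<^bsub>G\<^esub> c' \<otimes>\<^bsub>G\<^esub> inv\<^bsub>G\<^esub> g = c" using eg c by (simp add: c'_def G.m_assoc)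
  then have "c' \<noteq> \<one>\<^bsub>G\<^esub>" using v eg by auto
  then have fin: "finite {z \<in> carrier G. z \<otimes>\<^bsub>G\<^esub> c' = c' \<otimes>\<^bsub>G\<^esub> z}" (is "finite ?C")
    using finite_centralizer_edge eg c' by blast
  \<comment> \<open>The elements conjugating \<open>c\<close> to a given \<open>a\<close> form a
    coset of the centralizer of \<open>c\<close>, which conjugation by \<open>g\<close> carries to
    that of \<open>c'\<close>. As \<open>A x\<close> is finite, one \<open>a\<close> at a time
    suffices.\<close>
  have "finite {k \<in> carrier G. inv\<^bsub>G\<^esub> k \<otimes>\<^bsub>G\<^esub> (c \<otimes>\<^bsub>G\<^esub> k) = a}" (is "finite ?K") for a
  proof (cases "?K = {}")
    case False
    then obtain k0 where k0: "k0 \<in> carrier G" "inv\<^bsub>G\<^esub> k0 \<otimes>\<^bsub>G\<^esub> (c \<otimes>\<^bsub>G\<^esub> k0) = a" by blast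
    have "?K \<subseteq> (\<lambda>z. g \<otimes>\<^bsub>G\<^esub> z \<otimes>\<^bsub>G\<^esub> inv\<^bsub>G\<^esub> g \<otimes>\<^bsub>G\<^esub> k0) ` ?C"
    proof
      fix k assume "k \<in> ?K"
      then have k: "k \<in> carrier G" "inv\<^bsub>G\<^esub> k \<otimes>\<^bsub>G\<^esub> (c \<otimes>\<^bsub>G\<^esub> k) = inv\<^bsub>G\<^esub> k0 \<otimes>\<^bsub>G\<^esub> (c \<otimes>\<^bsub>G\<^esub> k0)"
        using k0 by auto
      define z where "z = inv\<^bsub>G\<^esub> g \<otimes>\<^bsub>G\<^esub> (k \<otimes>\<^bsub>G\<^esub> inv\<^bsub>G\<^esub> k0) \<otimes>\<^bsub>G\<^esub> g"
      have z: "z \<in> carrier G" using eg k k0 by (simp add: z_def)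
      have kz: "k = g \<otimes>\<^bsub>G\<^esub> z \<otimes>\<^bsub>G\<^esub> inv\<^bsub>G\<^esub> g \<otimes>\<^bsub>G\<^esub> k0"
        using eg k k0 by (simp add: z_def G.m_assoc) (simp add: G.m_assoc[symmetric])
      have "k \<otimes>\<^bsub>G\<^esub> inv\<^bsub>G\<^esub> k0 \<otimes>\<^bsub>G\<^esub> c = c \<otimes>\<^bsub>G\<^esub> (k \<otimes>\<^bsub>G\<^esub> inv\<^bsub>G\<^esub> k0)"
      proof -
        have "c \<otimes>\<^bsub>G\<^esub> k = k \<otimes>\<^bsub>G\<^esub> (inv\<^bsub>G\<^esub> k \<otimes>\<^bsub>G\<^esub> (c \<otimes>\<^bsub>G\<^esub> k))"
          using k(1) c by (simp add: G.m_assoc[symmetric])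
        also have "\<dots> = k \<otimes>\<^bsub>G\<^esub> (inv\<^bsub>G\<^esub> k0 \<otimes>\<^bsub>G\<^esub> (c \<otimes>\<^bsub>G\<^esub> k0))" by (simp only: k(2))
        finally have "c \<otimes>\<^bsub>G\<^esub> k \<otimes>\<^bsub>G\<^esub> inv\<^bsub>G\<^esub> k0 = k \<otimes>\<^bsub>G\<^esub> (inv\<^bsub>G\<^esub> k0 \<otimes>\<^bsub>G\<^esub> (c \<otimes>\<^bsub>G\<^esub> k0)) \<otimes>\<^bsub>G\<^esub> inv\<^bsub>G\<^esub> k0"
          by simp
        then show ?thesis using k(1) k0(1) c by (simp add: G.m_assoc)
      qed
      then have "z \<otimes>\<^bsub>G\<^esub> c' = c' \<otimes>\<^bsub>G\<^esub> z"
      proof -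
        assume *: "k \<otimes>\<^bsub>G\<^esub> inv\<^bsub>G\<^esub> k0 \<otimes>\<^bsub>G\<^esub> c = c \<otimes>\<^bsub>G\<^esub> (k \<otimes>\<^bsub>G\<^esub> inv\<^bsub>G\<^esub> k0)"
        define m where "m = k \<otimes>\<^bsub>G\<^esub> inv\<^bsub>G\<^esub> k0"
        have m: "m \<in> carrier G" "m \<otimes>\<^bsub>G\<^esub> c = c \<otimes>\<^bsub>G\<^esub> m" using k k0 * by (auto simp: m_def)
        have gg: "g \<otimes>\<^bsub>G\<^esub> (inv\<^bsub>G\<^esub> g \<otimes>\<^bsub>G\<^esub> y) = y" if "y \<in> carrier G" for y
          using eg that by (simp add: G.m_assoc[symmetric])
        have "z \<otimes>\<^bsub>G\<^esub> c' = inv\<^bsub>G\<^esub> g \<otimes>\<^bsub>G\<^esub> (m \<otimes>\<^bsub>G\<^esub> c) \<otimes>\<^bsub>G\<^esub> g"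
          using m(1) c eg gg unfolding z_def c'_def m_def[symmetric] by (simp add: G.m_assoc)
        also have "\<dots> = c' \<otimes>\<^bsub>G\<^esub> z"
          unfolding m(2) using m(1) c eg gg unfolding z_def c'_def m_def[symmetric]
          by (simp add: G.m_assoc)
        finally show ?thesis .
      qed
      then show "k \<in> (\<lambda>z. g \<otimes>\<^bsub>G\<^esub> z \<otimes>\<^bsub>G\<^esub> inv\<^bsub>G\<^esub> g \<otimes>\<^bsub>G\<^esub> k0) ` ?C" using kz z by blast
    qed
    then show ?thesis using fin finite_surj by blast
  qed (simp only: finite.emptyI)
  then have "finite (\<Union>a\<in>A x. {k \<in> carrier G. inv\<^bsub>G\<^esub> k \<otimes>\<^bsub>G\<^esub> (c \<otimes>\<^bsub>G\<^esub> k) = a})"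
    using finite_A[OF x] by blast
  then show ?thesis by (rule finite_subset[rotated]) auto
next
  case False
  have c: "c \<in> carrier G" using v A_carrier by blast
  have "{k \<in> carrier G. inv\<^bsub>G\<^esub> k \<otimes>\<^bsub>G\<^esub> (c \<otimes>\<^bsub>G\<^esub> k) \<in> A x} \<subseteq> A v"
  proof
    fix k assume "k \<in> {k \<in> carrier G. inv\<^bsub>G\<^esub> k \<otimes>\<^bsub>G\<^esub> (c \<otimes>\<^bsub>G\<^esub> k) \<in> A x}"
    then have k: "k \<in> carrier G" "inv\<^bsub>G\<^esub> k \<otimes>\<^bsub>G\<^esub> (c \<otimes>\<^bsub>G\<^esub> k) \<in> A x" by auto
    note subv = A_subgroup[OF v(1)] and subx = A_subgroup[OF x]
    \<comment> \<open>These are the cosets of \<open>\<one>\<close> at \<open>v\<close> and of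
      \<open>k\<close> at \<open>x\<close>, both preserved by \<open>c\<close>. Were they disjoint,
      the bridge between them would be an edge fixed by \<open>c\<close>.\<close>
    let ?P = "{v} \<times> A v" and ?P' = "{x} \<times> (\<lambda>a. k \<otimes>\<^bsub>G\<^esub> a) ` A x"
    have coset: "((u, g \<otimes>\<^bsub>G\<^esub> a), (u, g \<otimes>\<^bsub>G\<^esub> b)) \<in> tstep"
      if "u \<in> V" "g \<in> carrier G" "a \<in> A u" "b \<in> A u" for u g a b
    proof -
      have "a \<in> carrier G" "b \<in> carrier G" using that A_carrier by blast+
      moreover have "inv\<^bsub>G\<^esub> a \<otimes>\<^bsub>G\<^esub> b \<in> A u"
        using that A_subgroup subgroup.m_closed subgroup.m_inv_closed by metis
      ultimately show ?thesis
        using tstep_rotate[of u "g \<otimes>\<^bsub>G\<^esub> a" "inv\<^bsub>G\<^esub> a \<otimes>\<^bsub>G\<^esub> b"] that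
        by (simp add: G.m_assoc) (simp add: G.m_assoc[symmetric])
    qed
    have "?P \<inter> ?P' \<noteq> {}"
    proof
      assume disj: "?P \<inter> ?P' = {}"
      have "\<exists>e\<in>D. \<exists>g\<in>carrier G. (src e, g) \<in> ?P \<and> (tgt e, g) \<notin> ?P \<and>
        inv\<^bsub>G\<^esub> g \<otimes>\<^bsub>G\<^esub> (c \<otimes>\<^bsub>G\<^esub> g) \<in> E e"
      proof (rule bridge[OF c _ _ _ _ _ _ _ _ _ disj])
        show "?P \<subseteq> nodes" "?P' \<subseteq> nodes" using v x k A_carrier by (auto simp: nodes_def)
        show "?P \<noteq> {}" "?P' \<noteq> {}" using subgroup.one_closed subv subx by blast+
        show "(u, g \<otimes>\<^bsub>G\<^esub> a) \<in> ?P" if "(u, g) \<in> ?P" "a \<in> A u" for u g a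
          using that subv subgroup.m_closed by fastforce
        show "(p, q) \<in> (tstep \<inter> ?P \<times> ?P)\<^sup>*" if "p \<in> ?P" "q \<in> ?P" for p q
          using coset[of v "\<one>\<^bsub>G\<^esub>"] that v A_carrier by (intro r_into_rtrancl) auto
        show "translate c p \<in> ?P \<longleftrightarrow> p \<in> ?P" if "p \<in> nodes" for p
        proof -
          have "c \<otimes>\<^bsub>G\<^esub> g \<in> A v \<longleftrightarrow> g \<in> A v" if g: "g \<in> carrier G" for g
          proof
            assume "c \<otimes>\<^bsub>G\<^esub> g \<in> A v"
            then have "inv\<^bsub>G\<^esub> c \<otimes>\<^bsub>G\<^esub> (c \<otimes>\<^bsub>G\<^esub> g) \<in> A v"
              using subv v subgroup.m_closed subgroup.m_inv_closed by metis
            then show "g \<in> A v" using g c by (simp add: G.m_assoc[symmetric])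
          qed (use subv v subgroup.m_closed in metis)
          then show ?thesis using that by (auto simp: translate_def nodes_def)
        qed
        show "(p, q) \<in> (tstep \<inter> ?P' \<times> ?P')\<^sup>*" if "p \<in> ?P'" "q \<in> ?P'" for p q
          using coset[of x k] that x k by (intro r_into_rtrancl) auto
        show "translate c p \<in> ?P'" if p: "p \<in> ?P'" for p
        proof -
          obtain a where a: "a \<in> A x" "p = (x, k \<otimes>\<^bsub>G\<^esub> a)" using p by blast
          have ac: "a \<in> carrier G" using a x A_carrier by blast
          have "inv\<^bsub>G\<^esub> k \<otimes>\<^bsub>G\<^esub> (c \<otimes>\<^bsub>G\<^esub> k) \<otimes>\<^bsub>G\<^esub> a \<in> A x" using a k subx subgroup.m_closed by metis
          moreover have "c \<otimes>\<^bsub>G\<^esub> (k \<otimes>\<^bsub>G\<^esub> a) = k \<otimes>\<^bsub>G\<^esub> (inv\<^bsub>G\<^esub> k \<otimes>\<^bsub>G\<^esub> (c \<otimes>\<^bsub>G\<^esub> k) \<otimes>\<^bsub>G\<^esub> a)"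
            using k ac c by (simp add: G.m_assoc[symmetric])
          ultimately show ?thesis using a by (auto simp: translate_def)
        qed
      qed
      then show False using False by blast
    qed
    then obtain a where a: "x = v" "a \<in> A v" "k \<otimes>\<^bsub>G\<^esub> a \<in> A v" by auto
    then have "k \<otimes>\<^bsub>G\<^esub> a \<otimes>\<^bsub>G\<^esub> inv\<^bsub>G\<^esub> a \<in> A v"
      using subv subgroup.m_closed subgroup.m_inv_closed by metis
    then show "k \<in> A v" using a k v A_carrier[of v a] by (simp add: G.m_assoc)
  qed
  then show ?thesis using finite_A[OF v(1)] finite_subset by blast
qed

end

text \<open>A walk from \<open>b\<close> inside \<open>F\<close> visits only points of the component
  of \<open>b\<close>, so the component is connected by steps within itself.\<close>

lemma rtrancl_component:
  assumes "(b, q) \<in> (R \<inter> F \<times> F)\<^sup>*"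
  shows "(b, q) \<in> (R \<inter> {p. (b, p) \<in> (R \<inter> F \<times> F)\<^sup>*} \<times> {p. (b, p) \<in> (R \<inter> F \<times> F)\<^sup>*})\<^sup>*"
  using assms
proof (induction rule: rtrancl_induct)
  case base
  then show ?case by simp
next
  case (step y z)
  have "(b, z) \<in> (R \<inter> F \<times> F)\<^sup>*" using step.hyps by (rule rtrancl.rtrancl_into_rtrancl)
  then have "(y, z) \<in> R \<inter> {p. (b, p) \<in> (R \<inter> F \<times> F)\<^sup>*} \<times> {p. (b, p) \<in> (R \<inter> F \<times> F)\<^sup>*}"
    using step.hyps by simp
  with step.IH show ?case by (rule rtrancl.rtrancl_into_rtrancl)
qed

context normalizer_tree
begin

text \<open>
  If \<open>c\<close> fixes the coset \<open>gH\<close>, then \<open>g\<^sup>-\<^sup>1cg\<close> preserves an \<open>H\<close>-invariant subtree with finite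
  quotient and fixes a vertex of the Bass--Serre tree. By the bridge lemma it fixes a vertex
  of the subtree.
\<close>

theorem finite_fixed_cosets:
  assumes v: "v \<in> V" "c \<in> A v" "c \<noteq> \<one>\<^bsub>G\<^esub>" and S: "finite S" "S \<subseteq> carrier G"
  shows "finite ((\<lambda>g. g <#\<^bsub>G\<^esub> generate G S) `
    {g \<in> carrier G. inv\<^bsub>G\<^esub> g \<otimes>\<^bsub>G\<^esub> (c \<otimes>\<^bsub>G\<^esub> g) \<in> generate G S})"
proof -
  let ?H = "generate G S"
  define K where "K x = {k \<in> carrier G. inv\<^bsub>G\<^esub> k \<otimes>\<^bsub>G\<^esub> (c \<otimes>\<^bsub>G\<^esub> k) \<in> A x}" for x
  have c: "c \<in> carrier G" using v A_carrier by blast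
  have H: "subgroup ?H G" by (rule G.generate_is_subgroup[OF S(2)])
  have Hc: "h \<in> carrier G" if "h \<in> ?H" for h using H that subgroup.mem_carrier by metis
  obtain Y where Y: "finite Y" "Y \<subseteq> carrier G" "\<one>\<^bsub>G\<^esub> \<in> Y"
    and T0: "let T = V \<times> {h \<otimes>\<^bsub>G\<^esub> y | h y. h \<in> ?H \<and> y \<in> Y}
      in \<forall>p\<in>T. \<forall>q\<in>T. (p, q) \<in> (tstep \<inter> T \<times> T)\<^sup>*"
    using generate_tree[OF S] by (elim exE conjE)
  define T where "T = V \<times> {h \<otimes>\<^bsub>G\<^esub> y | h y. h \<in> ?H \<and> y \<in> Y}"
  have T_conn: "(p, q) \<in> (tstep \<inter> T \<times> T)\<^sup>*" if "p \<in> T" "q \<in> T" for p q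
    using T0 that by (simp add: T_def[symmetric] Let_def)
  have T_nodes: "T \<subseteq> nodes"
  proof
    fix p assume "p \<in> T"
    then obtain x h y where "p = (x, h \<otimes>\<^bsub>G\<^esub> y)" "x \<in> V" "h \<in> ?H" "y \<in> Y"
      unfolding T_def by blast
    then show "p \<in> nodes" using Hc Y by (auto simp: nodes_def)
  qed
  have T_ne: "T \<noteq> {}" using v(1) Y(3) subgroup.one_closed[OF H] unfolding T_def by blast
  have key: "\<exists>x\<in>V. \<exists>h\<in>?H. \<exists>y\<in>Y. g \<otimes>\<^bsub>G\<^esub> h \<otimes>\<^bsub>G\<^esub> y \<in> K x"
    if g: "g \<in> carrier G" and d: "inv\<^bsub>G\<^esub> g \<otimes>\<^bsub>G\<^esub> (c \<otimes>\<^bsub>G\<^esub> g) \<in> ?H" for g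
  proof -
    define d where "d = inv\<^bsub>G\<^esub> g \<otimes>\<^bsub>G\<^esub> (c \<otimes>\<^bsub>G\<^esub> g)"
    have dc: "d \<in> carrier G" "d \<in> ?H" using g c d by (simp_all add: d_def)
    \<comment> \<open>\<open>F\<close> consists of the nodes whose coset is preserved by
      \<open>d\<close>; it contains \<open>?b\<close> because \<open>g\<close> conjugates
      \<open>d\<close> back to \<open>c\<close>. The component \<open>P\<close> of \<open>?b\<close>
      in \<open>F\<close> is a subtree fixed by \<open>d\<close>.\<close>
    define F where "F = {p \<in> nodes. inv\<^bsub>G\<^esub> (snd p) \<otimes>\<^bsub>G\<^esub> (d \<otimes>\<^bsub>G\<^esub> snd p) \<in> A (fst p)}"
    let ?b = "(v, inv\<^bsub>G\<^esub> g)"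
    define P where "P = {p. (?b, p) \<in> (tstep \<inter> F \<times> F)\<^sup>*}"
    have bF: "?b \<in> F"
    proof -
      have "inv\<^bsub>G\<^esub> (inv\<^bsub>G\<^esub> g) \<otimes>\<^bsub>G\<^esub> (d \<otimes>\<^bsub>G\<^esub> inv\<^bsub>G\<^esub> g) = c"
        using g c by (simp add: d_def G.m_assoc) (simp add: G.m_assoc[symmetric])
      then show ?thesis using v g by (simp add: F_def nodes_def)
    qed
    have PF: "p \<in> F" if "p \<in> P" for p
    proof -
      have "(?b, p) \<in> (tstep \<inter> F \<times> F)\<^sup>*" using that by (simp add: P_def)
      then show ?thesis by (induction rule: rtrancl_induct) (use bF in auto)
    qed
    have P_step: "q \<in> P" if "p \<in> P" "q \<in> F" "(p, q) \<in> tstep" for p q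
    proof -
      have "(p, q) \<in> tstep \<inter> F \<times> F" using that PF by simp
      moreover have "(?b, p) \<in> (tstep \<inter> F \<times> F)\<^sup>*" using that(1) by (simp add: P_def)
      ultimately show ?thesis unfolding P_def mem_Collect_eq by (rule rtrancl.rtrancl_into_rtrancl[rotated])
    qed
    have F_sat: "(u, h \<otimes>\<^bsub>G\<^esub> a) \<in> F" if "(u, h) \<in> F" "a \<in> A u" for u h a
    proof -
      have u: "u \<in> V" "h \<in> carrier G" "inv\<^bsub>G\<^esub> h \<otimes>\<^bsub>G\<^esub> (d \<otimes>\<^bsub>G\<^esub> h) \<in> A u"
        using that by (auto simp: F_def nodes_def)
      have a: "a \<in> carrier G" "inv\<^bsub>G\<^esub> a \<in> A u"
        using u that A_carrier A_subgroup subgroup.m_inv_closed by metis+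
      have "inv\<^bsub>G\<^esub> a \<otimes>\<^bsub>G\<^esub> (inv\<^bsub>G\<^esub> h \<otimes>\<^bsub>G\<^esub> (d \<otimes>\<^bsub>G\<^esub> h)) \<otimes>\<^bsub>G\<^esub> a \<in> A u"
        using u a that A_subgroup subgroup.m_closed by metis
      then show ?thesis
        using u a dc by (simp add: F_def nodes_def G.inv_mult_group G.m_assoc)
    qed
    have P_sat: "(u, h \<otimes>\<^bsub>G\<^esub> a) \<in> P" if p: "(u, h) \<in> P" and a: "a \<in> A u" for u h a
    proof (rule P_step[OF p F_sat[OF PF[OF p] a]])
      show "((u, h), (u, h \<otimes>\<^bsub>G\<^esub> a)) \<in> tstep"
        using PF[OF p] a by (intro tstep_rotate) (auto simp: F_def nodes_def)
    qed
    have P_ne: "?b \<in> P" by (simp add: P_def)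
    have "P \<inter> T \<noteq> {}"
    proof
      assume disj: "P \<inter> T = {}"
      have "\<exists>e\<in>D. \<exists>g\<in>carrier G. (src e, g) \<in> P \<and> (tgt e, g) \<notin> P \<and>
        inv\<^bsub>G\<^esub> g \<otimes>\<^bsub>G\<^esub> (d \<otimes>\<^bsub>G\<^esub> g) \<in> E e"
      proof (rule bridge[OF dc(1) _ _ P_sat _ _ T_nodes T_ne T_conn _ disj])
        show "P \<subseteq> nodes" using PF by (auto simp: F_def)
        show "P \<noteq> {}" using P_ne by blast
        have conn: "(?b, p) \<in> (tstep \<inter> P \<times> P)\<^sup>*" if "p \<in> P" for p
          using rtrancl_component[of ?b p tstep F] that by (simp add: P_def)
        show "(p, q) \<in> (tstep \<inter> P \<times> P)\<^sup>*" if "p \<in> P" "q \<in> P" for p q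
          using rtrancl_tstep_sym[OF conn[OF that(1)]] conn[OF that(2)] by (rule rtrancl_trans)
        show "translate d p \<in> T" if p: "p \<in> T" for p
        proof -
          obtain x h y where xhy: "p = (x, h \<otimes>\<^bsub>G\<^esub> y)" "x \<in> V" "h \<in> ?H" "y \<in> Y"
            using p unfolding T_def by blast
          then have "translate d p = (x, (d \<otimes>\<^bsub>G\<^esub> h) \<otimes>\<^bsub>G\<^esub> y)"
            using dc Hc Y by (auto simp: translate_def G.m_assoc)
          moreover have "d \<otimes>\<^bsub>G\<^esub> h \<in> ?H" using dc xhy H subgroup.m_closed by metis
          then have "(x, (d \<otimes>\<^bsub>G\<^esub> h) \<otimes>\<^bsub>G\<^esub> y) \<in> T" using xhy unfolding T_def by blast
          ultimately show ?thesis by simp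
        qed
        show "translate d p \<in> P \<longleftrightarrow> p \<in> P" if p: "p \<in> nodes" for p
        proof -
          obtain u h where uh: "p = (u, h)" "u \<in> V" "h \<in> carrier G" using p by (auto simp: nodes_def)
          let ?a = "inv\<^bsub>G\<^esub> h \<otimes>\<^bsub>G\<^esub> (d \<otimes>\<^bsub>G\<^esub> h)"
          have a: "?a \<in> carrier G" using uh dc by simp
          have ha: "h \<otimes>\<^bsub>G\<^esub> ?a = d \<otimes>\<^bsub>G\<^esub> h" using uh dc by (simp add: G.m_assoc[symmetric])
          then have ha': "d \<otimes>\<^bsub>G\<^esub> h \<otimes>\<^bsub>G\<^esub> inv\<^bsub>G\<^esub> ?a = h"
            using uh a by (metis G.inv_solve_right G.m_closed dc(1))
          show ?thesis
          proof
            assume *: "p \<in> P"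
            then have "?a \<in> A u" using PF[of p] uh by (simp add: F_def)
            then show "translate d p \<in> P" using P_sat[of u h ?a] * uh ha by (simp add: translate_def)
          next
            assume *: "translate d p \<in> P"
            have "inv\<^bsub>G\<^esub> (d \<otimes>\<^bsub>G\<^esub> h) \<otimes>\<^bsub>G\<^esub> (d \<otimes>\<^bsub>G\<^esub> (d \<otimes>\<^bsub>G\<^esub> h)) = ?a"
              using uh dc by (simp add: G.inv_mult_group G.m_assoc) (simp add: G.m_assoc[symmetric])
            then have "?a \<in> A u" using PF[OF *] uh by (simp add: F_def translate_def)
            then have "inv\<^bsub>G\<^esub> ?a \<in> A u" using A_subgroup uh subgroup.m_inv_closed by metis
            then show "p \<in> P" using P_sat[of u "d \<otimes>\<^bsub>G\<^esub> h" "inv\<^bsub>G\<^esub> ?a"] * uh ha' by (simp add: translate_def)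
          qed
        qed
      qed
      then obtain e k where e: "e \<in> D" "k \<in> carrier G" "(src e, k) \<in> P" "(tgt e, k) \<notin> P"
        "inv\<^bsub>G\<^esub> k \<otimes>\<^bsub>G\<^esub> (d \<otimes>\<^bsub>G\<^esub> k) \<in> E e" by blast
      \<comment> \<open>An edge fixed by \<open>d\<close> has both ends in \<open>F\<close>, so it
        cannot lead out of the component \<open>P\<close>.\<close>
      then have "(tgt e, k) \<in> F" using E_tgt[OF e(1)] by (auto simp: F_def nodes_def)
      then have "(tgt e, k) \<in> P" using P_step[OF e(3)] tstep_cross[OF e(1,2)] by blast
      then show False using e by simp
    qed
    then obtain p where p: "p \<in> P" "p \<in> T" by blast
    then obtain x h y where xhy: "p = (x, h \<otimes>\<^bsub>G\<^esub> y)" "x \<in> V" "h \<in> ?H" "y \<in> Y"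
      unfolding T_def by blast
    have hy: "h \<in> carrier G" "y \<in> carrier G" using xhy Hc Y by auto
    have "inv\<^bsub>G\<^esub> (h \<otimes>\<^bsub>G\<^esub> y) \<otimes>\<^bsub>G\<^esub> (d \<otimes>\<^bsub>G\<^esub> (h \<otimes>\<^bsub>G\<^esub> y)) \<in> A x"
      using PF[OF p(1)] xhy by (simp add: F_def)
    then have "g \<otimes>\<^bsub>G\<^esub> h \<otimes>\<^bsub>G\<^esub> y \<in> K x"
      using g c hy by (simp add: K_def d_def G.inv_mult_group G.m_assoc)
    then show ?thesis using xhy by blast
  qed
  \<comment> \<open>The coset of \<open>g\<close> is recovered from \<open>y\<close> and from the
    product \<open>k\<close> of \<open>g\<close>, \<open>h\<close> and \<open>y\<close>; only
    finitely many such pairs exist.\<close>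
  have "(\<lambda>g. g <#\<^bsub>G\<^esub> ?H) ` {g \<in> carrier G. inv\<^bsub>G\<^esub> g \<otimes>\<^bsub>G\<^esub> (c \<otimes>\<^bsub>G\<^esub> g) \<in> ?H} \<subseteq>
    (\<Union>x\<in>V. \<Union>y\<in>Y. (\<lambda>k. (k \<otimes>\<^bsub>G\<^esub> inv\<^bsub>G\<^esub> y) <#\<^bsub>G\<^esub> ?H) ` K x)"
  proof
    fix C assume "C \<in> (\<lambda>g. g <#\<^bsub>G\<^esub> ?H) ` {g \<in> carrier G. inv\<^bsub>G\<^esub> g \<otimes>\<^bsub>G\<^esub> (c \<otimes>\<^bsub>G\<^esub> g) \<in> ?H}"
    then obtain g where g: "g \<in> carrier G" "inv\<^bsub>G\<^esub> g \<otimes>\<^bsub>G\<^esub> (c \<otimes>\<^bsub>G\<^esub> g) \<in> ?H" "C = g <#\<^bsub>G\<^esub> ?H"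
      by blast
    obtain x h y where xhy: "x \<in> V" "h \<in> ?H" "y \<in> Y" "g \<otimes>\<^bsub>G\<^esub> h \<otimes>\<^bsub>G\<^esub> y \<in> K x"
      using key[OF g(1,2)] by blast
    have hy: "h \<in> carrier G" "y \<in> carrier G" using xhy Hc Y by auto
    have "(g \<otimes>\<^bsub>G\<^esub> h) <#\<^bsub>G\<^esub> ?H = g <#\<^bsub>G\<^esub> (h <#\<^bsub>G\<^esub> ?H)"
      using G.lcos_m_assoc[OF subgroup.subset[OF H] g(1) hy(1)] by simp
    also have "h <#\<^bsub>G\<^esub> ?H = ?H" by (rule G.coset_join3[OF hy(1) H xhy(2)])
    finally have "(g \<otimes>\<^bsub>G\<^esub> h) <#\<^bsub>G\<^esub> ?H = C" using g by simp
    moreover have "g \<otimes>\<^bsub>G\<^esub> h \<otimes>\<^bsub>G\<^esub> y \<otimes>\<^bsub>G\<^esub> inv\<^bsub>G\<^esub> y = g \<otimes>\<^bsub>G\<^esub> h"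
      using g hy by (simp add: G.m_assoc)
    ultimately have "C \<in> (\<lambda>k. (k \<otimes>\<^bsub>G\<^esub> inv\<^bsub>G\<^esub> y) <#\<^bsub>G\<^esub> ?H) ` K x"
      by (intro image_eqI[OF _ xhy(4)]) simp
    then show "C \<in> (\<Union>x\<in>V. \<Union>y\<in>Y. (\<lambda>k. (k \<otimes>\<^bsub>G\<^esub> inv\<^bsub>G\<^esub> y) <#\<^bsub>G\<^esub> ?H) ` K x)"
      using xhy by blast
  qed
  moreover have "finite (K x)" if "x \<in> V" for x
    unfolding K_def using finite_conjugators[OF v that] .
  then have "finite (\<Union>x\<in>V. \<Union>y\<in>Y. (\<lambda>k. (k \<otimes>\<^bsub>G\<^esub> inv\<^bsub>G\<^esub> y) <#\<^bsub>G\<^esub> ?H) ` K x)"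
    using finite_V Y(1) by (intro finite_UN_I finite_imageI)
  ultimately show ?thesis by (rule finite_subset)
qed

end

section \<open>Finite completions of partial actions\<close>

lemma acts_Un: "acts G K \<alpha> \<Omega>1 \<Longrightarrow> acts G K \<alpha> \<Omega>2 \<Longrightarrow> acts G K \<alpha> (\<Omega>1 \<union> \<Omega>2)"
  unfolding acts_def by (simp add: ball_Un)

text \<open>Every orbit of a free action is a copy of \<open>K\<close>. Matching one orbit on each
  side through the parameter in \<open>K\<close> leaves free actions on smaller sets of equal
  size.\<close>

lemma (in group) free_acts_iso:
  assumes K: "subgroup K G"
    and "finite X1" "finite X2" "card X1 = card X2"
    and "acts G K \<alpha> X1" "acts G K \<beta> X2"
    and "\<And>a x. a \<in> K \<Longrightarrow> x \<in> X1 \<Longrightarrow> \<alpha> a x = x \<Longrightarrow> a = \<one>"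
    and "\<And>a x. a \<in> K \<Longrightarrow> x \<in> X2 \<Longrightarrow> \<beta> a x = x \<Longrightarrow> a = \<one>"
  shows "\<exists>f. bij_betw f X1 X2 \<and> (\<forall>a\<in>K. \<forall>x\<in>X1. f (\<alpha> a x) = \<beta> a (f x))"
  using assms(2-)
proof (induction "card X1" arbitrary: X1 X2 rule: less_induct)
  case less
  note act1 = less.prems(4) and act2 = less.prems(5)
  note Kc = subgroup.mem_carrier[OF K]
  have inj: "inj_on (\<lambda>a. \<gamma> a x) K"
    if act: "acts G K \<gamma> Y" and free: "\<forall>a\<in>K. \<forall>x\<in>Y. \<gamma> a x = x \<longrightarrow> a = \<one>" and x: "x \<in> Y"
    for x Y and \<gamma> :: "'a \<Rightarrow> 'z \<Rightarrow> 'z"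
  proof (rule inj_onI)
    fix a b assume ab: "a \<in> K" "b \<in> K" "\<gamma> a x = \<gamma> b x"
    have "\<gamma> (inv b \<otimes> a) x = x"
      using ab x acts_mult[OF act, of "inv b" a x] acts_inv(1)[OF act K ab(2) x]
        subgroup.m_inv_closed[OF K] by simp
    then have "inv b \<otimes> a = \<one>"
      using ab x free subgroup.m_closed[OF K] subgroup.m_inv_closed[OF K] by blast
    then show "a = b" using ab Kc by (metis inv_equality inv_inv inv_closed)
  qed
  show ?case
  proof (cases "X1 = {}")
    case True
    then have "X2 = {}" using less.prems by auto
    then show ?thesis using True by (auto simp: bij_betw_def)
  next
    case False
    then obtain x1 where x1: "x1 \<in> X1" by blast
    have "X2 \<noteq> {}" using False less.prems by auto
    then obtain x2 where x2: "x2 \<in> X2" by blast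
    let ?O1 = "(\<lambda>a. \<alpha> a x1) ` K" and ?O2 = "(\<lambda>a. \<beta> a x2) ` K"
    have inj1: "inj_on (\<lambda>a. \<alpha> a x1) K"
      by (rule inj[OF act1 _ x1]) (use less.prems(6) in blast)
    have inj2: "inj_on (\<lambda>a. \<beta> a x2) K"
      by (rule inj[OF act2 _ x2]) (use less.prems(7) in blast)
    have sub: "?O1 \<subseteq> X1" "?O2 \<subseteq> X2"
      using acts_closed[OF act1 _ x1] acts_closed[OF act2 _ x2] by blast+
    have cards: "card (X1 - ?O1) = card (X2 - ?O2)"
      using sub less.prems(1-3) card_image[OF inj1] card_image[OF inj2]
      by (simp add: card_Diff_subset finite_subset)
    have "x1 \<in> ?O1" using acts_one[OF act1 x1] subgroup.one_closed[OF K] by (metis image_eqI)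
    then have lt: "card (X1 - ?O1) < card X1"
      using x1 less.prems(1) by (intro psubset_card_mono) auto
    have rest: "acts G K \<gamma> (Y - (\<lambda>a. \<gamma> a y) ` K)"
      if "acts G K \<gamma> Y" "y \<in> Y" for Y y and \<gamma> :: "'a \<Rightarrow> 'z \<Rightarrow> 'z"
    proof -
      have "\<gamma> a x \<notin> (\<lambda>a. \<gamma> a y) ` K" if x: "a \<in> K" "x \<in> Y - (\<lambda>a. \<gamma> a y) ` K" for a x
      proof
        assume "\<gamma> a x \<in> (\<lambda>a. \<gamma> a y) ` K"
        then obtain b where b: "b \<in> K" "\<gamma> a x = \<gamma> b y" by blast
        have "\<gamma> (inv a \<otimes> b) y = \<gamma> (inv a) (\<gamma> a x)"
          using acts_mult[OF \<open>acts G K \<gamma> Y\<close>] b x \<open>y \<in> Y\<close> subgroup.m_inv_closed[OF K] by simp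
        also have "\<dots> = x" using acts_inv(1)[OF \<open>acts G K \<gamma> Y\<close> K] x by simp
        finally show False
          using x b subgroup.m_closed[OF K] subgroup.m_inv_closed[OF K] by (metis DiffD2 image_eqI)
      qed
      then show ?thesis using that unfolding acts_def by simp
    qed
    have "\<exists>f. bij_betw f (X1 - ?O1) (X2 - ?O2) \<and> (\<forall>a\<in>K. \<forall>x\<in>X1 - ?O1. f (\<alpha> a x) = \<beta> a (f x))"
    proof (rule less.hyps[OF lt _ _ cards rest[OF act1 x1] rest[OF act2 x2]])
      show "finite (X1 - ?O1)" "finite (X2 - ?O2)" using less.prems(1,2) by simp_all
      show "a = \<one>" if "a \<in> K" "x \<in> X1 - ?O1" "\<alpha> a x = x" for a x
        using less.prems(6)[OF that(1) _ that(3)] that(2) by simp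
      show "a = \<one>" if "a \<in> K" "x \<in> X2 - ?O2" "\<beta> a x = x" for a x
        using less.prems(7)[OF that(1) _ that(3)] that(2) by simp
    qed
    then obtain f where f: "bij_betw f (X1 - ?O1) (X2 - ?O2)"
      "\<forall>a\<in>K. \<forall>x\<in>X1 - ?O1. f (\<alpha> a x) = \<beta> a (f x)"
      by (elim exE conjE)
    \<comment> \<open>By freeness, a point of the orbit of \<open>x1\<close> determines the element
      of \<open>K\<close> that leads to it.\<close>
    define f0 where "f0 y = \<beta> (inv_into K (\<lambda>a. \<alpha> a x1) y) x2" for y
    have f0: "f0 (\<alpha> a x1) = \<beta> a x2" if "a \<in> K" for a
      using inv_into_f_f[OF inj1 that] by (simp add: f0_def)
    have f0_bij: "bij_betw f0 ?O1 ?O2"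
    proof (rule bij_betw_imageI)
      show "inj_on f0 ?O1" using f0 inj2 by (auto simp: inj_on_def)
      show "f0 ` ?O1 = ?O2" using f0 by (simp add: image_image)
    qed
    define F where "F x = (if x \<in> ?O1 then f0 x else f x)" for x
    have "bij_betw F ?O1 ?O2"
      using f0_bij by (rule bij_betw_cong[THEN iffD1, rotated]) (simp add: F_def)
    moreover have "bij_betw F (X1 - ?O1) (X2 - ?O2)"
      using f(1) by (rule bij_betw_cong[THEN iffD1, rotated]) (simp add: F_def)
    ultimately have "bij_betw F (?O1 \<union> (X1 - ?O1)) (?O2 \<union> (X2 - ?O2))"
      by (rule bij_betw_combine) blast
    moreover have "?O1 \<union> (X1 - ?O1) = X1" "?O2 \<union> (X2 - ?O2) = X2" using sub by blast+
    moreover have "F (\<alpha> a x) = \<beta> a (F x)" if ax: "a \<in> K" "x \<in> X1" for a x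
    proof (cases "x \<in> ?O1")
      case True
      then obtain b where b: "b \<in> K" "x = \<alpha> b x1" by blast
      have ab: "\<alpha> a x = \<alpha> (a \<otimes> b) x1" using acts_mult[OF act1] ax b x1 by simp
      have abK: "a \<otimes> b \<in> K" using ax b subgroup.m_closed[OF K] by blast
      have "F (\<alpha> a x) = f0 (\<alpha> (a \<otimes> b) x1)" unfolding ab F_def using abK by simp
      also have "\<dots> = \<beta> a (\<beta> b x2)" using f0[OF abK] acts_mult[OF act2] ax b x2 by simp
      also have "\<beta> b x2 = F x" using b f0 by (simp add: F_def)
      finally show ?thesis .
    next
      case False
      then have "\<alpha> a x \<in> X1 - ?O1" using acts_closed[OF rest[OF act1 x1]] ax by blast
      then show ?thesis using f(2) ax False by (simp add: F_def)
    qed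
    ultimately show ?thesis by (intro exI[of _ F]) simp
  qed
qed

context tree_of_finite_groups
begin

text \<open>
  The orbits meeting \<open>B\<close> are taken \<open>L\<close> times and completed by free orbits, so that the sets
  \<open>Z v\<close> on which the vertex groups act all have the same size. Outside the edge orbits of \<open>B\<close>,
  which are common to both sides of an edge, the edge groups act freely.
\<close>

theorem completion:
  fixes Y :: "'y set"
  assumes act: "acts G (carrier G) act Y"
    and B: "finite B" "B \<subseteq> Y"
    and free: "\<And>v a y. v \<in> V \<Longrightarrow> a \<in> A v \<Longrightarrow> a \<noteq> \<one>\<^bsub>G\<^esub> \<Longrightarrow> y \<in> Y \<Longrightarrow> act a y = y \<Longrightarrow> y \<in> B"
  shows "\<exists>(\<Omega> :: ('y \<times> nat + ('v, 'e, 'a) letter list set \<times> nat) set) act' \<iota>.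
    finite \<Omega> \<and> acts G (carrier G) act' \<Omega> \<and> \<iota> ` B \<subseteq> \<Omega> \<and> inj_on \<iota> B \<and>
    (\<forall>v\<in>V. \<forall>a\<in>A v. \<forall>y\<in>B. act a y \<in> B \<longrightarrow> act' a (\<iota> y) = \<iota> (act a y))"
proof -
  \<comment> \<open>Free orbits change the size of \<open>Z v\<close> by multiples of
    \<open>card (A v)\<close> only, so single copies of the sets \<open>Bt (A v)\<close> cannot in
    general be completed to a common size. The size of \<open>L\<close> copies is divisible by the
    order of every vertex subgroup, and \<open>k v\<close> free orbits bring it to
    \<open>m * L\<close>; the bound \<open>m\<close> keeps the subtraction in \<open>k v\<close>
    from being truncated.\<close>
  define Bt where "Bt K = (\<Union>a\<in>K. act a ` B)" for K
  define L where "L = (\<Prod>v\<in>V. card (A v))"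
  define m where "m = card (\<Union>v\<in>V. Bt (A v))"
  define k where "k v = (m - card (Bt (A v))) * (L div card (A v))" for v
  define Z where "Z v = Inl ` (Bt (A v) \<times> {..<L}) \<union> Inr ` (A v \<times> {..<k v})" for v
  define \<alpha> where "\<alpha> a z = (case z of Inl yl \<Rightarrow> Inl (act a (fst yl), snd yl)
      | Inr bi \<Rightarrow> Inr (a \<otimes>\<^bsub>G\<^esub> fst bi, snd bi))"
    for a and z :: "'y \<times> nat + ('v, 'e, 'a) letter list set \<times> nat"
  \<comment> \<open>A part common to both ends of \<open>e\<close>, on which the gluing map will be
    the identity.\<close>
  define C where "C e = (Inl ` (Bt (E e) \<times> {..<L}) :: ('y \<times> nat + ('v, 'e, 'a) letter list set \<times> nat) set)"
    for e
  have one: "\<one>\<^bsub>G\<^esub> \<in> A v" if "v \<in> V" for v using A_subgroup[OF that] by (rule subgroup.one_closed)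
  have cardA: "card (A v) > 0" if "v \<in> V" for v
    using one[OF that] finite_A[OF that] by (auto simp: card_gt_0_iff)
  have L0: "L > 0" unfolding L_def using cardA by (simp add: prod_pos)
  have finBt: "finite (Bt (A v))" if "v \<in> V" for v using finite_A[OF that] B by (simp add: Bt_def)
  have BtY: "Bt K \<subseteq> Y" if "K \<subseteq> carrier G" for K
    using that acts_closed[OF act] B by (auto simp: Bt_def)
  have B_Bt: "B \<subseteq> Bt K" if "subgroup K G" for K
  proof
    fix y assume y: "y \<in> B"
    then have "act \<one>\<^bsub>G\<^esub> y = y" using acts_one[OF act] B by blast
    then show "y \<in> Bt K" using subgroup.one_closed[OF that] y unfolding Bt_def by force
  qed
  have Bt_inv: "act a y \<in> Bt K" if K: "subgroup K G" "a \<in> K" "y \<in> Bt K" for K a y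
  proof -
    obtain b y' where b: "b \<in> K" "y' \<in> B" "y = act b y'" using K(3) unfolding Bt_def by blast
    then have "act a y = act (a \<otimes>\<^bsub>G\<^esub> b) y'"
      using acts_mult[OF act, of a b y'] K B subgroup.mem_carrier[OF K(1)] by auto
    moreover have "a \<otimes>\<^bsub>G\<^esub> b \<in> K" using b K subgroup.m_closed by metis
    ultimately show ?thesis using b unfolding Bt_def by blast
  qed
  have acts_Bt: "acts G K \<alpha> (Inl ` (Bt K' \<times> {..<L}))"
    if K: "subgroup K G" and K': "\<And>a y. a \<in> K \<Longrightarrow> y \<in> Bt K' \<Longrightarrow> act a y \<in> Bt K'" "K' \<subseteq> carrier G" for K K'
    unfolding acts_def
  proof (intro conjI ballI)
    have Y: "y \<in> Y" if "y \<in> Bt K'" for y using BtY[OF K'(2)] that by blast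
    fix z :: "'y \<times> nat + ('v, 'e, 'a) letter list set \<times> nat"
    assume "z \<in> Inl ` (Bt K' \<times> {..<L})"
    then obtain y l where z: "z = Inl (y, l)" "y \<in> Bt K'" "l \<in> {..<L}" by blast
    show "\<alpha> \<one>\<^bsub>G\<^esub> z = z" using z acts_one[OF act Y[OF z(2)]] by (simp add: \<alpha>_def)
    fix a assume a: "a \<in> K"
    have "(act a y, l) \<in> Bt K' \<times> {..<L}" using K'(1)[OF a z(2)] z(3) by simp
    then show "\<alpha> a z \<in> Inl ` (Bt K' \<times> {..<L})" using z(1) by (simp add: \<alpha>_def image_eqI)
    fix b assume b: "b \<in> K"
    show "\<alpha> (a \<otimes>\<^bsub>G\<^esub> b) z = \<alpha> a (\<alpha> b z)"
      using acts_mult[OF act subgroup.mem_carrier[OF K a] subgroup.mem_carrier[OF K b] Y[OF z(2)]]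
      by (simp add: \<alpha>_def z(1))
  qed
  have acts_Z: "acts G (A v) \<alpha> (Z v)" if v: "v \<in> V" for v
  proof -
    have "acts G (A v) \<alpha> (Inl ` (Bt (A v) \<times> {..<L}))"
      using Bt_inv[OF A_subgroup[OF v]] A_carrier[OF v] by (intro acts_Bt A_subgroup v) auto
    moreover have "acts G (A v) \<alpha> (Inr ` (A v \<times> {..<k v}))"
      unfolding acts_def
    proof (intro conjI ballI)
      fix z :: "'y \<times> nat + ('v, 'e, 'a) letter list set \<times> nat"
      assume "z \<in> Inr ` (A v \<times> {..<k v})"
      then obtain c i where z: "z = Inr (c, i)" "c \<in> A v" "i \<in> {..<k v}" by blast
      note c = A_carrier[OF v z(2)]
      show "\<alpha> \<one>\<^bsub>G\<^esub> z = z" using z c by (simp add: \<alpha>_def)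
      fix a assume a: "a \<in> A v"
      have "(a \<otimes>\<^bsub>G\<^esub> c, i) \<in> A v \<times> {..<k v}"
        using subgroup.m_closed[OF A_subgroup[OF v] a z(2)] z(3) by simp
      then show "\<alpha> a z \<in> Inr ` (A v \<times> {..<k v})" using z(1) by (simp add: \<alpha>_def image_eqI)
      fix b assume b: "b \<in> A v"
      show "\<alpha> (a \<otimes>\<^bsub>G\<^esub> b) z = \<alpha> a (\<alpha> b z)"
        using c A_carrier[OF v a] A_carrier[OF v b] by (simp add: \<alpha>_def z(1) G.m_assoc)
    qed
    ultimately show ?thesis unfolding Z_def by (rule acts_Un)
  qed
  have finZ: "finite (Z v)" if "v \<in> V" for v
    using finBt[OF that] finite_A[OF that] by (simp add: Z_def)
  have cardZ: "card (Z v) = m * L" if v: "v \<in> V" for v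
  proof -
    have "card (Z v) = card (Bt (A v)) * L + card (A v) * k v"
    proof -
      have "card (Inl ` (Bt (A v) \<times> {..<L}) :: ('y \<times> nat + ('v, 'e, 'a) letter list set \<times> nat) set) =
          card (Bt (A v)) * L"
        by (subst card_image) (simp_all add: card_cartesian_product)
      moreover have "card (Inr ` (A v \<times> {..<k v}) :: ('y \<times> nat + ('v, 'e, 'a) letter list set \<times> nat) set) =
          card (A v) * k v"
        by (subst card_image) (simp_all add: card_cartesian_product)
      moreover have "card (Z v) = card (Inl ` (Bt (A v) \<times> {..<L}) :: ('y \<times> nat + ('v, 'e, 'a) letter list set \<times> nat) set) +
          card (Inr ` (A v \<times> {..<k v}) :: ('y \<times> nat + ('v, 'e, 'a) letter list set \<times> nat) set)"
        unfolding Z_def using finBt[OF v] finite_A[OF v] by (intro card_Un_disjoint) auto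
      ultimately show ?thesis by simp
    qed
    moreover have "card (A v) dvd L" unfolding L_def using v finite_V by (rule dvd_prodI[rotated])
    then have "card (A v) * (L div card (A v)) = L" by simp
    then have "card (A v) * k v = (m - card (Bt (A v))) * L"
      by (simp add: k_def mult.left_commute)
    moreover have "card (Bt (A v)) \<le> m"
      unfolding m_def using finBt finite_V v by (intro card_mono) auto
    ultimately show ?thesis by (simp add: distrib_right[symmetric])
  qed
  have ex_\<beta>: "\<exists>f. bij_betw f (Z (src e)) (Z (tgt e)) \<and>
      (\<forall>a\<in>E e. \<forall>z\<in>Z (src e). f (\<alpha> a z) = \<alpha> a (f z)) \<and> (\<forall>z\<in>C e. f z = z)" if e: "e \<in> D" for e
  proof -
    note sub = E_subgroup[OF e]
    have st: "src e \<in> V" "tgt e \<in> V" using e by auto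
    have CZ: "C e \<subseteq> Z (src e)" "C e \<subseteq> Z (tgt e)"
      using E_src[OF e] E_tgt[OF e] by (auto simp: C_def Z_def Bt_def)
    have actC: "acts G (E e) \<alpha> (C e)"
      unfolding C_def using Bt_inv[OF sub] subgroup.subset[OF sub] by (intro acts_Bt sub) auto
    have rest: "acts G (E e) \<alpha> (Z v - C e)" if v: "v \<in> V" "E e \<subseteq> A v" for v
    proof -
      have Zv: "acts G (E e) \<alpha> (Z v)" using acts_Z[OF v(1)] v(2) by (rule acts_subset)
      have "\<alpha> a z \<notin> C e" if az: "a \<in> E e" "z \<in> Z v - C e" for a z
      proof
        assume *: "\<alpha> a z \<in> C e"
        have "inv\<^bsub>G\<^esub> a \<in> E e" using az subgroup.m_inv_closed[OF sub] by blast
        then have "\<alpha> (inv\<^bsub>G\<^esub> a) (\<alpha> a z) \<in> C e" using acts_closed[OF actC] * by blast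
        then show False using G.acts_inv(1)[OF Zv sub az(1)] az by simp
      qed
      then show ?thesis using Zv unfolding acts_def by simp
    qed
    \<comment> \<open>A point of \<open>Y\<close> fixed by a nontrivial vertex element lies in
      \<open>B\<close>, so all its copies are in \<open>C e\<close>; on the added orbits the action
      is translation in the group.\<close>
    have freeZ: "a = \<one>\<^bsub>G\<^esub>" if v: "v \<in> V" "E e \<subseteq> A v" and az: "a \<in> E e" "z \<in> Z v - C e" "\<alpha> a z = z" for v a z
    proof -
      have aA: "a \<in> A v" using v az by blast
      have ac: "a \<in> carrier G" using A_carrier[OF v(1) aA] .
      show ?thesis
      proof (cases z)
        case (Inl yl)
        then have "Inl yl \<in> Inl ` (Bt (A v) \<times> {..<L}) \<union> Inr ` (A v \<times> {..<k v})" "Inl yl \<notin> C e"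
          using az(2) by (simp_all add: Z_def)
        then have yl: "yl \<in> Bt (A v) \<times> {..<L}" "yl \<notin> Bt (E e) \<times> {..<L}"
          unfolding C_def by (elim UnE imageE, simp_all) (metis imageI)
        have "A v \<subseteq> carrier G" using A_carrier[OF v(1)] by blast
        then have "fst yl \<in> Y" using yl(1) BtY by (metis SigmaE fst_conv subsetD)
        moreover have "fst yl \<notin> Bt (E e)" using yl by (metis SigmaE SigmaI fst_conv)
        then have "fst yl \<notin> B" using B_Bt[OF sub] by (metis subsetD)
        moreover have "(act a (fst yl), snd yl) = yl" using az(3) Inl by (simp add: \<alpha>_def)
        then have "act a (fst yl) = fst yl" by (metis fst_conv)
        ultimately show ?thesis using free[OF v(1) aA] by blast
      next
        case (Inr bi)
        then have "fst bi \<in> A v" "a \<otimes>\<^bsub>G\<^esub> fst bi = fst bi"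
          using az(2,3) by (auto simp: Z_def \<alpha>_def prod_eq_iff)
        then show ?thesis using ac A_carrier[OF v(1)] by simp
      qed
    qed
    have "card (Z (src e) - C e) = card (Z (tgt e) - C e)"
      using cardZ st CZ finite_subset[OF CZ(1) finZ[OF st(1)]] by (simp add: card_Diff_subset)
    then have "\<exists>F. bij_betw F (Z (src e) - C e) (Z (tgt e) - C e) \<and>
      (\<forall>a\<in>E e. \<forall>z\<in>Z (src e) - C e. F (\<alpha> a z) = \<alpha> a (F z))"
      using finZ[OF st(1)] finZ[OF st(2)]
      by (intro G.free_acts_iso[OF sub] rest[OF st(1) E_src[OF e]] rest[OF st(2) E_tgt[OF e]]
        finite_Diff freeZ[OF st(1) E_src[OF e]] freeZ[OF st(2) E_tgt[OF e]])
    then obtain F where F: "bij_betw F (Z (src e) - C e) (Z (tgt e) - C e)"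
      "\<forall>a\<in>E e. \<forall>z\<in>Z (src e) - C e. F (\<alpha> a z) = \<alpha> a (F z)"
      by (elim exE conjE)
    define f where "f z = (if z \<in> C e then z else F z)" for z
    have "bij_betw f (C e) (C e)"
      using bij_betw_id by (rule bij_betw_cong[THEN iffD1, rotated]) (simp add: f_def)
    moreover have "bij_betw f (Z (src e) - C e) (Z (tgt e) - C e)"
      using F(1) by (rule bij_betw_cong[THEN iffD1, rotated]) (simp add: f_def)
    ultimately have "bij_betw f (C e \<union> (Z (src e) - C e)) (C e \<union> (Z (tgt e) - C e))"
      by (rule bij_betw_combine) blast
    moreover have "C e \<union> (Z (src e) - C e) = Z (src e)" "C e \<union> (Z (tgt e) - C e) = Z (tgt e)"
      using CZ by blast+
    moreover have "f (\<alpha> a z) = \<alpha> a (f z)" if az: "a \<in> E e" "z \<in> Z (src e)" for a z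
    proof (cases "z \<in> C e")
      case True
      then show ?thesis using acts_closed[OF actC az(1)] by (simp add: f_def)
    next
      case False
      then have "\<alpha> a z \<in> Z (src e) - C e"
        using acts_closed[OF rest[OF st(1) E_src[OF e]] az(1)] az by blast
      then show ?thesis using F(2) az False by (simp add: f_def)
    qed
    ultimately show ?thesis by (intro exI[of _ f]) (simp add: f_def)
  qed
  then have "\<exists>\<beta>. \<forall>e\<in>D. bij_betw (\<beta> e) (Z (src e)) (Z (tgt e)) \<and>
      (\<forall>a\<in>E e. \<forall>z\<in>Z (src e). \<beta> e (\<alpha> a z) = \<alpha> a (\<beta> e z)) \<and> (\<forall>z\<in>C e. \<beta> e z = z)"
    by (intro bchoice ballI)
  then obtain \<beta> where \<beta>: "\<forall>e\<in>D. bij_betw (\<beta> e) (Z (src e)) (Z (tgt e)) \<and>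
      (\<forall>a\<in>E e. \<forall>z\<in>Z (src e). \<beta> e (\<alpha> a z) = \<alpha> a (\<beta> e z)) \<and> (\<forall>z\<in>C e. \<beta> e z = z)"
    by (elim exE)
  let ?S = "{(z, \<beta> e z) | e z. e \<in> D \<and> z \<in> Z (src e)}"
  have "\<exists>r \<gamma> \<delta>. r \<in> V \<and> (\<forall>v\<in>V. bij_betw (\<gamma> v) (Z v) (Z r)) \<and>
    acts G (carrier G) \<delta> (Z r) \<and>
    (\<forall>v\<in>V. \<forall>a\<in>A v. \<forall>z\<in>Z v. \<delta> a (\<gamma> v z) = \<gamma> v (\<alpha> a z)) \<and>
    (\<forall>v\<in>V. \<forall>z\<in>Z v. (z, \<gamma> v z) \<in> ?S\<^sup>*)"
    by (rule gluing) (use acts_Z \<beta> in simp_all)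
  then obtain r \<gamma> \<delta> where r: "r \<in> V"
    and \<delta>: "acts G (carrier G) \<delta> (Z r)"
    and \<gamma>\<delta>: "\<forall>v\<in>V. \<forall>a\<in>A v. \<forall>z\<in>Z v. \<delta> a (\<gamma> v z) = \<gamma> v (\<alpha> a z)"
    and \<gamma>_chain: "\<forall>v\<in>V. \<forall>z\<in>Z v. (z, \<gamma> v z) \<in> ?S\<^sup>*"
    by (elim exE conjE)
  \<comment> \<open>Copy number 0 serves for the embedding; it exists because \<open>L\<close> is
    positive.\<close>
  define \<iota> where "\<iota> y = (Inl (y, 0) :: 'y \<times> nat + ('v, 'e, 'a) letter list set \<times> nat)" for y
  have \<iota>Z: "\<iota> y \<in> Z v" if "y \<in> B" "v \<in> V" for y v
    using B_Bt[OF A_subgroup[OF that(2)]] that L0 by (auto simp: \<iota>_def Z_def)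
  \<comment> \<open>\<open>\<iota> y\<close> lies in \<open>C e\<close> for every edge, so no gluing
    map moves it, and the identification with \<open>Z r\<close> leaves it in place.\<close>
  have fixed: "\<gamma> v (\<iota> y) = \<iota> y" if y: "y \<in> B" "v \<in> V" for v y
  proof -
    have "z = \<iota> y" if "(\<iota> y, z) \<in> ?S\<^sup>*" for z
      using that
    proof (induction rule: rtrancl_induct)
      case (step z z')
      then obtain e where "e \<in> D" "z' = \<beta> e (\<iota> y)" by auto
      moreover have "\<iota> y \<in> C e" if "e \<in> D"
        using B_Bt[OF E_subgroup[OF that]] y L0 by (auto simp: \<iota>_def C_def)
      ultimately show ?case using \<beta> by auto
    qed simp
    then show ?thesis using \<gamma>_chain[rule_format, OF y(2) \<iota>Z[OF y]] by blast
  qed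
  have "\<delta> a (\<iota> y) = \<iota> (act a y)" if "v \<in> V" "a \<in> A v" "y \<in> B" "act a y \<in> B" for v a y
    using \<gamma>\<delta>[rule_format, OF that(1,2) \<iota>Z[OF that(3,1)]] fixed that by (simp add: \<alpha>_def \<iota>_def)
  moreover have "inj_on \<iota> B" by (auto simp: inj_on_def \<iota>_def)
  moreover have "\<iota> ` B \<subseteq> Z r" using \<iota>Z r by blast
  ultimately show ?thesis
    using finZ[OF r] \<delta> by (intro exI[of _ "Z r"] exI[of _ \<delta>] exI[of _ \<iota>]) simp
qed

section \<open>Balls in the Cayley graph and residual finiteness\<close>

text \<open>Products of \<open>n\<close> vertex elements, built by left multiplication so that a
  further factor extends the walk of a point at its end. As the identity lies in every
  \<open>A v\<close>, this is the ball of radius \<open>n\<close> in the Cayley graph.\<close>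

primrec gball :: "nat \<Rightarrow> ('v, 'e, 'a) letter list set set" where
  "gball 0 = {\<one>\<^bsub>G\<^esub>}"
| "gball (Suc n) = (\<Union>v\<in>V. \<Union>a\<in>A v. (\<lambda>w. a \<otimes>\<^bsub>G\<^esub> w) ` gball n)"

lemma V_nonempty: "V \<noteq> {}"
  using base_connected by (auto simp: connected_def strongly_connected_def)

lemma gball_Suc_I: "v \<in> V \<Longrightarrow> a \<in> A v \<Longrightarrow> w \<in> gball n \<Longrightarrow> a \<otimes>\<^bsub>G\<^esub> w \<in> gball (Suc n)"
  by auto

lemma gball_Suc_E:
  assumes "w \<in> gball (Suc n)"
  obtains v a w' where "v \<in> V" "a \<in> A v" "w' \<in> gball n" "w = a \<otimes>\<^bsub>G\<^esub> w'"
  using assms unfolding gball.simps by (elim UN_E imageE) (rule that)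

lemma gball_carrier: "w \<in> gball n \<Longrightarrow> w \<in> carrier G"
proof (induction n arbitrary: w)
  case (Suc n)
  from Suc.prems obtain v a w' where "v \<in> V" "a \<in> A v" "w' \<in> gball n" "w = a \<otimes>\<^bsub>G\<^esub> w'"
    by (rule gball_Suc_E)
  then show ?case using Suc.IH A_carrier by blast
qed simp

lemma finite_gball: "finite (gball n)"
  by (induction n) (use finite_V finite_A in auto)

lemma gball_mult: "x \<in> gball m \<Longrightarrow> y \<in> gball n \<Longrightarrow> x \<otimes>\<^bsub>G\<^esub> y \<in> gball (m + n)"
proof (induction m arbitrary: x)
  case 0
  then show ?case using gball_carrier by simp
next
  case (Suc m)
  from Suc.prems(1) obtain v a w where w: "v \<in> V" "a \<in> A v" "w \<in> gball m" "x = a \<otimes>\<^bsub>G\<^esub> w"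
    by (rule gball_Suc_E)
  then have "a \<otimes>\<^bsub>G\<^esub> (w \<otimes>\<^bsub>G\<^esub> y) \<in> gball (Suc (m + n))"
    using Suc by (intro gball_Suc_I) auto
  moreover have "a \<otimes>\<^bsub>G\<^esub> (w \<otimes>\<^bsub>G\<^esub> y) = x \<otimes>\<^bsub>G\<^esub> y"
    using w gball_carrier Suc.prems(2) A_carrier by (simp add: G.m_assoc)
  ultimately show ?case by simp
qed

lemma A_gball: "v \<in> V \<Longrightarrow> a \<in> A v \<Longrightarrow> a \<in> gball 1"
  using gball_Suc_I[of v a "\<one>\<^bsub>G\<^esub>" 0] A_carrier[of v a] by simp

lemma one_gball: "\<one>\<^bsub>G\<^esub> \<in> gball n"
proof (induction n)
  case (Suc n)
  obtain v where v: "v \<in> V" using V_nonempty by blast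
  then have "\<one>\<^bsub>G\<^esub> \<in> A v" using A_subgroup subgroup.one_closed by metis
  then show ?case using gball_Suc_I[OF v, of "\<one>\<^bsub>G\<^esub>" "\<one>\<^bsub>G\<^esub>" n] Suc by simp
qed simp

lemma gball_mono: "m \<le> n \<Longrightarrow> w \<in> gball m \<Longrightarrow> w \<in> gball n"
  using gball_mult[of w m "\<one>\<^bsub>G\<^esub>" "n - m"] one_gball[of "n - m"] gball_carrier[of w m] by simp

lemma gball_inv: "w \<in> gball n \<Longrightarrow> inv\<^bsub>G\<^esub> w \<in> gball n"
proof (induction n arbitrary: w)
  case (Suc n)
  from Suc.prems obtain v a w' where w: "v \<in> V" "a \<in> A v" "w' \<in> gball n" "w = a \<otimes>\<^bsub>G\<^esub> w'"
    by (rule gball_Suc_E)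
  have "inv\<^bsub>G\<^esub> a \<in> gball 1"
    using w A_gball A_subgroup subgroup.m_inv_closed by metis
  then have "inv\<^bsub>G\<^esub> w' \<otimes>\<^bsub>G\<^esub> inv\<^bsub>G\<^esub> a \<in> gball (n + 1)"
    using Suc.IH[OF w(3)] by (intro gball_mult)
  then show ?case using w gball_carrier A_carrier by (simp add: G.inv_mult_group)
qed simp

lemma ex_gball: "g \<in> carrier G \<Longrightarrow> \<exists>n. g \<in> gball n"
proof (induction g rule: G_induct)
  case one
  then show ?case using one_gball by blast
next
  case (mult v a g)
  then show ?case using gball_Suc_I by blast
qed

lemma ex_gball_finite:
  assumes "finite S" "S \<subseteq> carrier G"
  shows "\<exists>n. S \<subseteq> gball n"
  using assms
proof (induction S)
  case (insert g S)
  then obtain m where m: "S \<subseteq> gball m" by auto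
  obtain n where n: "g \<in> gball n" using insert.prems ex_gball by auto
  have "S \<subseteq> gball (max m n)"
  proof
    fix x assume "x \<in> S"
    then show "x \<in> gball (max m n)" using gball_mono[of m "max m n" x] subsetD[OF m, of x] by simp
  qed
  moreover have "g \<in> gball (max m n)" using gball_mono[OF _ n, of "max m n"] by simp
  ultimately have "insert g S \<subseteq> gball (max m n)" by simp
  then show ?case by (rule exI)
qed simp

text \<open>\<open>\<iota>\<close> is equivariant only for single vertex elements that do not lead
  out of \<open>B\<close>. If the ball of radius \<open>n\<close> around \<open>y\<close> lies in
  \<open>B\<close>, so do all intermediate points of a word of length at most \<open>n\<close>, and
  equivariance propagates along it.\<close>

lemma partial_action_walk:
  assumes act: "acts G (carrier G) act Y" and act': "acts G (carrier G) act' \<Omega>"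
    and B: "B \<subseteq> Y" "\<iota> ` B \<subseteq> \<Omega>"
    and step: "\<forall>v\<in>V. \<forall>a\<in>A v. \<forall>y\<in>B. act a y \<in> B \<longrightarrow> act' a (\<iota> y) = \<iota> (act a y)"
    and yY: "y \<in> Y" and y: "\<forall>w\<in>gball n. act w y \<in> B" and w: "w \<in> gball k" "k \<le> n"
  shows "act' w (\<iota> y) = \<iota> (act w y)"
proof -
  have "y \<in> B" using bspec[OF y one_gball] acts_one[OF act yY] by simp
  then have yY: "y \<in> Y" "\<iota> y \<in> \<Omega>" using B by auto
  show ?thesis
    using w
  proof (induction k arbitrary: w)
    case 0
    then show ?case using acts_one[OF act yY(1)] acts_one[OF act' yY(2)] by simp
  next
    case (Suc k)
    from Suc.prems(1) obtain v a w' where w: "v \<in> V" "a \<in> A v" "w' \<in> gball k" "w = a \<otimes>\<^bsub>G\<^esub> w'"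
      by (rule gball_Suc_E)
    have c: "a \<in> carrier G" "w' \<in> carrier G" using w A_carrier gball_carrier by auto
    have aw: "act w y = act a (act w' y)" using acts_mult[OF act c yY(1)] w by simp
    have "act w' y \<in> B" "act w y \<in> B"
      using y gball_mono[of k n w'] gball_mono[OF Suc.prems(2,1)] w Suc.prems(2) by auto
    then have "act' a (\<iota> (act w' y)) = \<iota> (act w y)" using step w aw by auto
    moreover have "act' w (\<iota> y) = act' a (act' w' (\<iota> y))" using acts_mult[OF act' c yY(2)] w by simp
    ultimately show ?case using Suc.IH[OF w(3)] Suc.prems(2) by simp
  qed
qed

section \<open>Finite actions in which a given element has no fixed point\<close>

text \<open>Left multiplication of \<open>G\<close> on itself is free, so a ball containing
  \<open>f\<close> can be completed, and \<open>f\<close> moves a point of the resulting finite set.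
  Passing to the permutations of that set, with \<open>G\<close> acting by composition, makes
  \<open>f\<close> move every point.\<close>

theorem fixed_point_free_action:
  assumes f: "f \<in> carrier G" "f \<noteq> \<one>\<^bsub>G\<^esub>"
  shows "\<exists>(Q :: (('v, 'e, 'a) letter list set \<times> nat + ('v, 'e, 'a) letter list set \<times> nat \<Rightarrow>
      ('v, 'e, 'a) letter list set \<times> nat + ('v, 'e, 'a) letter list set \<times> nat) set) act.
    finite Q \<and> Q \<noteq> {} \<and> acts G (carrier G) act Q \<and> (\<forall>q\<in>Q. act f q \<noteq> q)"
proof -
  obtain n where n: "f \<in> gball n" using ex_gball[OF f(1)] by blast
  let ?m = "\<lambda>g x. g \<otimes>\<^bsub>G\<^esub> x"
  have act: "acts G (carrier G) ?m (carrier G)" by (simp add: acts_def G.m_assoc)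
  have "\<exists>(\<Omega> :: (('v, 'e, 'a) letter list set \<times> nat + ('v, 'e, 'a) letter list set \<times> nat) set) act' \<iota>.
    finite \<Omega> \<and> acts G (carrier G) act' \<Omega> \<and> \<iota> ` gball n \<subseteq> \<Omega> \<and> inj_on \<iota> (gball n) \<and>
    (\<forall>v\<in>V. \<forall>a\<in>A v. \<forall>y\<in>gball n. ?m a y \<in> gball n \<longrightarrow> act' a (\<iota> y) = \<iota> (?m a y))"
  proof (rule completion[OF act finite_gball])
    show "gball n \<subseteq> carrier G" using gball_carrier by blast
    fix v a y assume *: "v \<in> V" "a \<in> A v" "a \<noteq> \<one>\<^bsub>G\<^esub>" "y \<in> carrier G" "?m a y = y"
    then show "y \<in> gball n" using A_carrier[of v a] by simp
  qed
  then obtain \<Omega> :: "(('v, 'e, 'a) letter list set \<times> nat + ('v, 'e, 'a) letter list set \<times> nat) set"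
    and act' \<iota> where \<Omega>: "finite \<Omega>" "acts G (carrier G) act' \<Omega>" "\<iota> ` gball n \<subseteq> \<Omega>" "inj_on \<iota> (gball n)"
    "\<forall>v\<in>V. \<forall>a\<in>A v. \<forall>y\<in>gball n. ?m a y \<in> gball n \<longrightarrow> act' a (\<iota> y) = \<iota> (?m a y)"
    by (elim exE conjE)
  have "act' f (\<iota> \<one>\<^bsub>G\<^esub>) = \<iota> (f \<otimes>\<^bsub>G\<^esub> \<one>\<^bsub>G\<^esub>)"
    using gball_carrier by (intro partial_action_walk[OF act \<Omega>(2) _ \<Omega>(3,5) _ _ n]) auto
  then have f1: "act' f (\<iota> \<one>\<^bsub>G\<^esub>) \<noteq> \<iota> \<one>\<^bsub>G\<^esub>"
    using inj_onD[OF \<Omega>(4), of f "\<one>\<^bsub>G\<^esub>"] n one_gball f by auto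
  \<comment> \<open>Extensionality makes a permutation determined by its values on
    \<open>\<Omega>\<close>, so that \<open>Q\<close> is finite.\<close>
  define Q where "Q = {\<sigma> \<in> extensional \<Omega>. bij_betw \<sigma> \<Omega> \<Omega>}"
  define actQ where "actQ g \<sigma> = restrict (\<lambda>x. act' g (\<sigma> x)) \<Omega>" for g \<sigma>
  have bij: "bij_betw (act' g) \<Omega> \<Omega>" if g: "g \<in> carrier G" for g
    using acts_closed[OF \<Omega>(2)] G.acts_inv[OF \<Omega>(2) G.subgroup_self g] g
    by (intro bij_betw_byWitness[where f' = "act' (inv\<^bsub>G\<^esub> g)"]) auto
  have closed: "actQ g \<sigma> \<in> Q" if "g \<in> carrier G" "\<sigma> \<in> Q" for g \<sigma>
  proof -
    have "bij_betw (act' g \<circ> \<sigma>) \<Omega> \<Omega>" using that bij bij_betw_trans unfolding Q_def by blast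
    then have "bij_betw (actQ g \<sigma>) \<Omega> \<Omega>"
      by (rule bij_betw_cong[THEN iffD1, rotated]) (simp add: actQ_def)
    then show ?thesis by (simp add: Q_def actQ_def)
  qed
  have Q\<Omega>: "\<sigma> x \<in> \<Omega>" if "\<sigma> \<in> Q" "x \<in> \<Omega>" for \<sigma> x
    using that bij_betw_apply unfolding Q_def by fastforce
  have "acts G (carrier G) actQ Q"
    unfolding acts_def
  proof (intro conjI ballI)
    fix \<sigma> assume \<sigma>: "\<sigma> \<in> Q"
    show "actQ \<one>\<^bsub>G\<^esub> \<sigma> = \<sigma>"
    proof (rule extensionalityI)
      show "actQ \<one>\<^bsub>G\<^esub> \<sigma> \<in> extensional \<Omega>" "\<sigma> \<in> extensional \<Omega>" using \<sigma> by (simp_all add: actQ_def Q_def)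
      show "actQ \<one>\<^bsub>G\<^esub> \<sigma> x = \<sigma> x" if "x \<in> \<Omega>" for x
        using that acts_one[OF \<Omega>(2) Q\<Omega>[OF \<sigma> that]] by (simp add: actQ_def)
    qed
    fix g assume g: "g \<in> carrier G"
    show "actQ g \<sigma> \<in> Q" using closed g \<sigma> .
    fix h assume h: "h \<in> carrier G"
    show "actQ (g \<otimes>\<^bsub>G\<^esub> h) \<sigma> = actQ g (actQ h \<sigma>)"
      unfolding actQ_def using acts_mult[OF \<Omega>(2) g h] Q\<Omega>[OF \<sigma>]
      by (intro restrict_ext) simp
  qed
  moreover have "finite Q"
  proof (rule finite_subset)
    show "Q \<subseteq> \<Omega> \<rightarrow>\<^sub>E \<Omega>" using Q\<Omega> by (auto simp: Q_def PiE_def)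
    show "finite (\<Omega> \<rightarrow>\<^sub>E \<Omega>)" using \<Omega>(1) by (intro finite_PiE)
  qed
  moreover have "Q \<noteq> {}"
  proof -
    have "bij_betw (restrict id \<Omega>) \<Omega> \<Omega>"
      using bij_betw_id by (rule bij_betw_cong[THEN iffD1, rotated]) simp
    then have "restrict id \<Omega> \<in> Q" by (simp add: Q_def)
    then show ?thesis by blast
  qed
  moreover have "actQ f \<sigma> \<noteq> \<sigma>" if \<sigma>: "\<sigma> \<in> Q" for \<sigma>
  proof
    \<comment> \<open>As \<open>\<sigma>\<close> is onto, its being fixed would force
      \<open>f\<close> to fix the image of the identity under \<open>\<iota>\<close>.\<close>
    assume *: "actQ f \<sigma> = \<sigma>"
    have "\<iota> \<one>\<^bsub>G\<^esub> \<in> \<Omega>" using \<Omega>(3) one_gball by blast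
    moreover have "\<sigma> ` \<Omega> = \<Omega>" using \<sigma> by (simp add: Q_def bij_betw_def)
    ultimately have "\<iota> \<one>\<^bsub>G\<^esub> \<in> \<sigma> ` \<Omega>" by simp
    then obtain x where x: "\<iota> \<one>\<^bsub>G\<^esub> = \<sigma> x" "x \<in> \<Omega>" by (rule imageE)
    have "act' f (\<sigma> x) = \<sigma> x" using fun_cong[OF *, of x] x(2) by (simp add: actQ_def)
    then show False using x(1) f1 by simp
  qed
  then have "\<forall>q\<in>Q. actQ f q \<noteq> q" by (rule ballI)
  ultimately show ?thesis by (intro exI[of _ Q] exI[of _ actQ] conjI)
qed

end

section \<open>Twisted products\<close>

text \<open>A free action is a disjoint union of copies of \<open>K\<close>: after choosing a
  representative in each orbit, \<open>t x\<close> is the unique element taking it to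
  \<open>x\<close>.\<close>

lemma (in group) free_acts_coordinate:
  assumes K: "subgroup K G" and act: "acts G K \<alpha> X"
    and free: "\<forall>a\<in>K. \<forall>x\<in>X. \<alpha> a x = x \<longrightarrow> a = \<one>"
  shows "\<exists>t. \<forall>x\<in>X. t x \<in> K \<and> (\<forall>a\<in>K. t (\<alpha> a x) = a \<otimes> t x)"
proof -
  note Kc = subgroup.mem_carrier[OF K]
  define orb where "orb x = (\<lambda>a. \<alpha> a x) ` K" for x
  \<comment> \<open>The choice depends only on the set \<open>orb x\<close>, so all points of an
    orbit have the same representative.\<close>
  define rep where "rep x = (SOME y. y \<in> orb x)" for x
  have orb_act: "orb (\<alpha> a x) = orb x" if "a \<in> K" "x \<in> X" for a x
  proof
    show "orb (\<alpha> a x) \<subseteq> orb x"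
    proof
      fix y assume "y \<in> orb (\<alpha> a x)"
      then obtain b where b: "b \<in> K" "y = \<alpha> b (\<alpha> a x)" by (auto simp: orb_def)
      then have "y = \<alpha> (b \<otimes> a) x" using acts_mult[OF act b(1) that] by simp
      then show "y \<in> orb x" unfolding orb_def using subgroup.m_closed[OF K b(1) that(1)] by blast
    qed
    show "orb x \<subseteq> orb (\<alpha> a x)"
    proof
      fix y assume "y \<in> orb x"
      then obtain b where b: "b \<in> K" "y = \<alpha> b x" by (auto simp: orb_def)
      have ia: "inv a \<in> K" using subgroup.m_inv_closed[OF K that(1)] .
      have "\<alpha> (b \<otimes> inv a) (\<alpha> a x) = \<alpha> b (\<alpha> (inv a) (\<alpha> a x))"
        using acts_mult[OF act b(1) ia acts_closed[OF act that]] .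
      also have "\<dots> = y" using acts_inv(1)[OF act K that] b by simp
      finally show "y \<in> orb (\<alpha> a x)"
        unfolding orb_def using subgroup.m_closed[OF K b(1) ia] by (metis image_eqI)
    qed
  qed
  have rep: "rep x \<in> orb x" if "x \<in> X" for x
    unfolding rep_def orb_def using subgroup.one_closed[OF K] by (intro someI) blast
  define t where "t x = (SOME g. g \<in> K \<and> \<alpha> g (rep x) = x)" for x
  have repX: "rep x \<in> X" if "x \<in> X" for x
    using rep[OF that] acts_closed[OF act _ that] by (auto simp: orb_def)
  have t: "t x \<in> K \<and> \<alpha> (t x) (rep x) = x" if x: "x \<in> X" for x
  proof -
    obtain b where b: "b \<in> K" "rep x = \<alpha> b x" using rep[OF x] by (auto simp: orb_def)
    have "inv b \<in> K \<and> \<alpha> (inv b) (rep x) = x"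
      using acts_inv(1)[OF act K b(1) x] subgroup.m_inv_closed[OF K b(1)] b by simp
    then show ?thesis unfolding t_def by (rule someI)
  qed
  have "t (\<alpha> a x) = a \<otimes> t x" if "a \<in> K" "x \<in> X" for a x
  proof -
    have ax: "\<alpha> a x \<in> X" using acts_closed[OF act that] .
    have r: "rep (\<alpha> a x) = rep x" by (simp add: rep_def orb_act[OF that])
    let ?b = "a \<otimes> t x"
    have b: "?b \<in> K" using subgroup.m_closed[OF K that(1)] t[OF that(2)] by blast
    have 1: "\<alpha> ?b (rep x) = \<alpha> a x"
      using acts_mult[OF act that(1) _ repX[OF that(2)], of "t x"] t[OF that(2)] by simp
    have 2: "\<alpha> (t (\<alpha> a x)) (rep x) = \<alpha> a x" "t (\<alpha> a x) \<in> K" using t[OF ax] r by simp_all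
    have ib: "inv ?b \<in> K" using subgroup.m_inv_closed[OF K b] .
    have "\<alpha> (inv ?b \<otimes> t (\<alpha> a x)) (rep x) = rep x"
      using acts_mult[OF act ib 2(2) repX[OF that(2)]] 2(1) 1
        acts_inv(1)[OF act K b repX[OF that(2)]] by simp
    then have "inv ?b \<otimes> t (\<alpha> a x) = \<one>"
      using free subgroup.m_closed[OF K ib 2(2)] repX[OF that(2)] by blast
    then show ?thesis using Kc[OF b] Kc[OF 2(2)] by (metis inv_equality inv_inv inv_closed)
  qed
  then show ?thesis using t by (intro exI[of _ t]) simp
qed

context tree_of_finite_groups
begin

text \<open>
  Over \<open>C\<close> the new action leaves the second coordinate alone, far from \<open>C\<close> it is the product
  action. The two are matched along the edge orbits that separate the two regions, where the
  edge group acts freely, by using a coordinate in the edge group.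
\<close>

theorem twisted_product:
  fixes \<Omega> :: "'x set" and Q :: "'q set"
  assumes act: "acts G (carrier G) act \<Omega>" and actQ: "acts G (carrier G) actQ Q"
    and C: "C \<subseteq> \<Omega>"
    and N: "\<And>v. v \<in> V \<Longrightarrow> N v = (\<Union>a\<in>A v. act a ` C)"
    and free: "\<And>e x a. e \<in> D \<Longrightarrow> x \<in> \<Omega> \<Longrightarrow> (x \<in> N (src e)) \<noteq> (x \<in> N (tgt e)) \<Longrightarrow>
      a \<in> E e \<Longrightarrow> act a x = x \<Longrightarrow> a = \<one>\<^bsub>G\<^esub>"
  shows "\<exists>act'. acts G (carrier G) act' (\<Omega> \<times> Q) \<and>
    (\<forall>g\<in>carrier G. \<forall>z\<in>\<Omega> \<times> Q. fst (act' g z) = act g (fst z)) \<and>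
    (\<forall>v\<in>V. \<forall>a\<in>A v. \<forall>x\<in>C. \<forall>q\<in>Q. act a x \<in> C \<longrightarrow> act' a (x, q) = (act a x, q)) \<and>
    (\<forall>v\<in>V. \<forall>a\<in>A v. \<forall>x\<in>\<Omega>. \<forall>q\<in>Q. x \<notin> (\<Union>v\<in>V. N v) \<longrightarrow> act a x \<notin> (\<Union>v\<in>V. N v) \<longrightarrow>
      act' a (x, q) = (act a x, actQ a q))"
proof -
  have actA: "act a x \<in> \<Omega>" if "v \<in> V" "a \<in> A v" "x \<in> \<Omega>" for v a x
    using acts_closed[OF act A_carrier[OF that(1,2)] that(3)] .
  have N_sub: "N v \<subseteq> \<Omega>" if "v \<in> V" for v
    using N[OF that] C actA[OF that] by auto
  have N_act1: "act a x \<in> N v" if v: "v \<in> V" and a: "a \<in> A v" and x: "x \<in> N v" for v a x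
  proof -
    have "\<exists>b\<in>A v. \<exists>y\<in>C. x = act b y" using x N[OF v] by auto
    then obtain b y where b: "b \<in> A v" "y \<in> C" "x = act b y" by (elim bexE)
    have "act (a \<otimes>\<^bsub>G\<^esub> b) y = act a x"
      using acts_mult[OF act A_carrier[OF v a] A_carrier[OF v b(1)], of y] b C by auto
    moreover have "a \<otimes>\<^bsub>G\<^esub> b \<in> A v" using subgroup.m_closed[OF A_subgroup[OF v] a b(1)] .
    ultimately show ?thesis unfolding N[OF v] using b(2) by (metis UN_I image_eqI)
  qed
  have N_act: "act a x \<in> N v \<longleftrightarrow> x \<in> N v" if v: "v \<in> V" and a: "a \<in> A v" and x: "x \<in> \<Omega>" for v a x
  proof
    assume *: "act a x \<in> N v"
    have "inv\<^bsub>G\<^esub> a \<in> A v" using subgroup.m_inv_closed[OF A_subgroup[OF v] a] .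
    then have "act (inv\<^bsub>G\<^esub> a) (act a x) \<in> N v" using N_act1[OF v _ *] by blast
    then show "x \<in> N v" using G.acts_inv(1)[OF act G.subgroup_self A_carrier[OF v a] x] by simp
  qed (rule N_act1[OF v a])
  have C_N: "x \<in> N v" if "v \<in> V" "x \<in> C" for v x
  proof -
    have "act \<one>\<^bsub>G\<^esub> x = x" using acts_one[OF act] that C by blast
    then show ?thesis unfolding N[OF that(1)]
      using subgroup.one_closed[OF A_subgroup[OF that(1)]] that(2) by (metis UN_I image_eqI)
  qed
  \<comment> \<open>The points at which one end of \<open>e\<close> uses the trivial action on
    \<open>Q\<close> and the other end the product action.\<close>
  define X where "X e = {x \<in> \<Omega>. (x \<in> N (src e)) \<noteq> (x \<in> N (tgt e))}" for e
  have X_act: "act a x \<in> X e" if e: "e \<in> D" and a: "a \<in> E e" and x: "x \<in> X e" for e a x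
  proof -
    have st: "src e \<in> V" "tgt e \<in> V" "a \<in> A (src e)" "a \<in> A (tgt e)" "x \<in> \<Omega>"
      using e a x E_src[OF e] E_tgt[OF e] by (auto simp: X_def)
    then show ?thesis
      using x N_act[OF st(1,3,5)] N_act[OF st(2,4,5)] actA[OF st(1,3,5)] by (simp add: X_def)
  qed
  have "\<exists>t. \<forall>x\<in>X e. t x \<in> E e \<and> (\<forall>a\<in>E e. t (act a x) = a \<otimes>\<^bsub>G\<^esub> t x)" if e: "e \<in> D" for e
  proof (rule G.free_acts_coordinate[OF E_subgroup[OF e]])
    have "acts G (E e) act \<Omega>"
      using act by (rule acts_subset) (use E_carrier[OF e] in blast)
    then show "acts G (E e) act (X e)"
      unfolding acts_def using X_act[OF e] by (simp add: X_def)
    show "\<forall>a\<in>E e. \<forall>x\<in>X e. act a x = x \<longrightarrow> a = \<one>\<^bsub>G\<^esub>"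
    proof (intro ballI impI)
      fix a x assume "a \<in> E e" "x \<in> X e" "act a x = x"
      then show "a = \<one>\<^bsub>G\<^esub>" using free[OF e, of x a] by (simp add: X_def)
    qed
  qed
  then have "\<exists>t. \<forall>e\<in>D. \<forall>x\<in>X e. t e x \<in> E e \<and> (\<forall>a\<in>E e. t e (act a x) = a \<otimes>\<^bsub>G\<^esub> t e x)"
    by (intro bchoice ballI)
  then obtain t where t: "\<forall>e\<in>D. \<forall>x\<in>X e. t e x \<in> E e \<and> (\<forall>a\<in>E e. t e (act a x) = a \<otimes>\<^bsub>G\<^esub> t e x)"
    by (elim exE)
  \<comment> \<open>The form of \<open>\<tau>\<close> is dictated by \<open>cocycle\<close> below.
    If only the source end is near \<open>C\<close>, it asks that \<tau>(ax) = a \<tau>(x), which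
    the coordinate \<open>t e\<close> satisfies; if only the target end is, that \<tau>(ax) a =
    \<tau>(x), hence the inverse.\<close>
  define \<tau> where "\<tau> e x = (if x \<in> X e then (if x \<in> N (src e) then t e x else inv\<^bsub>G\<^esub> (t e x)) else \<one>\<^bsub>G\<^esub>)"
    for e x
  have \<tau>c: "\<tau> e x \<in> carrier G" if "e \<in> D" for e x
    using t that E_carrier[OF that] by (simp add: \<tau>_def)
  define \<kappa> where "\<kappa> v a x = (if x \<in> N v then \<one>\<^bsub>G\<^esub> else a)" for v a x
  define \<alpha> where "\<alpha> v a z = (act a (fst z), actQ (\<kappa> v a (fst z)) (snd z))" for v a and z :: "'x \<times> 'q"
  define \<beta> where "\<beta> e z = (fst z, actQ (\<tau> e (fst z)) (snd z))" for e and z :: "'x \<times> 'q"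
  have \<kappa>c: "\<kappa> v a x \<in> carrier G" if "a \<in> carrier G" for v a x using that by (simp add: \<kappa>_def)
  have cocycle: "\<tau> e (act a x) \<otimes>\<^bsub>G\<^esub> \<kappa> (src e) a x = \<kappa> (tgt e) a x \<otimes>\<^bsub>G\<^esub> \<tau> e x"
    if e: "e \<in> D" and a: "a \<in> E e" and x: "x \<in> \<Omega>" for e a x
  proof -
    have st: "src e \<in> V" "tgt e \<in> V" "a \<in> A (src e)" "a \<in> A (tgt e)"
      using e a E_src[OF e] E_tgt[OF e] by auto
    note N_src = N_act[OF st(1,3) x] and N_tgt = N_act[OF st(2,4) x]
    have ac: "a \<in> carrier G" using E_carrier[OF e a] .
    have Xa: "act a x \<in> X e \<longleftrightarrow> x \<in> X e"
      using N_src N_tgt actA[OF st(1,3) x] x by (simp add: X_def)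
    show ?thesis
    proof (cases "x \<in> X e")
      case False
      then have "(x \<in> N (src e)) = (x \<in> N (tgt e))" using x by (simp add: X_def)
      then show ?thesis using False Xa ac by (simp add: \<tau>_def \<kappa>_def)
    next
      case True
      have tx: "t e x \<in> E e" "t e (act a x) = a \<otimes>\<^bsub>G\<^esub> t e x" using t e a True by auto
      have tc: "t e x \<in> carrier G" using E_carrier[OF e tx(1)] .
      show ?thesis
      proof (cases "x \<in> N (src e)")
        case src: True
        then have "x \<notin> N (tgt e)" using True by (simp add: X_def)
        then show ?thesis using True src Xa N_src tx tc ac by (simp add: \<tau>_def \<kappa>_def)
      next
        case src: False
        then have "x \<in> N (tgt e)" using True by (simp add: X_def)
        then show ?thesis
          using True src Xa N_src tx tc ac by (simp add: \<tau>_def \<kappa>_def G.inv_mult_group G.m_assoc)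
      qed
    qed
  qed
  have acts_\<alpha>: "acts G (A v) (\<alpha> v) (\<Omega> \<times> Q)" if v: "v \<in> V" for v
    unfolding acts_def
  proof (intro conjI ballI)
    fix z assume z: "z \<in> \<Omega> \<times> Q"
    then have z': "fst z \<in> \<Omega>" "snd z \<in> Q" by auto
    show "\<alpha> v \<one>\<^bsub>G\<^esub> z = z"
      using acts_one[OF act z'(1)] acts_one[OF actQ z'(2)] by (simp add: \<alpha>_def \<kappa>_def)
    fix b assume b: "b \<in> A v"
    note bc = A_carrier[OF v b]
    show "\<alpha> v b z \<in> \<Omega> \<times> Q"
      using actA[OF v b z'(1)] acts_closed[OF actQ \<kappa>c[OF bc] z'(2)] by (simp add: \<alpha>_def)
    fix a assume a: "a \<in> A v"
    note ac = A_carrier[OF v a]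
    \<comment> \<open>\<open>N v\<close> is invariant under \<open>A v\<close>, so \<open>x\<close>
      and its translate by \<open>b\<close> fall into the same case of
      \<open>\<kappa>\<close>.\<close>
    have "\<kappa> v (a \<otimes>\<^bsub>G\<^esub> b) (fst z) = \<kappa> v a (act b (fst z)) \<otimes>\<^bsub>G\<^esub> \<kappa> v b (fst z)"
      using N_act[OF v b z'(1)] ac bc by (simp add: \<kappa>_def)
    then show "\<alpha> v (a \<otimes>\<^bsub>G\<^esub> b) z = \<alpha> v a (\<alpha> v b z)"
      using acts_mult[OF act ac bc z'(1)] acts_mult[OF actQ \<kappa>c[OF ac] \<kappa>c[OF bc] z'(2)]
      by (simp add: \<alpha>_def)
  qed
  have bij_\<beta>: "bij_betw (\<beta> e) (\<Omega> \<times> Q) (\<Omega> \<times> Q)" if e: "e \<in> D" for e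
  proof (rule bij_betw_byWitness[where f' = "\<lambda>z. (fst z, actQ (inv\<^bsub>G\<^esub> (\<tau> e (fst z))) (snd z))"])
    show "\<forall>z\<in>\<Omega> \<times> Q. (fst (\<beta> e z), actQ (inv\<^bsub>G\<^esub> (\<tau> e (fst (\<beta> e z)))) (snd (\<beta> e z))) = z"
      using G.acts_inv(1)[OF actQ G.subgroup_self \<tau>c[OF e]] by (auto simp: \<beta>_def)
    show "\<forall>z\<in>\<Omega> \<times> Q. \<beta> e (fst z, actQ (inv\<^bsub>G\<^esub> (\<tau> e (fst z))) (snd z)) = z"
      using G.acts_inv(2)[OF actQ G.subgroup_self \<tau>c[OF e]] by (auto simp: \<beta>_def)
    show "\<beta> e ` (\<Omega> \<times> Q) \<subseteq> \<Omega> \<times> Q"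
      using acts_closed[OF actQ \<tau>c[OF e]] by (auto simp: \<beta>_def)
    show "(\<lambda>z. (fst z, actQ (inv\<^bsub>G\<^esub> (\<tau> e (fst z))) (snd z))) ` (\<Omega> \<times> Q) \<subseteq> \<Omega> \<times> Q"
      using acts_closed[OF actQ G.inv_closed[OF \<tau>c[OF e]]] by auto
  qed
  have equi: "\<beta> e (\<alpha> (src e) a z) = \<alpha> (tgt e) a (\<beta> e z)" if e: "e \<in> D" and a: "a \<in> E e" and z: "z \<in> \<Omega> \<times> Q" for e a z
  proof -
    have z': "fst z \<in> \<Omega>" "snd z \<in> Q" using z by auto
    note ac = E_carrier[OF e a]
    have "actQ (\<tau> e (act a (fst z))) (actQ (\<kappa> (src e) a (fst z)) (snd z)) =
        actQ (\<kappa> (tgt e) a (fst z)) (actQ (\<tau> e (fst z)) (snd z))"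
      using cocycle[OF e a z'(1)] acts_mult[OF actQ \<tau>c[OF e] \<kappa>c[OF ac] z'(2)]
        acts_mult[OF actQ \<kappa>c[OF ac] \<tau>c[OF e] z'(2)] by metis
    then show ?thesis by (simp add: \<alpha>_def \<beta>_def)
  qed
  let ?S = "{(z, \<beta> e z) | e z. e \<in> D \<and> z \<in> \<Omega> \<times> Q}"
  have "\<exists>r \<gamma> \<delta>. r \<in> V \<and> (\<forall>v\<in>V. bij_betw (\<gamma> v) (\<Omega> \<times> Q) (\<Omega> \<times> Q)) \<and>
    acts G (carrier G) \<delta> (\<Omega> \<times> Q) \<and>
    (\<forall>v\<in>V. \<forall>a\<in>A v. \<forall>z\<in>\<Omega> \<times> Q. \<delta> a (\<gamma> v z) = \<gamma> v (\<alpha> v a z)) \<and>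
    (\<forall>v\<in>V. \<forall>z\<in>\<Omega> \<times> Q. (z, \<gamma> v z) \<in> ?S\<^sup>*)"
    by (rule gluing[of \<alpha> "\<lambda>_. \<Omega> \<times> Q" \<beta>]) (fact acts_\<alpha> bij_\<beta> equi)+
  then obtain r \<gamma> \<delta> where \<gamma>_bij: "\<forall>v\<in>V. bij_betw (\<gamma> v) (\<Omega> \<times> Q) (\<Omega> \<times> Q)"
    and \<delta>: "acts G (carrier G) \<delta> (\<Omega> \<times> Q)"
    and \<gamma>\<delta>: "\<forall>v\<in>V. \<forall>a\<in>A v. \<forall>z\<in>\<Omega> \<times> Q. \<delta> a (\<gamma> v z) = \<gamma> v (\<alpha> v a z)"
    and chain: "\<forall>v\<in>V. \<forall>z\<in>\<Omega> \<times> Q. (z, \<gamma> v z) \<in> ?S\<^sup>*"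
    by (elim exE conjE)
  have fst_chain: "fst z' = fst z" if "(z, z') \<in> ?S\<^sup>*" for z z'
    using that by (induction rule: rtrancl_induct) (auto simp: \<beta>_def)
  have fst_\<gamma>: "fst (\<gamma> v z) = fst z" if "v \<in> V" "z \<in> \<Omega> \<times> Q" for v z
    using fst_chain chain that by blast
  have fst_\<delta>: "fst (\<delta> g z) = act g (fst z)" if "g \<in> carrier G" "z \<in> \<Omega> \<times> Q" for g z
    using that(1)
  proof (induction g rule: G_induct)
    case one
    then show ?case using acts_one[OF \<delta> that(2)] acts_one[OF act] that(2) by auto
  next
    case (mult v a g)
    note ac = A_carrier[OF mult(1,2)]
    let ?y = "\<delta> g z"
    have y: "?y \<in> \<Omega> \<times> Q" using acts_closed[OF \<delta> mult(3) that(2)] .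
    then have "?y \<in> \<gamma> v ` (\<Omega> \<times> Q)"
      using bij_betw_imp_surj_on[OF bspec[OF \<gamma>_bij mult(1)]] by simp
    then obtain z0 where z0: "?y = \<gamma> v z0" "z0 \<in> \<Omega> \<times> Q" by (rule imageE)
    have "\<delta> (a \<otimes>\<^bsub>G\<^esub> g) z = \<gamma> v (\<alpha> v a z0)"
      using acts_mult[OF \<delta> ac mult(3) that(2)] \<gamma>\<delta>[rule_format, OF mult(1,2) z0(2)] z0(1) by simp
    then have "fst (\<delta> (a \<otimes>\<^bsub>G\<^esub> g) z) = fst (\<alpha> v a z0)"
      using fst_\<gamma>[OF mult(1) acts_closed[OF acts_\<alpha>[OF mult(1)] mult(2) z0(2)]] by simp
    also have "\<dots> = act a (fst z0)" by (simp add: \<alpha>_def)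
    also have "fst z0 = act g (fst z)" using fst_\<gamma>[OF mult(1) z0(2)] z0(1) mult(4) by simp
    also have "act a (act g (fst z)) = act (a \<otimes>\<^bsub>G\<^esub> g) (fst z)"
      using acts_mult[OF act ac mult(3)] that(2) by auto
    finally show ?case .
  qed
  \<comment> \<open>\<open>\<tau>\<close> is trivial outside the sets \<open>X e\<close>, so gluing
    does not move such points. Among them are the points of \<open>C\<close>, which lie in every
    \<open>N v\<close>, and the far points, which lie in none.\<close>
  have \<gamma>_id: "\<gamma> v (x, q) = (x, q)" if v: "v \<in> V" and xq: "x \<in> \<Omega>" "q \<in> Q" and X: "\<forall>e\<in>D. x \<notin> X e" for v x q
  proof -
    have "z = (x, q)" if "((x, q), z) \<in> ?S\<^sup>*" for z
      using that
    proof (induction rule: rtrancl_induct)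
      case (step z z')
      then obtain e where e: "e \<in> D" "z' = \<beta> e (x, q)" by auto
      then show ?case using X acts_one[OF actQ xq(2)] by (simp add: \<beta>_def \<tau>_def)
    qed simp
    then show ?thesis using chain v xq by blast
  qed
  have \<delta>_eq: "\<delta> a (x, q) = \<alpha> v a (x, q)"
    if v: "v \<in> V" and a: "a \<in> A v" and xq: "x \<in> \<Omega>" "q \<in> Q"
      and X: "\<forall>e\<in>D. x \<notin> X e" "\<forall>e\<in>D. act a x \<notin> X e" for v a x q
  proof -
    have "\<delta> a (x, q) = \<gamma> v (\<alpha> v a (x, q))"
      using \<gamma>\<delta>[rule_format, OF v a, of "(x, q)"] \<gamma>_id[OF v xq X(1)] xq by simp
    also have "\<dots> = \<alpha> v a (x, q)"
      using \<gamma>_id[OF v actA[OF v a xq(1)] acts_closed[OF actQ \<kappa>c[OF A_carrier[OF v a]] xq(2)] X(2)]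
      by (simp add: \<alpha>_def)
    finally show ?thesis .
  qed
  have X_C: "x \<notin> X e" if "e \<in> D" "x \<in> C" for e x
    using C_N[of "src e" x] C_N[of "tgt e" x] that by (simp add: X_def)
  have X_far: "x \<notin> X e" if "e \<in> D" "x \<notin> (\<Union>v\<in>V. N v)" for e x
    using that by (simp add: X_def)
  have "\<delta> a (x, q) = (act a x, q)"
    if "v \<in> V" "a \<in> A v" "x \<in> C" "q \<in> Q" "act a x \<in> C" for v a x q
  proof -
    have "\<delta> a (x, q) = \<alpha> v a (x, q)" using that X_C C by (intro \<delta>_eq) auto
    then show ?thesis
      using C_N[OF that(1,3)] acts_one[OF actQ that(4)] by (simp add: \<alpha>_def \<kappa>_def)
  qed
  moreover have "\<delta> a (x, q) = (act a x, actQ a q)"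
    if "v \<in> V" "a \<in> A v" "x \<in> \<Omega>" "q \<in> Q" "x \<notin> (\<Union>v\<in>V. N v)" "act a x \<notin> (\<Union>v\<in>V. N v)" for v a x q
  proof -
    have "\<delta> a (x, q) = \<alpha> v a (x, q)"
      using that(1-4) X_far[OF _ that(5)] X_far[OF _ that(6)] by (intro \<delta>_eq) simp_all
    moreover have "x \<notin> N v" using that(1,5) by blast
    ultimately show ?thesis by (simp add: \<alpha>_def \<kappa>_def)
  qed
  ultimately show ?thesis
    using \<delta> fst_\<delta> by (intro exI[of _ \<delta>] conjI ballI impI) simp_all
qed

end

section \<open>Separating subgroups by finite actions\<close>

lemma finite_group_iso_nat:
  assumes "group N" "finite (carrier N)"
  shows "\<exists>(Q :: nat monoid) e. group Q \<and> finite (carrier Q) \<and> e \<in> hom N Q \<and> bij_betw e (carrier N) (carrier Q)"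
proof -
  interpret N: group N by fact
  obtain e :: "_ \<Rightarrow> nat" where e: "bij_betw e (carrier N) {0..<card (carrier N)}"
    using ex_bij_betw_finite_nat[OF assms(2)] by (elim exE)
  define e' where "e' = inv_into (carrier N) e"
  have e'e: "e' (e x) = x" if "x \<in> carrier N" for x
    using e that by (simp add: e'_def bij_betw_def)
  define Q where "Q = \<lparr>carrier = e ` carrier N, monoid.mult = (\<lambda>x y. e (e' x \<otimes>\<^bsub>N\<^esub> e' y)), one = e \<one>\<^bsub>N\<^esub>\<rparr>"
  have Q: "carrier Q = e ` carrier N" "\<one>\<^bsub>Q\<^esub> = e \<one>\<^bsub>N\<^esub>"
    "x \<in> carrier N \<Longrightarrow> y \<in> carrier N \<Longrightarrow> e x \<otimes>\<^bsub>Q\<^esub> e y = e (x \<otimes>\<^bsub>N\<^esub> y)" for x y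
    by (simp_all add: Q_def e'e)
  have "group Q"
  proof (rule groupI)
    fix x assume "x \<in> carrier Q"
    then obtain x' where x: "x = e x'" "x' \<in> carrier N" unfolding Q by (rule imageE)
    show "\<one>\<^bsub>Q\<^esub> \<otimes>\<^bsub>Q\<^esub> x = x" using x by (simp add: Q)
    have "e (inv\<^bsub>N\<^esub> x') \<otimes>\<^bsub>Q\<^esub> x = \<one>\<^bsub>Q\<^esub>" using x by (simp add: Q)
    then show "\<exists>y\<in>carrier Q. y \<otimes>\<^bsub>Q\<^esub> x = \<one>\<^bsub>Q\<^esub>" using x Q(1) by (metis N.inv_closed image_eqI)
  qed (auto simp: Q N.m_assoc)
  moreover have "bij_betw e (carrier N) (carrier Q)"
    using e by (simp add: Q bij_betw_def)
  moreover have "e \<in> hom N Q" by (simp add: hom_def Q)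
  moreover have "finite (carrier Q)" using assms(2) by (simp add: Q)
  ultimately show ?thesis by (intro exI[of _ Q] exI[of _ e] conjI)
qed

text \<open>\<open>Q\<close> is a copy of the full symmetric group of \<open>\<Omega>\<close>. If
  \<open>k\<close> conjugates the image of \<open>H2\<close> into that of \<open>H1\<close>, then
  \<open>k\<close> takes \<open>z0\<close> to a point fixed by \<open>H2\<close>. This works for
  every permutation \<open>k\<close>, whether or not it comes from \<open>G\<close>.\<close>

lemma (in group) finite_action_separates:
  assumes act: "acts G (carrier G) act \<Omega>" and fin: "finite \<Omega>"
    and H: "H1 \<subseteq> carrier G" "H2 \<subseteq> carrier G"
    and z0: "z0 \<in> \<Omega>" "\<forall>h\<in>H1. act h z0 = z0"
    and no_fix: "\<forall>z\<in>\<Omega>. \<exists>h\<in>H2. act h z \<noteq> z"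
  shows "\<exists>(Q :: nat monoid) \<phi>. group Q \<and> finite (carrier Q) \<and> \<phi> \<in> hom G Q \<and>
    \<not> conjugate_into Q (\<phi> ` H2) (\<phi> ` H1)"
proof -
  define N where "N = BijGroup \<Omega>"
  interpret N: group N unfolding N_def by (rule group_BijGroup)
  have N: "carrier N = Bij \<Omega>" "\<And>g f. g \<in> Bij \<Omega> \<Longrightarrow> f \<in> Bij \<Omega> \<Longrightarrow> g \<otimes>\<^bsub>N\<^esub> f = compose \<Omega> g f"
    by (simp_all add: N_def BijGroup_def)
  have "Bij \<Omega> \<subseteq> \<Omega> \<rightarrow>\<^sub>E \<Omega>"
    using Bij_imp_funcset Bij_imp_extensional by (auto simp: PiE_def)
  then have finN: "finite (carrier N)"
    unfolding N by (rule finite_subset) (use fin in \<open>intro finite_PiE\<close>)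
  define \<psi> where "\<psi> g = restrict (act g) \<Omega>" for g
  have \<psi>: "\<psi> g \<in> Bij \<Omega>" if g: "g \<in> carrier G" for g
  proof -
    have "bij_betw (act g) \<Omega> \<Omega>"
      using acts_closed[OF act] acts_inv[OF act subgroup_self g] g
      by (intro bij_betw_byWitness[where f' = "act (inv g)"]) auto
    then have "bij_betw (\<psi> g) \<Omega> \<Omega>"
      by (rule bij_betw_cong[THEN iffD1, rotated]) (simp add: \<psi>_def)
    then show ?thesis by (simp add: Bij_def \<psi>_def)
  qed
  have \<psi>_hom: "\<psi> \<in> hom G N"
  proof (rule homI)
    fix g h assume gh: "g \<in> carrier G" "h \<in> carrier G"
    show "\<psi> g \<in> carrier N" using \<psi>[OF gh(1)] by (simp add: N)
    have "\<psi> (g \<otimes> h) = compose \<Omega> (\<psi> g) (\<psi> h)"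
      unfolding compose_def \<psi>_def using acts_mult[OF act gh] acts_closed[OF act gh(2)]
      by (intro restrict_ext) simp
    then show "\<psi> (g \<otimes> h) = \<psi> g \<otimes>\<^bsub>N\<^esub> \<psi> h" using \<psi> gh by (simp add: N)
  qed
  obtain Q :: "nat monoid" and e where Q: "group Q" "finite (carrier Q)" "e \<in> hom N Q"
    "bij_betw e (carrier N) (carrier Q)"
    using finite_group_iso_nat[OF N.group_axioms finN] by (elim exE conjE)
  interpret Q: group Q by fact
  let ?\<phi> = "e \<circ> \<psi>"
  have \<phi>: "?\<phi> \<in> hom G Q" using \<psi>_hom Q(3) by (rule Group.hom_compose)
  have "\<not> conjugate_into Q (?\<phi> ` H2) (?\<phi> ` H1)"
  proof
    assume "conjugate_into Q (?\<phi> ` H2) (?\<phi> ` H1)"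
    then obtain k where k: "k \<in> carrier Q"
      "subgroup (inv\<^bsub>Q\<^esub> k <#\<^bsub>Q\<^esub> ?\<phi> ` H2 #>\<^bsub>Q\<^esub> k) (Q\<lparr>carrier := ?\<phi> ` H1\<rparr>)"
      unfolding conjugate_into_def by (elim bexE)
    then have sub: "inv\<^bsub>Q\<^esub> k <#\<^bsub>Q\<^esub> ?\<phi> ` H2 #>\<^bsub>Q\<^esub> k \<subseteq> ?\<phi> ` H1"
      using subgroup.subset by fastforce
    obtain \<kappa> where \<kappa>: "k = e \<kappa>" "\<kappa> \<in> Bij \<Omega>"
      using k(1) bij_betw_imp_surj_on[OF Q(4)] unfolding N by blast
    have \<kappa>\<Omega>: "\<kappa> z0 \<in> \<Omega>" using Bij_imp_funcset[OF \<kappa>(2)] z0(1) by (rule funcset_mem)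
    have "act h (\<kappa> z0) = \<kappa> z0" if h: "h \<in> H2" for h
    proof -
      have hc: "h \<in> carrier G" using h H by blast
      have \<phi>h: "?\<phi> h \<in> carrier Q" using \<phi> hc by (rule hom_in_carrier)
      have "inv\<^bsub>Q\<^esub> k \<otimes>\<^bsub>Q\<^esub> ?\<phi> h \<otimes>\<^bsub>Q\<^esub> k \<in> inv\<^bsub>Q\<^esub> k <#\<^bsub>Q\<^esub> ?\<phi> ` H2 #>\<^bsub>Q\<^esub> k"
        unfolding l_coset_def r_coset_def using h by blast
      then have "inv\<^bsub>Q\<^esub> k \<otimes>\<^bsub>Q\<^esub> ?\<phi> h \<otimes>\<^bsub>Q\<^esub> k \<in> ?\<phi> ` H1" using sub by blast
      then obtain h1 where h1: "inv\<^bsub>Q\<^esub> k \<otimes>\<^bsub>Q\<^esub> ?\<phi> h \<otimes>\<^bsub>Q\<^esub> k = ?\<phi> h1" "h1 \<in> H1" by (rule imageE)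
      have h1c: "h1 \<in> carrier G" using h1 H by blast
      have "k \<otimes>\<^bsub>Q\<^esub> ?\<phi> h1 = ?\<phi> h \<otimes>\<^bsub>Q\<^esub> k"
        unfolding h1(1)[symmetric] using k(1) \<phi>h by (simp add: Q.m_assoc[symmetric])
      then have "e (\<kappa> \<otimes>\<^bsub>N\<^esub> \<psi> h1) = e (\<psi> h \<otimes>\<^bsub>N\<^esub> \<kappa>)"
        using hom_mult[OF Q(3)] \<kappa> \<psi>[OF hc] \<psi>[OF h1c] by (simp add: N)
      moreover have "\<kappa> \<otimes>\<^bsub>N\<^esub> \<psi> h1 \<in> carrier N" "\<psi> h \<otimes>\<^bsub>N\<^esub> \<kappa> \<in> carrier N"
        using \<kappa>(2) \<psi>[OF hc] \<psi>[OF h1c] by (simp_all add: N compose_Bij)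
      ultimately have "\<kappa> \<otimes>\<^bsub>N\<^esub> \<psi> h1 = \<psi> h \<otimes>\<^bsub>N\<^esub> \<kappa>"
        using bij_betw_imp_inj_on[OF Q(4)] by (simp add: inj_on_eq_iff)
      then have "compose \<Omega> \<kappa> (\<psi> h1) z0 = compose \<Omega> (\<psi> h) \<kappa> z0"
        using \<kappa>(2) \<psi>[OF hc] \<psi>[OF h1c] by (simp add: N)
      then show ?thesis using z0 h1(2) \<kappa>\<Omega> by (simp add: compose_def \<psi>_def)
    qed
    then show False using no_fix \<kappa>\<Omega> by blast
  qed
  then show ?thesis using Q(1,2) \<phi> by (intro exI[of _ Q] exI[of _ ?\<phi>] conjI)
qed

section \<open>Stabilizers of cosets\<close>

lemma (in group) acts_cosets:
  assumes "subgroup H G"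
  shows "acts G (carrier G) (\<lambda>g C. g <# C) ((\<lambda>g. g <# H) ` carrier G)"
  unfolding acts_def
  using lcos_m_assoc[OF subgroup.subset[OF assms]] by (auto simp: m_assoc)

lemma (in group) coset_fixed_iff:
  assumes H: "subgroup H G" and "g \<in> carrier G" "a \<in> carrier G"
  shows "a <# (g <# H) = g <# H \<longleftrightarrow> inv g \<otimes> (a \<otimes> g) \<in> H"
proof -
  have 1: "a <# (g <# H) = (a \<otimes> g) <# H"
    using lcos_m_assoc[OF subgroup.subset[OF H]] assms by simp
  have 2: "inv g <# (g <# H) = H"
    using lcos_m_assoc[OF subgroup.subset[OF H], of "inv g" g] lcos_mult_one[OF subgroup.subset[OF H]] assms
    by simp
  let ?b = "inv g \<otimes> (a \<otimes> g)"
  have b: "?b \<in> carrier G" "g \<otimes> ?b = a \<otimes> g" using assms by (simp_all add: m_assoc[symmetric])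
  show ?thesis
  proof
    assume "a <# (g <# H) = g <# H"
    then have "inv g <# ((a \<otimes> g) <# H) = H" using 1 2 by simp
    then have "?b <# H = H" using lcos_m_assoc[OF subgroup.subset[OF H], of "inv g" "a \<otimes> g"] assms by simp
    moreover have "?b \<otimes> \<one> \<in> ?b <# H"
      unfolding l_coset_def using subgroup.one_closed[OF H] by blast
    ultimately show "?b \<in> H" using b(1) by simp
  next
    assume "?b \<in> H"
    then have "?b <# H = H" using coset_join3[OF b(1) H] by simp
    then have "g <# (?b <# H) = g <# H" by simp
    then show "a <# (g <# H) = g <# H"
      using 1 b lcos_m_assoc[OF subgroup.subset[OF H], of g ?b] assms by simp
  qed
qed

lemma (in group) fixes_generate:
  assumes act: "acts G (carrier G) act \<Omega>" and S: "S \<subseteq> carrier G"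
    and z: "z \<in> \<Omega>" "\<forall>h\<in>S. act h z = z" and h: "h \<in> generate G S"
  shows "act h z = z"
  using h
proof (induction h rule: generate.induct)
  case one
  then show ?case by (rule acts_one[OF act z(1)])
next
  case (incl h)
  then show ?case using z by simp
next
  case (inv h)
  then have "h \<in> carrier G" using S by blast
  then show ?case using acts_inv(1)[OF act subgroup_self _ z(1), of h] z(2) inv by simp
next
  case (eng h1 h2)
  then have "h1 \<in> carrier G" "h2 \<in> carrier G" using generate_in_carrier[OF S] by blast+
  then show ?case using acts_mult[OF act _ _ z(1)] eng by simp
qed

text \<open>The stabilizer of a coset is a conjugate of \<open>H\<close>. Used contrapositively: the
  generators of a subgroup that is not conjugate into \<open>H\<close> have no common fixed
  coset.\<close>

lemma (in group) conjugate_into_if_fixed_coset: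
  assumes S: "S \<subseteq> carrier G" and H: "subgroup H G" and g: "g \<in> carrier G"
    and fixed: "\<forall>h\<in>S. h <# (g <# H) = g <# H"
  shows "conjugate_into G (generate G S) H"
proof -
  let ?K = "generate G S"
  have K: "subgroup ?K G" by (rule generate_is_subgroup[OF S])
  have "inv g <# ?K #> g \<subseteq> H"
  proof
    fix x assume "x \<in> inv g <# ?K #> g"
    then obtain h where h: "h \<in> ?K" "x = inv g \<otimes> h \<otimes> g"
      unfolding l_coset_def r_coset_def by blast
    have hc: "h \<in> carrier G" using generate_in_carrier[OF S h(1)] .
    have "h <# (g <# H) = g <# H"
      by (rule fixes_generate[OF acts_cosets[OF H] S _ fixed h(1)]) (use g in blast)
    then show "x \<in> H" using coset_fixed_iff[OF H g hc] h g hc by (simp add: m_assoc)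
  qed
  then show ?thesis
    unfolding conjugate_into_def
    using subgroup_incl[OF subgroup_conjugation_is_surj1[OF g K] H] g by blast
qed

section \<open>The separating finite action for two given subgroups\<close>

context normalizer_tree
begin

theorem subgroup_into_conjugacy_separable_pi1: "subgroup_into_conjugacy_separable G"
  unfolding subgroup_into_conjugacy_separable_def
proof (intro allI impI, elim conjE)
  fix H1 H2 assume "fg_subgroup G H1" "fg_subgroup G H2" and not_conj: "\<not> conjugate_into G H2 H1"
  then obtain S1 S2 where S1: "finite S1" "S1 \<subseteq> carrier G" "H1 = generate G S1"
    and S2: "finite S2" "S2 \<subseteq> carrier G" "H2 = generate G S2"
    unfolding fg_subgroup_def by (elim exE conjE)
  have H1: "subgroup H1 G" unfolding S1(3) by (rule G.generate_is_subgroup[OF S1(2)])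
  define act where "act g C = g <#\<^bsub>G\<^esub> C" for g C
  define Y where "Y = (\<lambda>g. g <#\<^bsub>G\<^esub> H1) ` carrier G"
  have act: "acts G (carrier G) act Y" unfolding act_def Y_def by (rule G.acts_cosets[OF H1])
  have moved: "\<exists>h\<in>S2. act h y \<noteq> y" if y: "y \<in> Y" for y
  proof (rule ccontr)
    assume "\<not> ?thesis"
    then have "\<forall>h\<in>S2. act h y = y" by simp
    moreover obtain g where "y = g <#\<^bsub>G\<^esub> H1" "g \<in> carrier G" using y unfolding Y_def by (rule imageE)
    ultimately have "conjugate_into G H2 H1"
      unfolding S2(3) act_def by (intro G.conjugate_into_if_fixed_coset[OF S2(2) H1, of g]) simp_all
    then show False using not_conj by simp
  qed
  define p where "p = \<one>\<^bsub>G\<^esub> <#\<^bsub>G\<^esub> H1"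
  have pY: "p \<in> Y" unfolding p_def Y_def by blast
  \<comment> \<open>A generator of \<open>H2\<close> that moves the coset \<open>p\<close> is not
    the identity; this is the element that will have no fixed point in \<open>Q\<close>.\<close>
  obtain f where f: "f \<in> S2" "f \<noteq> \<one>\<^bsub>G\<^esub>"
    using moved[OF pY] acts_one[OF act pY] by metis
  \<comment> \<open>The points with a nontrivial stabilizer in some vertex group, finite in number
    by \<open>finite_fixed_cosets\<close>.\<close>
  define B0 where "B0 = (\<Union>v\<in>V. \<Union>a\<in>A v - {\<one>\<^bsub>G\<^esub>}. {y \<in> Y. act a y = y})"
  have "finite {y \<in> Y. act a y = y}" if "v \<in> V" "a \<in> A v - {\<one>\<^bsub>G\<^esub>}" for v a
  proof (rule finite_subset)
    show "finite ((\<lambda>g. g <#\<^bsub>G\<^esub> H1) ` {g \<in> carrier G. inv\<^bsub>G\<^esub> g \<otimes>\<^bsub>G\<^esub> (a \<otimes>\<^bsub>G\<^esub> g) \<in> H1})"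
      unfolding S1(3) using that by (intro finite_fixed_cosets[OF that(1) _ _ S1(1,2)]) simp_all
    have ac: "a \<in> carrier G" using that A_carrier by simp
    show "{y \<in> Y. act a y = y} \<subseteq>
        (\<lambda>g. g <#\<^bsub>G\<^esub> H1) ` {g \<in> carrier G. inv\<^bsub>G\<^esub> g \<otimes>\<^bsub>G\<^esub> (a \<otimes>\<^bsub>G\<^esub> g) \<in> H1}"
      using G.coset_fixed_iff[OF H1 _ ac] by (auto simp: Y_def act_def)
  qed
  then have finB0: "finite B0" unfolding B0_def using finite_V finite_A by simp
  obtain n where n: "S1 \<union> S2 \<subseteq> gball n"
    using ex_gball_finite[of "S1 \<union> S2"] S1 S2 by auto
  \<comment> \<open>With the ball around \<open>p\<close> included, the generators of
    \<open>H1\<close>, as words of length at most \<open>n\<close>, can be walked from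
    \<open>p\<close> without leaving the core.\<close>
  define B where "B = B0 \<union> (\<lambda>w. act w p) ` gball n"
  \<comment> \<open>A candidate fixed point near the core will be reached from \<open>B\<close> by a
    word of length \<open>n + 1\<close>, and a generator of \<open>H2\<close> adds \<open>n\<close>
    letters; \<open>m\<close> covers the total of \<open>2 * n + 1\<close>.\<close>
  define m where "m = 2 * n + 2"
  define B' where "B' = (\<Union>w\<in>gball m. act w ` B)"
  have actY: "act w y \<in> Y" if "w \<in> gball k" "y \<in> Y" for w k y
    using acts_closed[OF act gball_carrier[OF that(1)] that(2)] .
  have BY: "B \<subseteq> Y" using actY pY by (auto simp: B_def B0_def)
  have finB': "finite B'" using finB0 finite_gball by (simp add: B'_def B_def)
  have B'Y: "B' \<subseteq> Y" using actY BY by (auto simp: B'_def)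
  have B'I: "act w y \<in> B'" if "w \<in> gball m" "y \<in> B" for w y
    unfolding B'_def using that by blast
  have act_one: "act \<one>\<^bsub>G\<^esub> y = y" if "y \<in> Y" for y using acts_one[OF act that] .
  have BB': "B \<subseteq> B'"
  proof
    fix y assume "y \<in> B"
    then show "y \<in> B'" using B'I[OF one_gball] act_one BY by force
  qed
  have B0I: "y \<in> B0" if "v \<in> V" "a \<in> A v" "a \<noteq> \<one>\<^bsub>G\<^esub>" "y \<in> Y" "act a y = y" for v a y
    unfolding B0_def using that by blast
  have "\<exists>(\<Omega> :: (('v, 'e, 'a) letter list set set \<times> nat + ('v, 'e, 'a) letter list set \<times> nat) set) act' \<iota>.
    finite \<Omega> \<and> acts G (carrier G) act' \<Omega> \<and> \<iota> ` B' \<subseteq> \<Omega> \<and> inj_on \<iota> B' \<and>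
    (\<forall>v\<in>V. \<forall>a\<in>A v. \<forall>y\<in>B'. act a y \<in> B' \<longrightarrow> act' a (\<iota> y) = \<iota> (act a y))"
  proof (rule completion[OF act finB' B'Y])
    fix v a y assume "v \<in> V" "a \<in> A v" "a \<noteq> \<one>\<^bsub>G\<^esub>" "y \<in> Y" "act a y = y"
    then have "y \<in> B0" by (rule B0I)
    then show "y \<in> B'" using BB' by (auto simp: B_def)
  qed
  then obtain \<Omega>0 :: "(('v, 'e, 'a) letter list set set \<times> nat + ('v, 'e, 'a) letter list set \<times> nat) set"
    and act0 \<iota> where fin0: "finite \<Omega>0" and act0: "acts G (carrier G) act0 \<Omega>0"
    and \<iota>: "\<iota> ` B' \<subseteq> \<Omega>0" "inj_on \<iota> B'"
      "\<forall>v\<in>V. \<forall>a\<in>A v. \<forall>y\<in>B'. act a y \<in> B' \<longrightarrow> act0 a (\<iota> y) = \<iota> (act a y)"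
    by (elim exE conjE)
  have walk: "act0 w (\<iota> y) = \<iota> (act w y)" if y: "y \<in> B" and w: "w \<in> gball m" for y w
    using BY y by (intro partial_action_walk[OF act act0 B'Y \<iota>(1,3) _ _ w order_refl] ballI B'I) auto
  define C where "C = \<iota> ` B"
  have C\<Omega>: "C \<subseteq> \<Omega>0" using \<iota>(1) BB' by (auto simp: C_def)
  define N where "N v = (\<Union>a\<in>A v. act0 a ` C)" for v
  have N_E: "\<exists>b\<in>A v. \<exists>y\<in>B. x = act0 b (\<iota> y)" if "x \<in> N v" for v x
    using that unfolding N_def C_def by blast
  have C_N: "x \<in> N v" if "v \<in> V" "x \<in> C" for v x
  proof -
    have "act0 \<one>\<^bsub>G\<^esub> x = x" using acts_one[OF act0] that C\<Omega> by blast
    then show ?thesis unfolding N_def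
      using subgroup.one_closed[OF A_subgroup[OF that(1)]] that(2) by (metis UN_I image_eqI)
  qed
  have A_ball: "a \<in> gball m" if "v \<in> V" "a \<in> A v" for v a
    using gball_mono[OF _ A_gball[OF that], of m] by (simp add: m_def)
  \<comment> \<open>Points of \<open>N v\<close> are images of cosets in \<open>B'\<close>, and
    \<open>\<iota>\<close> is injective there, so a point fixed by \<open>a\<close> comes from a
    coset fixed by \<open>a\<close>. Such a coset is in \<open>B0\<close>, so the point is in
    \<open>C\<close> and hence in every \<open>N w\<close>.\<close>
  have free1: "a = \<one>\<^bsub>G\<^esub>"
    if vw: "v \<in> V" "w \<in> V" and x: "x \<in> N v" "x \<notin> N w" and a: "a \<in> A v" "act0 a x = x" for v w x a
  proof (rule ccontr)
    assume a1: "a \<noteq> \<one>\<^bsub>G\<^esub>"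
    obtain b y where yb: "b \<in> A v" "y \<in> B" "x = act0 b (\<iota> y)" using N_E[OF x(1)] by (elim bexE)
    have y: "y \<in> Y" "\<iota> y \<in> \<Omega>0" using yb BY C\<Omega> by (auto simp: C_def)
    have xb: "x = \<iota> (act b y)" using walk[OF yb(2) A_ball[OF vw(1) yb(1)]] yb by simp
    have ab: "a \<otimes>\<^bsub>G\<^esub> b \<in> A v" using subgroup.m_closed[OF A_subgroup[OF vw(1)] a(1) yb(1)] .
    note ac = A_carrier[OF vw(1) a(1)] and bc = A_carrier[OF vw(1) yb(1)]
    have "act0 a x = act0 (a \<otimes>\<^bsub>G\<^esub> b) (\<iota> y)" using acts_mult[OF act0 ac bc y(2)] yb by simp
    also have "\<dots> = \<iota> (act (a \<otimes>\<^bsub>G\<^esub> b) y)" using walk[OF yb(2) A_ball[OF vw(1) ab]] .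
    finally have "\<iota> (act (a \<otimes>\<^bsub>G\<^esub> b) y) = \<iota> (act b y)" using a(2) xb by simp
    then have "act (a \<otimes>\<^bsub>G\<^esub> b) y = act b y"
      using inj_onD[OF \<iota>(2)] B'I[OF A_ball[OF vw(1) ab] yb(2)] B'I[OF A_ball[OF vw(1) yb(1)] yb(2)]
      by blast
    then have "act a (act b y) = act b y" using acts_mult[OF act ac bc y(1)] by simp
    then have "act b y \<in> B0"
      using B0I[OF vw(1) a(1) a1] acts_closed[OF act bc y(1)] by blast
    then have "x \<in> C" using xb by (auto simp: C_def B_def)
    then show False using C_N[OF vw(2)] x(2) by blast
  qed
  obtain Q :: "(('v, 'e, 'a) letter list set \<times> nat + ('v, 'e, 'a) letter list set \<times> nat \<Rightarrow>
      ('v, 'e, 'a) letter list set \<times> nat + ('v, 'e, 'a) letter list set \<times> nat) set" and actQ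
    where Q: "finite Q" "Q \<noteq> {}" "acts G (carrier G) actQ Q" "\<forall>q\<in>Q. actQ f q \<noteq> q"
    using fixed_point_free_action[OF subsetD[OF S2(2) f(1)] f(2)] by (elim exE conjE)
  let ?far = "\<lambda>x. x \<notin> (\<Union>v\<in>V. N v)"
  have "\<exists>act'. acts G (carrier G) act' (\<Omega>0 \<times> Q) \<and>
    (\<forall>g\<in>carrier G. \<forall>z\<in>\<Omega>0 \<times> Q. fst (act' g z) = act0 g (fst z)) \<and>
    (\<forall>v\<in>V. \<forall>a\<in>A v. \<forall>x\<in>C. \<forall>q\<in>Q. act0 a x \<in> C \<longrightarrow> act' a (x, q) = (act0 a x, q)) \<and>
    (\<forall>v\<in>V. \<forall>a\<in>A v. \<forall>x\<in>\<Omega>0. \<forall>q\<in>Q. ?far x \<longrightarrow> ?far (act0 a x) \<longrightarrow>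
      act' a (x, q) = (act0 a x, actQ a q))"
  proof (rule twisted_product[OF act0 Q(3) C\<Omega> N_def])
    fix e x a assume e: "e \<in> D" "a \<in> E e" "act0 a x = x"
      and x: "(x \<in> N (src e)) \<noteq> (x \<in> N (tgt e))"
    have st: "src e \<in> V" "tgt e \<in> V" "a \<in> A (src e)" "a \<in> A (tgt e)"
      using e E_src[OF e(1)] E_tgt[OF e(1)] by auto
    show "a = \<one>\<^bsub>G\<^esub>"
    proof (cases "x \<in> N (src e)")
      case True
      then show ?thesis using free1[OF st(1,2) True _ st(3) e(3)] x by simp
    next
      case False
      then show ?thesis using free1[OF st(2,1) _ False st(4) e(3)] x by simp
    qed
  qed
  then obtain act' where act': "acts G (carrier G) act' (\<Omega>0 \<times> Q)"
    and fst_act': "\<forall>g\<in>carrier G. \<forall>z\<in>\<Omega>0 \<times> Q. fst (act' g z) = act0 g (fst z)"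
    and near: "\<forall>v\<in>V. \<forall>a\<in>A v. \<forall>x\<in>C. \<forall>q\<in>Q. act0 a x \<in> C \<longrightarrow> act' a (x, q) = (act0 a x, q)"
    and far: "\<forall>v\<in>V. \<forall>a\<in>A v. \<forall>x\<in>\<Omega>0. \<forall>q\<in>Q. ?far x \<longrightarrow> ?far (act0 a x) \<longrightarrow>
      act' a (x, q) = (act0 a x, actQ a q)"
    by (elim exE conjE)
  obtain q0 where q0: "q0 \<in> Q" using Q(2) by blast
  have pB: "act w p \<in> B" if "w \<in> gball n" for w using that by (simp add: B_def)
  have pB1: "p \<in> B" using pB[OF one_gball] act_one[OF pY] by simp
  have z0: "(\<iota> p, q0) \<in> \<Omega>0 \<times> Q" using C\<Omega> pB1 q0 by (auto simp: C_def)
  \<comment> \<open>Within \<open>n\<close> steps of \<open>p\<close> the walk stays in the image of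
    the core, where the second coordinate does not change.\<close>
  have near_walk: "act' w (\<iota> p, q0) = (\<iota> (act w p), q0)" if "w \<in> gball k" "k \<le> n" for w k
    using that
  proof (induction k arbitrary: w)
    case 0
    then show ?case using acts_one[OF act' z0] act_one[OF pY] by simp
  next
    case (Suc k)
    from Suc.prems(1) obtain v a w' where w: "v \<in> V" "a \<in> A v" "w' \<in> gball k" "w = a \<otimes>\<^bsub>G\<^esub> w'"
      by (rule gball_Suc_E)
    note ac = A_carrier[OF w(1,2)] and wc = gball_carrier[OF w(3)]
    have IH: "act' w' (\<iota> p, q0) = (\<iota> (act w' p), q0)" using Suc.IH[OF w(3)] Suc.prems(2) by simp
    have aw: "act w p = act a (act w' p)" using acts_mult[OF act ac wc pY] w(4) by simp
    have B: "act w' p \<in> B" "act w p \<in> B"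
      using pB gball_mono[OF _ w(3), of n] gball_mono[OF Suc.prems(2,1)] Suc.prems(2) by simp_all
    have 1: "act0 a (\<iota> (act w' p)) = \<iota> (act w p)"
      using walk[OF B(1) A_ball[OF w(1,2)]] aw by simp
    have "act' w (\<iota> p, q0) = act' a (\<iota> (act w' p), q0)"
      using acts_mult[OF act' ac wc z0] w(4) IH by simp
    also have "\<dots> = (\<iota> (act w p), q0)"
      using near[rule_format, OF w(1,2), of "\<iota> (act w' p)" q0] 1 B q0 by (simp add: C_def)
    finally show ?case .
  qed
  have "act' h (\<iota> p, q0) = (\<iota> p, q0)" if h: "h \<in> H1" for h
  proof (rule G.fixes_generate[OF act' S1(2) z0 _ h[unfolded S1(3)]], intro ballI)
    fix s assume s: "s \<in> S1"
    then have "s \<in> carrier G" "s \<in> H1" using S1 by (auto intro: generate.incl)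
    then have "inv\<^bsub>G\<^esub> \<one>\<^bsub>G\<^esub> \<otimes>\<^bsub>G\<^esub> (s \<otimes>\<^bsub>G\<^esub> \<one>\<^bsub>G\<^esub>) \<in> H1" by simp
    then have "act s p = p"
      unfolding act_def p_def using G.coset_fixed_iff[OF H1 G.one_closed \<open>s \<in> carrier G\<close>] by blast
    then show "act' s (\<iota> p, q0) = (\<iota> p, q0)" using near_walk[of s n] s n by auto
  qed
  moreover have "\<exists>h\<in>H2. act' h z \<noteq> z" if z: "z \<in> \<Omega>0 \<times> Q" for z
  proof (rule ccontr)
    assume "\<not> ?thesis"
    then have fixed: "act' h z = z" if "h \<in> S2" for h using that S2(3) generate.incl by metis
    obtain x q where xq: "z = (x, q)" "x \<in> \<Omega>0" "q \<in> Q" using z by blast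
    have hc: "h \<in> carrier G" "h \<in> gball n" if "h \<in> S2" for h using that S2(2) n by auto
    have fixed0: "act0 h x = x" if "h \<in> S2" for h
      using fst_act'[rule_format, OF hc(1)[OF that] z] fixed[OF that] xq by simp
    show False
    \<comment> \<open>If \<open>x\<close> is near, it is the image of a coset in \<open>B'\<close>
      that would be fixed by all of \<open>S2\<close>, contrary to \<open>moved\<close>. Otherwise
      every word of length at most \<open>n\<close>, in particular \<open>f\<close>, acts on
      \<open>z\<close> by the product action.\<close>
    proof (cases "\<exists>w\<in>gball n. \<exists>v\<in>V. act0 w x \<in> N v")
      case True
      then obtain w v where w: "w \<in> gball n" "v \<in> V" "act0 w x \<in> N v" by (elim bexE)
      obtain b y where yb: "b \<in> A v" "y \<in> B" "act0 w x = act0 b (\<iota> y)" using N_E[OF w(3)] by (elim bexE)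
      have y: "y \<in> Y" "\<iota> y \<in> \<Omega>0" using yb BY C\<Omega> by (auto simp: C_def)
      note wc = gball_carrier[OF w(1)] and bc = A_carrier[OF w(2) yb(1)]
      let ?u = "inv\<^bsub>G\<^esub> w \<otimes>\<^bsub>G\<^esub> b"
      have u: "?u \<in> gball (n + 1)" using gball_mult[OF gball_inv[OF w(1)] A_gball[OF w(2) yb(1)]] .
      note uc = gball_carrier[OF u]
      have "x = act0 (inv\<^bsub>G\<^esub> w) (act0 b (\<iota> y))"
        using G.acts_inv(1)[OF act0 G.subgroup_self wc xq(2)] yb(3) by simp
      then have xu: "x = act0 ?u (\<iota> y)" using acts_mult[OF act0 G.inv_closed[OF wc] bc y(2)] by simp
      have um: "?u \<in> gball m" using gball_mono[OF _ u, of m] by (simp add: m_def)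
      have "act h (act ?u y) = act ?u y" if h: "h \<in> S2" for h
      proof -
        have hu: "h \<otimes>\<^bsub>G\<^esub> ?u \<in> gball m"
          using gball_mono[OF _ gball_mult[OF hc(2)[OF h] u], of m] by (simp add: m_def)
        have "\<iota> (act (h \<otimes>\<^bsub>G\<^esub> ?u) y) = act0 (h \<otimes>\<^bsub>G\<^esub> ?u) (\<iota> y)" using walk[OF yb(2) hu] by simp
        also have "\<dots> = act0 h x" using acts_mult[OF act0 hc(1)[OF h] uc y(2)] xu by simp
        also have "\<dots> = \<iota> (act ?u y)" using fixed0[OF h] xu walk[OF yb(2) um] by simp
        finally have "act (h \<otimes>\<^bsub>G\<^esub> ?u) y = act ?u y"
          using inj_onD[OF \<iota>(2)] B'I[OF hu yb(2)] B'I[OF um yb(2)] by blast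
        then show ?thesis using acts_mult[OF act hc(1)[OF h] uc y(1)] by simp
      qed
      then show False using moved[OF actY[OF um y(1)]] by blast
    next
      case False
      have far_walk: "act' w (x, q) = (act0 w x, actQ w q)" if "w \<in> gball k" "k \<le> n" for w k
        using that
      proof (induction k arbitrary: w)
        case 0
        then show ?case using acts_one[OF act' z] acts_one[OF act0 xq(2)] acts_one[OF Q(3) xq(3)] xq by simp
      next
        case (Suc k)
        from Suc.prems(1) obtain v a w' where w: "v \<in> V" "a \<in> A v" "w' \<in> gball k" "w = a \<otimes>\<^bsub>G\<^esub> w'"
          by (rule gball_Suc_E)
        note ac = A_carrier[OF w(1,2)] and wc = gball_carrier[OF w(3)]
        have IH: "act' w' (x, q) = (act0 w' x, actQ w' q)" using Suc.IH[OF w(3)] Suc.prems(2) by simp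
        have aw: "act0 w x = act0 a (act0 w' x)" "actQ w q = actQ a (actQ w' q)"
          using acts_mult[OF act0 ac wc xq(2)] acts_mult[OF Q(3) ac wc xq(3)] w(4) by simp_all
        have "w' \<in> gball n" "w \<in> gball n"
          using gball_mono[OF _ w(3), of n] gball_mono[OF Suc.prems(2,1)] Suc.prems(2) by simp_all
        then have fars: "?far (act0 w' x)" "?far (act0 a (act0 w' x))" using False aw(1) by auto
        have "act' w (x, q) = act' a (act0 w' x, actQ w' q)"
          using acts_mult[OF act' ac wc z] w(4) IH xq by simp
        also have "\<dots> = (act0 w x, actQ w q)"
          using far[rule_format, OF w(1,2) acts_closed[OF act0 wc xq(2)] acts_closed[OF Q(3) wc xq(3)] fars] aw
          by simp
        finally show ?case .
      qed
      have "actQ f q = q" using far_walk[OF hc(2)[OF f(1)] order_refl] fixed[OF f(1)] xq by simp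
      then show False using Q(4) xq(3) by blast
    qed
  qed
  moreover have "finite (\<Omega>0 \<times> Q)" using fin0 Q(1) by simp
  moreover have "H2 \<subseteq> carrier G" unfolding S2(3) by (rule G.generate_incl[OF S2(2)])
  ultimately show "\<exists>(Q :: nat monoid) \<phi>. group Q \<and> finite (carrier Q) \<and> \<phi> \<in> hom G Q \<and>
    \<not> conjugate_into Q (\<phi> ` H2) (\<phi> ` H1)"
    using z0 by (intro G.finite_action_separates[OF act' _ subgroup.subset[OF H1]] ballI)
qed

end

theorem theorem1p9:
  fixes X :: "('v, 'e, 'a, 'b) graph_of_groups"
  assumes "graph_of_groups X"
    and "fin_digraph (base_graph X)"
    and "serre_tree (base_graph X) (edge_inv X)"
    and "\<And>v. v \<in> verts (base_graph X) \<Longrightarrow> finite (carrier (vertex_group X v))"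
    and "normalizer_condition X (arcs (base_graph X))"
  shows "subgroup_into_conjugacy_separable (pi1 X (arcs (base_graph X)))"
proof -
  interpret normalizer_tree X
    by (intro normalizer_tree.intro tree_of_finite_groups.intro tree_of_finite_groups_axioms.intro
      normalizer_tree_axioms.intro) (use assms in simp_all)
  show ?thesis by (rule subgroup_into_conjugacy_separable_pi1)
qed

end
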